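(* Let $d\ge1$ be an integer, $\alpha>0$, $0<\gamma\le d$ and $0<r<\infty$. Suppose that for some $s_*>0$ there is a constant $C$ such that $$\Big\| \sup_{0<t<1} |e^{it(-\Delta)^{\alpha/2}}f| \Big\|_{L^{2}(B(0,1),d\mu)}\le C\,\langle \mu\rangle_\gamma^{1/2}\, \|f\|_{H^{\frac{d-\gamma}2+s_*}(\mathbb R^d)}$$ for all $f$ and all $\gamma$-dimensional measures $\mu$ in $\mathbb R^d$. Let $$\tilde s_*=\frac{r\alpha}{r\min\{\alpha,1\}+2s_*}\,s_*.$$ Let $\{t_n\}_{n\in\mathbb N} \in \ell^{r,\infty}(\mathbb N)$. Then for every $s\ge\min\{ s_*, \tilde s_*\}$ there is a constant $C'>0$ such that $$\Big\|\sup_{n\in\mathbb{N}} |e^{it_n(-\Delta)^{\alpha/2}}f| \Big\|_{L^{2}(B(0,1),d\mu)}\le C' \,\langle \mu\rangle_\gamma^{1/2}\, \|f\|_{H^{\frac{d-\gamma}2+s}(\mathbb R^d)}$$ for all $f$ and all $\gamma$-dimensional measures $\mu$ in $\mathbb R^d$.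
   Context: For $\alpha>0$, $e^{it(-\Delta)^{\alpha/2}}f(x) = (2\pi)^{-d} \int_{\mathbb{R}^d} e^{i(x\cdot \xi+t|\xi|^\alpha)} \widehat f(\xi)\, d\xi$. $H^s(\mathbb R^d)$ has norm $\|f\|_{H^s} = \| (1+|\cdot|^2)^{s/2} \widehat{f}\, \|_{L^2(\mathbb R^d)}$. $B(x,\rho)=\{y\in\mathbb R^d:|x-y|<\rho\}$. A nonnegative Borel measure $\mu$ on $\mathbb R^d$ is $\gamma$-dimensional if there is a constant $C_\mu$ with $\mu(B(x,\rho))\le C_\mu \rho^\gamma$ for all $x\in\mathbb R^d$, $\rho>0$; $\langle\mu\rangle_\gamma$ denotes the infimum of such constants $C_\mu$. For $0<r<\infty$, $\ell^{r,\infty}(\mathbb N)$ is the set of real sequences $\{t_n\}$ with $\sup_{\delta>0} \delta^r\, \#\{ n \in \mathbb N: |t_n| \ge \delta \} <\infty$. Convention: the estimates are understood for Schwartz functions $f$, so that $e^{it(-\Delta)^{\alpha/2}}f(x)$ is defined at every point. *)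

theory Defs
  imports "HOL-Analysis.Analysis"
begin

text \<open>Multi-indices are encoded as lists of coordinate directions, differentiated from the right.\<close>

primrec iter_partial :: "'n::finite list \<Rightarrow> (real^'n \<Rightarrow> complex) \<Rightarrow> real^'n \<Rightarrow> complex" where
  "iter_partial [] f = f"
| "iter_partial (i # is) f = (\<lambda>x. frechet_derivative (iter_partial is f) (at x) (axis i 1))"

text \<open>The differentiability clause matters, since \<^const>\<open>frechet_derivative\<close> is unspecified
  at points of non-differentiability; over all lists it says that \<open>f\<close> is smooth.\<close>

definition schwartz :: "(real^'n::finite \<Rightarrow> complex) \<Rightarrow> bool" where
  "schwartz f \<longleftrightarrow>
     (\<forall>is x. iter_partial is f differentiable (at x)) \<and>
     (\<forall>is k::nat. \<exists>B. \<forall>x. (1 + norm x) ^ k * cmod (iter_partial is f x) \<le> B)"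

text \<open>The normalisation without a prefactor is the one matching the factor \<open>(2\<pi>)\<^sup>-\<^sup>d\<close> in
  the propagator.\<close>

definition fourier :: "(real^'n::finite \<Rightarrow> complex) \<Rightarrow> real^'n \<Rightarrow> complex" where
  "fourier f \<xi> = (LINT x|lborel. cis (- (x \<bullet> \<xi>)) * f x)"

definition propagator ::
    "real \<Rightarrow> real \<Rightarrow> (real^'n::finite \<Rightarrow> complex) \<Rightarrow> real^'n \<Rightarrow> complex" where
  "propagator \<alpha> t f x =
     of_real (1 / (2 * pi) ^ CARD('n)) *
     (LINT \<xi>|lborel. cis (x \<bullet> \<xi> + t * norm \<xi> powr \<alpha>) * fourier f \<xi>)"

definition ennreal_sqrt :: "ennreal \<Rightarrow> ennreal" where
  "ennreal_sqrt x = (if x = \<infinity> then \<infinity> else ennreal (sqrt (enn2real x)))"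

definition L2_norm_on :: "'a measure \<Rightarrow> 'a set \<Rightarrow> ('a \<Rightarrow> ennreal) \<Rightarrow> ennreal" where
  "L2_norm_on M A F = ennreal_sqrt (\<integral>\<^sup>+x\<in>A. (F x)\<^sup>2 \<partial>M)"

definition sobolev_norm :: "real \<Rightarrow> (real^'n::finite \<Rightarrow> complex) \<Rightarrow> ennreal" where
  "sobolev_norm s f =
     L2_norm_on lborel UNIV
       (\<lambda>\<xi>. ennreal ((1 + (norm \<xi>)\<^sup>2) powr (s / 2) * cmod (fourier f \<xi>)))"

text \<open>Negative \<open>C\<close> must be excluded explicitly because \<^const>\<open>ennreal\<close> truncates at \<open>0\<close>.\<close>

definition ball_growth_constants :: "real \<Rightarrow> (real^'n::finite) measure \<Rightarrow> real set" where
  "ball_growth_constants \<gamma> \<mu> =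
     {C. 0 \<le> C \<and> (\<forall>x \<rho>. 0 < \<rho> \<longrightarrow> emeasure \<mu> (ball x \<rho>) \<le> ennreal (C * \<rho> powr \<gamma>))}"

definition gamma_dimensional :: "real \<Rightarrow> (real^'n::finite) measure \<Rightarrow> bool" where
  "gamma_dimensional \<gamma> \<mu> \<longleftrightarrow> sets \<mu> = sets borel \<and> ball_growth_constants \<gamma> \<mu> \<noteq> {}"

definition dim_const :: "real \<Rightarrow> (real^'n::finite) measure \<Rightarrow> real" where
  "dim_const \<gamma> \<mu> = Inf (ball_growth_constants \<gamma> \<mu>)"

text \<open>Finiteness of the level sets is part of finiteness of the supremum, but
  \<^const>\<open>card\<close> is \<open>0\<close> on infinite sets.\<close>

definition weak_ell :: "real \<Rightarrow> (nat \<Rightarrow> real) set" where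
  "weak_ell r =
     {t. (\<forall>\<delta>>0. finite {n. \<delta> \<le> \<bar>t n\<bar>}) \<and>
         bdd_above ((\<lambda>\<delta>. \<delta> powr r * real (card {n. \<delta> \<le> \<bar>t n\<bar>})) ` {0<..})}"

end

theory Submission
  imports Defs "HOL-Probability.Characteristic_Functions" "HOL-Real_Asymp.Real_Asymp"
begin

text \<open>
  Write \<open>U F(x, t) = \<integral> exp (i (x \<cdot> \<xi> + t |\<xi>|^\<alpha>)) F(\<xi>) d\<xi>\<close> for the wave with frequency profile \<open>F\<close>, put
  \<open>\<theta> = min \<alpha> 1\<close>, \<open>\<kappa> = d - \<gamma>\<close>, \<open>s\<^sub>0 = s_star\<close> and \<open>S = r \<alpha> s\<^sub>0 / (r \<theta> + 2 s\<^sub>0)\<close>. If \<open>S \<ge> s\<^sub>0\<close> there is little to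
  do: a sequence in weak \<open>\<ell>^r\<close> is bounded, and a bounded time interval is covered by finitely many
  translates of \<open>(0, 1)\<close>. Assume \<open>S < s\<^sub>0\<close>.

  The hypothesis has a short-time version. For profiles of frequency at most \<open>R\<close>, for
  \<open>1 \<le> N \<le> R\<close> and for times \<open>|t| \<le> N^\<theta> R^(-\<alpha>)\<close>, the maximal function is bounded in \<open>L\<^sup>2(\<mu>)\<close> with
  constant \<open>R^(\<kappa>/2) N^s\<^sub>0\<close> instead of \<open>R^(\<kappa>/2 + s\<^sub>0)\<close> (\<open>local_maximal_estimate\<close>). Indeed the dilation
  \<open>x \<mapsto> l x\<close> with \<open>l = R / N\<close> turns the frequencies into frequencies of size \<open>N\<close> and the times into
  times of size at most \<open>min 1 (N^(1-\<alpha>))\<close>, during which a wave of frequency \<open>N\<close> travels a bounded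
  distance. The estimate on unit balls can therefore be applied separately on each ball of
  radius \<open>1/l\<close>, and the pieces are almost orthogonal. To make this precise, the phase
  \<open>x \<cdot> \<zeta> + t |\<zeta>|^\<alpha>\<close> is compared with its value at a frequency \<open>\<omega>\<close> at distance less than \<open>l\<close>. On a ball
  of radius \<open>1/l\<close> around \<open>z\<close> the two differ, apart from \<open>z \<cdot> (\<zeta> - \<omega>)\<close>, which does not involve
  \<open>(x, t)\<close>, by a bounded sum of products of a function of \<open>(x, t)\<close> and a function of \<open>(\<zeta>, \<omega>)\<close>.
  Taylor expansion removes such products at the cost of a constant (\<open>phase_factors\<close>), and what
  remains is the wave at \<open>x - z\<close> whose profile at \<open>\<omega>\<close> is a Fourier integral of \<open>F\<close> over the ball of
  radius \<open>l\<close> around \<open>\<omega>\<close>, evaluated at \<open>z\<close>. By \<open>local_Bessel\<close> the energies of these profiles are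
  integrable in \<open>z\<close>.
  The case \<open>N = 1\<close> contains the fixed-time estimate with constant \<open>R^(\<kappa>/2)\<close>.

  For a single frequency \<open>R\<close> the times are split at \<open>R^(-a)\<close> with \<open>a = 2 S / r\<close>. There are only
  \<open>O(R^(a r)) = O(R^(2 S))\<close> larger times, each costing \<open>R^\<kappa>\<close> in the square, and the smaller ones
  are covered by the short-time estimate with \<open>N = R^(S / s\<^sub>0)\<close>, which costs \<open>R^(\<kappa> + 2 S)\<close> too. Both
  estimates improve geometrically away from \<open>|t| = R^(-a)\<close>. This room is stored in the weight
  \<open>freq_weight\<close>, whose sum over dyadic \<open>R\<close> is bounded uniformly in \<open>t\<close>, so that the Cauchy-Schwarz
  inequality sums the dyadic pieces without any loss and the endpoint \<open>s = S\<close> is reached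
  (\<open>single_frequency_estimate\<close>, \<open>dyadic_assembly\<close>).

  All of this needs the hypothesis for profiles that are merely bounded, measurable and of bounded
  support, because cutting off and modulating by \<open>t |\<xi>|^\<alpha>\<close> destroys smoothness. Such a profile is
  reached from Schwartz functions by multiplying its Fourier integral by a wide Gaussian
  (\<open>maximal_bound_tame\<close>).
\<close>

section \<open>Square roots, suprema and ball growth constants\<close>

lemma ennreal_sqrt_square: "(ennreal_sqrt x)\<^sup>2 = x"
proof (cases x)
  case (real r)
  then show ?thesis by (simp add: ennreal_sqrt_def ennreal_power)
next
  case top
  then show ?thesis by (simp add: ennreal_sqrt_def power2_eq_square)
qed

lemma ennreal_power2_mono_iff: "(a::ennreal)\<^sup>2 \<le> b\<^sup>2 \<longleftrightarrow> a \<le> b"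
  by (cases a; cases b) (auto simp: ennreal_power top_unique power_mono_iff)

lemma ennreal_sqrt_le_iff:
  assumes "0 \<le> c"
  shows "ennreal_sqrt x \<le> ennreal c * ennreal_sqrt y \<longleftrightarrow> x \<le> ennreal (c\<^sup>2) * y"
  unfolding ennreal_power2_mono_iff[symmetric, of "ennreal_sqrt x"]
  by (simp add: power_mult_distrib ennreal_sqrt_square assms ennreal_power)

text \<open>Multiplication by a constant commutes with suprema, so the square of a supremum is a
  double supremum, and it is dominated by its diagonal.\<close>

lemma SUP_ennreal_square:
  fixes f :: "nat \<Rightarrow> ennreal"
  shows "(SUP n. f n)\<^sup>2 = (SUP n. (f n)\<^sup>2)"
proof (rule antisym)
  have "(SUP n. f n)\<^sup>2 = (SUP n. SUP m. f n * f m)"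
    unfolding power2_eq_square SUP_mult_left_ennreal[symmetric] SUP_mult_right_ennreal[symmetric] ..

  also have "\<dots> \<le> (SUP n. (f n)\<^sup>2)"
  proof (intro SUP_least)
    fix n m
    have "f n * f m \<le> (max (f n) (f m))\<^sup>2" by (simp add: power2_eq_square mult_mono)
    also have "\<dots> = (f n)\<^sup>2 \<or> (max (f n) (f m))\<^sup>2 = (f m)\<^sup>2" by (simp add: max_def)
    then have "(max (f n) (f m))\<^sup>2 \<le> (SUP n. (f n)\<^sup>2)" by (metis SUP_upper UNIV_I)
    finally show "f n * f m \<le> (SUP n. (f n)\<^sup>2)" .
  qed
  finally show "(SUP n. f n)\<^sup>2 \<le> (SUP n. (f n)\<^sup>2)" .
qed (intro SUP_least power_mono SUP_upper, auto)

lemma dim_const_nonneg: "gamma_dimensional \<gamma> \<mu> \<Longrightarrow> 0 \<le> dim_const \<gamma> \<mu>"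
  unfolding dim_const_def gamma_dimensional_def
  by (intro cInf_greatest) (auto simp: ball_growth_constants_def)

lemma dim_const_le: "D \<in> ball_growth_constants \<gamma> \<mu> \<Longrightarrow> dim_const \<gamma> \<mu> \<le> D"
  unfolding dim_const_def
  by (rule cInf_lower) (auto simp: ball_growth_constants_def intro!: bdd_belowI[of _ 0])

text \<open>The growth condition is closed in the constant, so the infimum is itself admissible. Hence
  all later estimates can be stated with an arbitrary admissible constant.\<close>

lemma dim_const_attained:
  assumes "gamma_dimensional \<gamma> \<mu>"
  shows "dim_const \<gamma> \<mu> \<in> ball_growth_constants \<gamma> \<mu>"
  unfolding ball_growth_constants_def
proof (intro CollectI conjI allI impI)
  show "0 \<le> dim_const \<gamma> \<mu>" by (rule dim_const_nonneg[OF assms])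
  fix x and \<rho> :: real assume \<rho>: "0 < \<rho>"
  have *: "emeasure \<mu> (ball x \<rho>) \<le> ennreal ((dim_const \<gamma> \<mu> + 1 / real (Suc n)) * \<rho> powr \<gamma>)" for n
  proof -
    have ne: "ball_growth_constants \<gamma> \<mu> \<noteq> {}" using assms by (simp add: gamma_dimensional_def)
    obtain C where C: "C \<in> ball_growth_constants \<gamma> \<mu>" "C < dim_const \<gamma> \<mu> + 1 / real (Suc n)"
      using cInf_lessD[OF ne, of "dim_const \<gamma> \<mu> + 1 / real (Suc n)"]
      by (auto simp: dim_const_def)
    have "emeasure \<mu> (ball x \<rho>) \<le> ennreal (C * \<rho> powr \<gamma>)"
      using C(1) \<rho> by (auto simp: ball_growth_constants_def)
    also have "\<dots> \<le> ennreal ((dim_const \<gamma> \<mu> + 1 / real (Suc n)) * \<rho> powr \<gamma>)"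
      using C(2) by (intro ennreal_leI mult_right_mono) auto
    finally show ?thesis .
  qed
  have "(\<lambda>n. (dim_const \<gamma> \<mu> + 1 / real (Suc n)) * \<rho> powr \<gamma>) \<longlonglongrightarrow> (dim_const \<gamma> \<mu> + 0) * \<rho> powr \<gamma>"
    by (intro tendsto_intros LIMSEQ_inverse_real_of_nat[unfolded inverse_eq_divide])
  then have "(\<lambda>n. ennreal ((dim_const \<gamma> \<mu> + 1 / real (Suc n)) * \<rho> powr \<gamma>))
      \<longlonglongrightarrow> ennreal (dim_const \<gamma> \<mu> * \<rho> powr \<gamma>)"
    by (simp add: tendsto_ennrealI)
  then show "emeasure \<mu> (ball x \<rho>) \<le> ennreal (dim_const \<gamma> \<mu> * \<rho> powr \<gamma>)"
    by (rule LIMSEQ_le_const) (use * in auto)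
qed

section \<open>Gaussians\<close>

definition gauss :: "'a::euclidean_space \<Rightarrow> real" where
  "gauss x = (\<Prod>b\<in>Basis. std_normal_density (x \<bullet> b))"

lemma gauss_eq: "gauss (x::'a::euclidean_space) = (2 * pi) powr (- real DIM('a) / 2) * exp (- (norm x)\<^sup>2 / 2)"
proof -
  have "gauss x = (\<Prod>b\<in>(Basis::'a set). 1 / sqrt (2 * pi)) * exp (\<Sum>b\<in>Basis. - (x \<bullet> b)\<^sup>2 / 2)"
    unfolding gauss_def std_normal_density_def prod.distrib by (simp add: exp_sum)
  also have "(\<Sum>b\<in>Basis. - (x \<bullet> b)\<^sup>2 / 2) = - (norm x)\<^sup>2 / 2"
    unfolding power2_norm_eq_inner
    by (subst euclidean_inner) (simp add: sum_negf sum_divide_distrib power2_eq_square)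
  also have "(\<Prod>b\<in>(Basis::'a set). 1 / sqrt (2 * pi)) = (2 * pi) powr (- real DIM('a) / 2)"
  proof -
    have "(2 * pi) powr (- real DIM('a) / 2) = ((2 * pi) powr (- (1 / 2))) ^ DIM('a)"
      by (subst powr_power) auto
    also have "(2 * pi) powr (- (1 / 2)) = 1 / sqrt (2 * pi)"
      unfolding powr_minus by (subst powr_half_sqrt) (auto simp: inverse_eq_divide)
    finally show ?thesis by simp
  qed
  finally show ?thesis .
qed

lemma gauss_nonneg [simp]: "0 \<le> gauss x" by (simp add: gauss_eq)

lemma gauss_measurable [measurable]: "gauss \<in> borel_measurable borel"
  unfolding gauss_def[abs_def] by measurable

context begin
interpretation PL: product_sigma_finite "\<lambda>b::'a::euclidean_space. (lborel::real measure)"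
  by standard

text \<open>Lebesgue measure is the image of a product of one-dimensional Lebesgue measures, one for
  each basis vector.\<close>

lemma integral_lborel_prod_basis:
  fixes f :: "'a::euclidean_space \<Rightarrow> real \<Rightarrow> 'b::{real_normed_field,banach,second_countable_topology}"
  assumes f: "\<And>b. b \<in> Basis \<Longrightarrow> integrable lborel (f b)"
  shows "integrable lborel (\<lambda>x::'a. \<Prod>b\<in>Basis. f b (x \<bullet> b))"
    and "(LINT x|lborel. (\<Prod>b\<in>Basis. f b (x \<bullet> b))) = (\<Prod>b\<in>Basis. (LINT y|lborel. f b y))"
proof -
  have m[measurable]: "f b \<in> borel_measurable borel" if "b \<in> Basis" for b
    using borel_measurable_integrable[OF f[OF that]] by simp
  have M: "(\<lambda>x::'a. \<Prod>b\<in>Basis. f b (x \<bullet> b)) \<in> borel_measurable borel"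
    by (intro borel_measurable_prod measurable_compose[OF _ m]) auto
  have T: "(\<lambda>f. \<Sum>b\<in>Basis. f b *\<^sub>R b) \<in> (\<Pi>\<^sub>M b\<in>Basis. (lborel::real measure)) \<rightarrow>\<^sub>M (borel::'a measure)"
    by measurable
  have e: "(\<Prod>b\<in>Basis. f b ((\<Sum>c\<in>Basis. g c *\<^sub>R c) \<bullet> b)) = (\<Prod>b\<in>(Basis::'a set). f b (g b))" for g
    by (intro prod.cong refl) (simp add: inner_sum_left inner_Basis if_distrib sum.delta cong: if_cong)
  show "integrable lborel (\<lambda>x::'a. \<Prod>b\<in>Basis. f b (x \<bullet> b))"
    by (subst lborel_eq, subst integrable_distr_eq[OF T M], unfold e)
      (intro PL.product_integrable_prod f finite_Basis)
  show "(LINT x|lborel. (\<Prod>b\<in>Basis. f b (x \<bullet> b))) = (\<Prod>b\<in>Basis. (LINT y|lborel. f b y))"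
    by (subst lborel_eq, subst integral_distr[OF T M], unfold e)
      (intro PL.product_integral_prod f finite_Basis)
qed
end

lemma integrable_gauss: "integrable lborel (gauss :: 'a::euclidean_space \<Rightarrow> real)"
  unfolding gauss_def[abs_def] by (intro integral_lborel_prod_basis) auto

lemma integral_gauss: "(LINT x|lborel. gauss (x::'a::euclidean_space)) = 1"
  unfolding gauss_def[abs_def] by (subst integral_lborel_prod_basis(2)) (auto simp: integral_normal_density)

lemma cis_sum: "cis (\<Sum>b\<in>B. g b) = (\<Prod>b\<in>B. cis (g b))"
  by (induction B rule: infinite_finite_induct) (auto simp: cis_mult[symmetric])

text \<open>The integrand factors over the coordinates, and each factor is the characteristic function
  of the standard normal distribution.\<close>

lemma integral_cis_gauss:
  fixes u :: "'a::euclidean_space"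
  shows "(LINT x|lborel. cis (x \<bullet> u) * gauss x) = of_real (exp (- (norm u)\<^sup>2 / 2))"
proof -
  have one: "(LINT y|lborel. cis (y * t) * of_real (std_normal_density y)) = of_real (exp (- t\<^sup>2 / 2))"
    and int: "integrable lborel (\<lambda>y. cis (y * t) * complex_of_real (std_normal_density y))" for t
  proof -
    have "char std_normal_distribution t = (LINT y|lborel. std_normal_density y *\<^sub>R iexp (t * y))"
      unfolding char_def by (subst integral_density) auto
    also have "\<dots> = (LINT y|lborel. cis (y * t) * of_real (std_normal_density y))"
      by (simp add: cis_conv_exp scaleR_conv_of_real mult_ac)
    finally show "(LINT y|lborel. cis (y * t) * of_real (std_normal_density y)) = of_real (exp (- t\<^sup>2 / 2))"
      by (simp add: char_std_normal_distribution)
    show "integrable lborel (\<lambda>y. cis (y * t) * complex_of_real (std_normal_density y))"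
    proof (rule Bochner_Integration.integrable_bound)
      show "integrable lborel std_normal_density" by simp
      show "(\<lambda>y. cis (y * t) * complex_of_real (std_normal_density y)) \<in> borel_measurable lborel"
        unfolding cis_conv_exp by measurable
    qed (auto simp: norm_mult)
  qed
  have e: "cis (x \<bullet> u) * gauss x = (\<Prod>b\<in>Basis. cis ((x \<bullet> b) * (u \<bullet> b)) * of_real (std_normal_density (x \<bullet> b)))" for x
    unfolding gauss_def of_real_prod prod.distrib cis_sum[symmetric] by (subst euclidean_inner) simp
  have "(LINT x|lborel. cis (x \<bullet> u) * gauss x) = (\<Prod>b\<in>Basis. (LINT y|lborel. cis (y * (u \<bullet> b)) * of_real (std_normal_density y)))"
    unfolding e by (intro integral_lborel_prod_basis int)
  also have "\<dots> = of_real (exp (\<Sum>b\<in>Basis. - (u \<bullet> b)\<^sup>2 / 2))"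
    by (simp add: one exp_sum)
  also have "(\<Sum>b\<in>Basis. - (u \<bullet> b)\<^sup>2 / 2) = - (norm u)\<^sup>2 / 2"
    unfolding power2_norm_eq_inner
    by (subst euclidean_inner) (simp add: sum_negf sum_divide_distrib power2_eq_square)
  finally show ?thesis .
qed

lemma nn_integral_affine:
  fixes t :: "'a::euclidean_space"
  assumes [measurable]: "f \<in> borel_measurable borel" and c: "c \<noteq> 0"
  shows "(\<integral>\<^sup>+x. f x \<partial>lborel) = \<bar>c\<bar> ^ DIM('a) * (\<integral>\<^sup>+x. f (t + c *\<^sub>R x) \<partial>lborel)"
  by (subst lborel_affine[OF c, of t])
     (simp add: nn_integral_density nn_integral_distr nn_integral_cmult ennreal_power)

lemma integral_affine:
  fixes t :: "'a::euclidean_space" and f :: "'a \<Rightarrow> 'b::{banach,second_countable_topology}"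
  assumes [measurable]: "f \<in> borel_measurable borel" and c: "c \<noteq> 0"
  shows "(LINT x|lborel. f x) = \<bar>c\<bar> ^ DIM('a) *\<^sub>R (LINT x|lborel. f (t + c *\<^sub>R x))"
  by (subst lborel_affine[OF c, of t])
     (simp add: integral_density integral_distr)

lemma integrable_pair_dominated:
  fixes f :: "'a::euclidean_space \<times> 'b::euclidean_space \<Rightarrow> complex"
  assumes [measurable]: "f \<in> borel_measurable borel"
    and g: "integrable lborel g" and h: "integrable lborel h"
    and b: "\<And>x y. cmod (f (x, y)) \<le> g x * h y"
  shows "integrable (lborel \<Otimes>\<^sub>M lborel) f"
proof (rule Bochner_Integration.integrable_bound)
  have [measurable]: "g \<in> borel_measurable borel" "h \<in> borel_measurable borel"
    using borel_measurable_integrable[OF g] borel_measurable_integrable[OF h] by auto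
  show "integrable (lborel \<Otimes>\<^sub>M lborel) (\<lambda>(x, y). g x * h y)"
    by (rule lborel_pair.Fubini_integrable) (auto simp: abs_mult g h intro!: integrable_mult_left integrable_abs)
  show "f \<in> borel_measurable (lborel \<Otimes>\<^sub>M lborel)"
    by (simp add: lborel_prod)
  show "AE p in lborel \<Otimes>\<^sub>M lborel. cmod (f p) \<le> norm (case p of (x, y) \<Rightarrow> g x * h y)"
    using b order_trans[OF b abs_ge_self] by (auto simp: split_beta)
qed

lemma measurable_cis [measurable (raw)]:
  "f \<in> borel_measurable M \<Longrightarrow> (\<lambda>x. cis (f x)) \<in> borel_measurable M"
  unfolding cis_conv_exp by measurable

section \<open>Waves with bounded, compactly supported frequency profiles\<close>

lemma measurable_cnj [measurable (raw)]:
  "f \<in> borel_measurable M \<Longrightarrow> (\<lambda>x. cnj (f x)) \<in> borel_measurable M"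
  by (rule measurable_compose[OF _ borel_measurable_continuous_onI[OF continuous_on_cnj[OF continuous_on_id]]])

lemma integral_cnj':
  fixes f :: "'a \<Rightarrow> complex"
  shows "(LINT x|M. cnj (f x)) = cnj (LINT x|M. f x)"
  by (rule integral_bounded_linear'[OF bounded_linear_cnj bounded_linear_cnj]) simp

lemma norm_LINT_le:
  fixes f :: "'a \<Rightarrow> complex"
  shows "ennreal (cmod (LINT x|M. f x)) \<le> (\<integral>\<^sup>+x. ennreal (cmod (f x)) \<partial>M)"
  by (cases "integrable M f") (auto simp: integral_norm_bound_ennreal not_integrable_integral_eq)

lemma integrable_cis_mult:
  fixes F :: "'a \<Rightarrow> complex"
  assumes "integrable M F" and [measurable]: "g \<in> borel_measurable M"
  shows "integrable M (\<lambda>x. cis (g x) * F x)"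
proof (rule Bochner_Integration.integrable_bound[OF assms(1)])
  have [measurable]: "F \<in> borel_measurable M" by (rule borel_measurable_integrable[OF assms(1)])
  show "(\<lambda>x. cis (g x) * F x) \<in> borel_measurable M" by measurable
qed (simp add: norm_mult)

text \<open>The class of profiles in which all manipulations take place: every integral over it
  converges absolutely, and it is stable under bounded multipliers and cut-offs.\<close>

definition tame :: "(real^'n::finite \<Rightarrow> complex) \<Rightarrow> bool" where
  "tame F \<longleftrightarrow> F \<in> borel_measurable borel \<and> (\<exists>B. \<forall>\<xi>. cmod (F \<xi>) \<le> B) \<and> (\<exists>R. \<forall>\<xi>. R < norm \<xi> \<longrightarrow> F \<xi> = 0)"

lemma tame_measurable: "tame F \<Longrightarrow> F \<in> borel_measurable borel"
  by (simp add: tame_def)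

lemma tame_integrable:
  assumes "tame F" shows "integrable lborel F"
proof -
  obtain B R where B: "\<And>\<xi>. cmod (F \<xi>) \<le> B" and R: "\<And>\<xi>. R < norm \<xi> \<Longrightarrow> F \<xi> = 0"
    using assms unfolding tame_def by blast
  show ?thesis
  proof (rule Bochner_Integration.integrable_bound)
    show "integrable lborel (\<lambda>\<xi>. indicator (cball 0 R) \<xi> *\<^sub>R B)"
      using emeasure_lborel_cball_finite[of 0 R] by (intro integrable_scaleR_left) auto
    show "F \<in> borel_measurable lborel" using assms by (simp add: tame_def)
    show "AE \<xi> in lborel. cmod (F \<xi>) \<le> norm (indicator (cball 0 R) \<xi> *\<^sub>R B)"
      using B R by (auto simp: indicator_def not_le intro: order_trans[OF B abs_ge_self])
  qed
qed

lemma tame_mult: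
  assumes "tame F" and [measurable]: "g \<in> borel_measurable borel" and K: "\<And>\<xi>. cmod (g \<xi>) \<le> K"
  shows "tame (\<lambda>\<xi>. g \<xi> * F \<xi>)"
proof -
  have [measurable]: "F \<in> borel_measurable borel" using assms by (simp add: tame_def)
  obtain B R where B: "\<And>\<xi>. cmod (F \<xi>) \<le> B" and R: "\<And>\<xi>. R < norm \<xi> \<Longrightarrow> F \<xi> = 0"
    using assms unfolding tame_def by blast
  have "cmod (g \<xi> * F \<xi>) \<le> K * B" for \<xi>
    unfolding norm_mult using order_trans[OF norm_ge_zero K] by (intro mult_mono K B) auto
  then show ?thesis unfolding tame_def using R by auto
qed

lemma tame_mult_coord:
  assumes "tame F"
  shows "tame (\<lambda>\<xi>. \<i> * of_real (\<xi> $ i) * F \<xi>)"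
proof -
  have [measurable]: "F \<in> borel_measurable borel" using assms by (simp add: tame_def)
  obtain B R where B: "\<And>\<xi>. cmod (F \<xi>) \<le> B" and R: "\<And>\<xi>. R < norm \<xi> \<Longrightarrow> F \<xi> = 0"
    using assms unfolding tame_def by blast
  have "cmod (\<i> * of_real (\<xi> $ i) * F \<xi>) \<le> \<bar>R\<bar> * B" for \<xi>
  proof (cases "norm \<xi> > R")
    case False
    then have "\<bar>\<xi> $ i\<bar> \<le> \<bar>R\<bar>" using component_le_norm_cart[of \<xi> i] by linarith
    then show ?thesis unfolding norm_mult by (simp add: mult_mono B)
  next
    case True
    then show ?thesis using R B[of \<xi>] order_trans[OF norm_ge_zero B] by simp
  qed
  then show ?thesis unfolding tame_def using R by auto
qed

abbreviation energy :: "(real^'n::finite \<Rightarrow> complex) \<Rightarrow> ennreal" where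
  "energy F \<equiv> \<integral>\<^sup>+\<xi>. ennreal ((cmod (F \<xi>))\<^sup>2) \<partial>lborel"

definition wave :: "real \<Rightarrow> real \<Rightarrow> (real^'n::finite \<Rightarrow> complex) \<Rightarrow> real^'n \<Rightarrow> complex" where
  "wave \<alpha> t F x = (LINT \<xi>|lborel. cis (x \<bullet> \<xi> + t * norm \<xi> powr \<alpha>) * F \<xi>)"

text \<open>The inverse Fourier transform without its normalising constant.\<close>

definition synth :: "(real^'n::finite \<Rightarrow> complex) \<Rightarrow> real^'n \<Rightarrow> complex" where
  "synth F x = (LINT \<xi>|lborel. cis (x \<bullet> \<xi>) * F \<xi>)"

lemma wave_measurable [measurable (raw)]:
  assumes [measurable]: "F \<in> borel_measurable borel" "g \<in> borel_measurable M"
  shows "(\<lambda>p. wave \<alpha> t F (g p)) \<in> borel_measurable M"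
  unfolding wave_def by measurable

lemma synth_measurable [measurable (raw)]:
  assumes [measurable]: "F \<in> borel_measurable borel" "g \<in> borel_measurable M"
  shows "(\<lambda>p. synth F (g p)) \<in> borel_measurable M"
  unfolding synth_def by measurable

lemma norm_synth_le: "cmod (synth F x) \<le> (LINT \<xi>|lborel. cmod (F \<xi>))"
  unfolding synth_def by (rule order_trans[OF integral_norm_bound]) (simp add: norm_mult)

lemma integrable_affine:
  fixes t :: "'a::euclidean_space" and f :: "'a \<Rightarrow> 'b::{banach,second_countable_topology}"
  assumes f: "integrable lborel f" and c: "c \<noteq> 0"
  shows "integrable lborel (\<lambda>x. f (t + c *\<^sub>R x))"
proof -
  have [measurable]: "f \<in> borel_measurable borel" using borel_measurable_integrable[OF f] by simp
  have "(\<integral>\<^sup>+x. norm (f x) \<partial>lborel) = \<bar>c\<bar> ^ DIM('a) * (\<integral>\<^sup>+x. norm (f (t + c *\<^sub>R x)) \<partial>lborel)"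
    by (subst nn_integral_affine[OF _ c, of _ t]) (auto simp: ennreal_power)
  moreover have "(\<integral>\<^sup>+x. norm (f x) \<partial>lborel) < \<infinity>" using f by (simp add: integrable_iff_bounded)
  ultimately have "(\<integral>\<^sup>+x. norm (f (t + c *\<^sub>R x)) \<partial>lborel) < \<infinity>"
    using c by (auto simp: ennreal_mult_less_top ennreal_power[symmetric] power_0_left)
  then show ?thesis by (simp add: integrable_iff_bounded)
qed

lemma exp_eq_gauss:
  "exp (- (\<epsilon> * norm x)\<^sup>2 / 2) = (2 * pi) powr (real DIM('a) / 2) * gauss (\<epsilon> *\<^sub>R (x::'a::euclidean_space))"
proof -
  have "(2 * pi) powr (real DIM('a) / 2) * (2 * pi) powr (- real DIM('a) / 2) = 1"
    by (subst powr_add[symmetric]) auto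
  then show ?thesis unfolding gauss_eq by (simp add: power_mult_distrib mult.assoc[symmetric])
qed

lemma integrable_exp_square:
  assumes "\<epsilon> > 0"
  shows "integrable lborel (\<lambda>x::'a::euclidean_space. exp (- (\<epsilon> * norm x)\<^sup>2 / 2))"
  unfolding exp_eq_gauss
  using integrable_affine[OF integrable_gauss, of \<epsilon> "0::'a"] assms by simp

lemma integral_cis_exp_square:
  fixes u :: "real^'n::finite"
  assumes "\<epsilon> > 0"
  shows "(LINT x|lborel. cis (x \<bullet> u) * of_real (exp (- (\<epsilon> * norm x)\<^sup>2 / 2)))
    = of_real ((2 * pi) ^ CARD('n) * (1 / \<epsilon>) ^ CARD('n) * gauss ((1 / \<epsilon>) *\<^sub>R u))"
proof -
  have "(LINT x|lborel. cis (x \<bullet> u) * of_real (exp (- (\<epsilon> * norm x)\<^sup>2 / 2)))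
      = \<bar>1/\<epsilon>\<bar> ^ DIM(real^'n) *\<^sub>R (LINT y|lborel. cis ((0 + (1/\<epsilon>) *\<^sub>R y) \<bullet> u) * of_real (exp (- (\<epsilon> * norm (0 + (1/\<epsilon>) *\<^sub>R y))\<^sup>2 / 2)))"
    using assms by (intro integral_affine) auto
  also have "(LINT y|lborel. cis ((0 + (1/\<epsilon>) *\<^sub>R y) \<bullet> u) * of_real (exp (- (\<epsilon> * norm (0 + (1/\<epsilon>) *\<^sub>R y))\<^sup>2 / 2)))
      = (LINT y|lborel. of_real ((2 * pi) powr (real DIM(real^'n) / 2)) * (cis (y \<bullet> ((1/\<epsilon>) *\<^sub>R u)) * of_real (gauss y)))"
    unfolding exp_eq_gauss using assms by (simp add: mult_ac)
  also have "\<dots> = of_real ((2 * pi) powr (real DIM(real^'n) / 2)) * of_real (exp (- (norm ((1/\<epsilon>) *\<^sub>R u))\<^sup>2 / 2))"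
    by (subst integral_mult_right_zero, subst integral_cis_gauss) (rule refl)
  also have "exp (- (norm ((1/\<epsilon>) *\<^sub>R u))\<^sup>2 / 2) = (2 * pi) powr (real DIM(real^'n) / 2) * gauss ((1 / \<epsilon>) *\<^sub>R u)"
    using exp_eq_gauss[of 1 "(1/\<epsilon>) *\<^sub>R u"] by simp
  also have "of_real ((2 * pi) powr (real DIM(real^'n) / 2)) * of_real ((2 * pi) powr (real DIM(real^'n) / 2) * gauss ((1 / \<epsilon>) *\<^sub>R u))
     = of_real ((2 * pi) ^ CARD('n)) * (of_real (gauss ((1 / \<epsilon>) *\<^sub>R u)) :: complex)"
  proof -
    have "(2 * pi) powr (real CARD('n) / 2) * (2 * pi) powr (real CARD('n) / 2) = (2 * pi) ^ CARD('n)"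
      by (subst powr_add[symmetric]) (simp add: powr_realpow)
    then show ?thesis by (simp add: mult.assoc[symmetric] of_real_mult[symmetric] del: of_real_mult)
  qed
  finally show ?thesis using assms by (simp add: scaleR_conv_of_real mult_ac)
qed

text \<open>The factor \<open>(2 \<pi>)^(-d)\<close> of the propagator is compensated by the mass of the Gaussian in
  \<open>fourier_packet\<close>, so that \<open>packet \<epsilon> H\<close> evolves into an approximation of \<open>wave \<alpha> t H\<close>.\<close>

definition packet :: "real \<Rightarrow> (real^'n::finite \<Rightarrow> complex) \<Rightarrow> real^'n \<Rightarrow> complex" where
  "packet \<epsilon> H x = synth H x * of_real (exp (- (\<epsilon> * norm x)\<^sup>2 / 2))"

text \<open>Fubini, with the inner integral an explicit Gaussian: damping in space is averaging at
  scale \<open>\<epsilon>\<close> in frequency.\<close>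

lemma fourier_packet:
  fixes H :: "real^'n::finite \<Rightarrow> complex"
  assumes H: "tame H" and \<epsilon>: "\<epsilon> > 0"
  shows "fourier (packet \<epsilon> H) \<xi> = of_real ((2 * pi) ^ CARD('n)) * (LINT \<eta>|lborel. of_real (gauss \<eta>) * H (\<xi> + \<epsilon> *\<^sub>R \<eta>))"
proof -
  have [measurable]: "H \<in> borel_measurable borel" by (rule tame_measurable[OF H])
  define G where "G x = exp (- (\<epsilon> * norm x)\<^sup>2 / 2)" for x :: "real^'n"
  have [measurable]: "G \<in> borel_measurable borel" unfolding G_def[abs_def] by measurable
  have G: "integrable lborel G" unfolding G_def[abs_def] by (rule integrable_exp_square[OF \<epsilon>])
  define f where "f = (\<lambda>(x, \<omega>). cis (x \<bullet> (\<omega> - \<xi>)) * H \<omega> * of_real (G x))"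
  have fi: "integrable (lborel \<Otimes>\<^sub>M lborel) f"
  proof (rule integrable_pair_dominated)
    show "f \<in> borel_measurable borel" unfolding f_def borel_prod[symmetric] by measurable
    show "integrable lborel (\<lambda>x. \<bar>G x\<bar>)" "integrable lborel (\<lambda>\<omega>. cmod (H \<omega>))"
      using G tame_integrable[OF H] by auto
  qed (simp add: f_def norm_mult mult.commute)
  have "fourier (packet \<epsilon> H) \<xi> = (LINT x|lborel. LINT \<omega>|lborel. f (x, \<omega>))"
    unfolding fourier_def packet_def synth_def f_def G_def[symmetric]
  proof (intro Bochner_Integration.integral_cong refl)
    fix x :: "real^'n"
    have cs: "cis (x \<bullet> (\<omega> - \<xi>)) = cis (- (x \<bullet> \<xi>)) * cis (x \<bullet> \<omega>)" for \<omega>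
      by (simp add: cis_mult inner_diff_right)
    have "cis (- (x \<bullet> \<xi>)) * ((LINT \<omega>|lborel. cis (x \<bullet> \<omega>) * H \<omega>) * of_real (G x)) =
      (LINT \<omega>|lborel. (cis (- (x \<bullet> \<xi>)) * of_real (G x)) * (cis (x \<bullet> \<omega>) * H \<omega>))"
      by (subst integral_mult_right_zero) simp
    also have "\<dots> = (LINT \<omega>|lborel. (case (x, \<omega>) of (x, \<omega>) \<Rightarrow> cis (x \<bullet> (\<omega> - \<xi>)) * H \<omega> * of_real (G x)))"
      by (intro Bochner_Integration.integral_cong refl)
        (simp add: cs mult_ac)
    finally show "cis (- (x \<bullet> \<xi>)) * ((LINT \<omega>|lborel. cis (x \<bullet> \<omega>) * H \<omega>) * of_real (G x)) = \<dots>" .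
  qed
  also have "\<dots> = (LINT \<omega>|lborel. LINT x|lborel. f (x, \<omega>))"
    using fi by (intro lborel_pair.Fubini_integral[symmetric]) simp
  also have "\<dots> = (LINT \<omega>|lborel. H \<omega> * of_real ((2 * pi) ^ CARD('n) * (1 / \<epsilon>) ^ CARD('n) * gauss ((1 / \<epsilon>) *\<^sub>R (\<omega> - \<xi>))))"
  proof (intro Bochner_Integration.integral_cong refl)
    fix \<omega>
    have "(LINT x|lborel. f (x, \<omega>)) = (LINT x|lborel. H \<omega> * (cis (x \<bullet> (\<omega> - \<xi>)) * of_real (G x)))"
      by (simp add: f_def mult_ac)
    also have "\<dots> = H \<omega> * of_real ((2 * pi) ^ CARD('n) * (1 / \<epsilon>) ^ CARD('n) * gauss ((1 / \<epsilon>) *\<^sub>R (\<omega> - \<xi>)))"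
      unfolding G_def by (subst integral_mult_right_zero, subst integral_cis_exp_square[OF \<epsilon>]) (rule refl)
    finally show "(LINT x|lborel. f (x, \<omega>)) = \<dots>" .
  qed
  also have "\<dots> = \<bar>\<epsilon>\<bar> ^ DIM(real^'n) *\<^sub>R (LINT \<eta>|lborel. H (\<xi> + \<epsilon> *\<^sub>R \<eta>) * of_real ((2 * pi) ^ CARD('n) * (1 / \<epsilon>) ^ CARD('n) * gauss ((1 / \<epsilon>) *\<^sub>R ((\<xi> + \<epsilon> *\<^sub>R \<eta>) - \<xi>))))"
    using \<epsilon> by (intro integral_affine) auto
  also have "(LINT \<eta>|lborel. H (\<xi> + \<epsilon> *\<^sub>R \<eta>) * of_real ((2 * pi) ^ CARD('n) * (1 / \<epsilon>) ^ CARD('n) * gauss ((1 / \<epsilon>) *\<^sub>R ((\<xi> + \<epsilon> *\<^sub>R \<eta>) - \<xi>))))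
     = (LINT \<eta>|lborel. of_real ((2 * pi) ^ CARD('n) * (1 / \<epsilon>) ^ CARD('n)) * (of_real (gauss \<eta>) * H (\<xi> + \<epsilon> *\<^sub>R \<eta>)))"
    using \<epsilon> by (simp add: mult_ac)
  also have "\<dots> = of_real ((2 * pi) ^ CARD('n) * (1 / \<epsilon>) ^ CARD('n)) * (LINT \<eta>|lborel. of_real (gauss \<eta>) * H (\<xi> + \<epsilon> *\<^sub>R \<eta>))"
    by (rule integral_mult_right_zero)
  finally show ?thesis using \<epsilon>
    by (simp add: scaleR_conv_of_real power_one_over field_simps)
qed

text \<open>Half of the Plancherel theorem, localised to a ball. On \<open>ball 0 2\<close> the Gaussian
  \<open>exp (- |z|\<^sup>2 / 2)\<close> is at least \<open>exp (- 2)\<close>. With this weight the left-hand side becomes a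
  pairing of \<open>g\<close> with its own Gaussian average, which the inequality between geometric and
  arithmetic means bounds by the energy of \<open>g\<close>.\<close>

lemma local_Bessel:
  fixes g :: "real^'n::finite \<Rightarrow> complex"
  assumes g: "tame g"
  shows "(\<integral>\<^sup>+z\<in>ball 0 2. ennreal ((cmod (synth g z))\<^sup>2) \<partial>lborel)
    \<le> ennreal (exp 2 * (2 * pi) ^ CARD('n)) * (energy g)"
proof -
  have [measurable]: "g \<in> borel_measurable borel" by (rule tame_measurable[OF g])
  define G where "G x = exp (- (1 * norm x)\<^sup>2 / 2)" for x :: "real^'n"
  have [measurable]: "G \<in> borel_measurable borel" unfolding G_def[abs_def] by measurable
  have G: "integrable lborel G" unfolding G_def[abs_def] by (rule integrable_exp_square) simp
  have G0: "0 \<le> G x" for x by (simp add: G_def)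
  define A where "A = (LINT \<xi>|lborel. cmod (g \<xi>))"
  have A: "cmod (synth g z) \<le> A" for z unfolding A_def by (rule norm_synth_le)
  have A0: "0 \<le> A" using A[of 0] by (meson norm_ge_zero order_trans)
  define h where "h z = cnj (synth g z) * of_real (G z)" for z
  have [measurable]: "h \<in> borel_measurable borel" unfolding h_def[abs_def] by measurable
  have h: "integrable lborel (\<lambda>z. cmod (h z))"
  proof (rule Bochner_Integration.integrable_bound)
    show "integrable lborel (\<lambda>z. A * G z)" using G by simp
    show "AE z in lborel. norm (cmod (h z)) \<le> norm (A * G z)"
      using A A0 G0 by (auto simp: h_def norm_mult abs_mult intro!: mult_mono)
  qed simp
  have int2: "integrable lborel (\<lambda>z. (cmod (synth g z))\<^sup>2 * G z)"
  proof (rule Bochner_Integration.integrable_bound)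
    show "integrable lborel (\<lambda>z. A\<^sup>2 * G z)" using G by simp
    show "AE z in lborel. norm ((cmod (synth g z))\<^sup>2 * G z) \<le> norm (A\<^sup>2 * G z)"
      using A A0 G0 by (auto simp: abs_mult intro!: mult_right_mono power_mono)
  qed simp
  \<comment> \<open>the remaining integral over \<open>z\<close> is again the Fourier transform of a packet, so \<open>fourier_packet\<close> evaluates it\<close>
  have cn: "(LINT z|lborel. cis (z \<bullet> \<zeta>) * h z) = cnj (fourier (packet 1 g) \<zeta>)" for \<zeta>
    unfolding fourier_def packet_def G_def[symmetric] h_def
    by (subst integral_cnj'[symmetric]) (simp add: cis_cnj mult_ac)
  have "of_real (LINT z|lborel. (cmod (synth g z))\<^sup>2 * G z) = (LINT z|lborel. synth g z * h z)"
    unfolding h_def integral_complex_of_real[symmetric]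
    by (intro Bochner_Integration.integral_cong refl) (simp add: complex_norm_square[unfolded of_real_power] mult_ac)
  also have "\<dots> = (LINT z|lborel. LINT \<zeta>|lborel. cis (z \<bullet> \<zeta>) * g \<zeta> * h z)"
    unfolding synth_def by simp
  also have "\<dots> = (LINT \<zeta>|lborel. LINT z|lborel. cis (z \<bullet> \<zeta>) * g \<zeta> * h z)"
  proof (rule lborel_pair.Fubini_integral[symmetric])
    show "integrable (lborel \<Otimes>\<^sub>M lborel) (\<lambda>(z, \<zeta>). cis (z \<bullet> \<zeta>) * g \<zeta> * h z)"
    proof (rule integrable_pair_dominated)
      show "(\<lambda>(z, \<zeta>). cis (z \<bullet> \<zeta>) * g \<zeta> * h z) \<in> borel_measurable borel"
        unfolding borel_prod[symmetric] by measurable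
      show "integrable lborel (\<lambda>z. cmod (h z))" by fact
      show "integrable lborel (\<lambda>\<omega>. cmod (g \<omega>))" using tame_integrable[OF g] by auto
    qed (simp add: norm_mult)
  qed
  also have "\<dots> = (LINT \<zeta>|lborel. g \<zeta> * cnj (fourier (packet 1 g) \<zeta>))"
  proof (intro Bochner_Integration.integral_cong refl)
    fix \<zeta>
    have "(LINT z|lborel. cis (z \<bullet> \<zeta>) * g \<zeta> * h z) = (LINT z|lborel. g \<zeta> * (cis (z \<bullet> \<zeta>) * h z))"
      by (simp add: mult_ac)
    then show "(LINT z|lborel. cis (z \<bullet> \<zeta>) * g \<zeta> * h z) = g \<zeta> * cnj (fourier (packet 1 g) \<zeta>)"
      by (simp add: cn)
  qed
  finally have eq: "complex_of_real (LINT z|lborel. (cmod (synth g z))\<^sup>2 * G z) = (LINT \<zeta>|lborel. g \<zeta> * cnj (fourier (packet 1 g) \<zeta>))" .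
  define I where "I = (energy g)"
  have ptw: "ennreal (cmod (g \<zeta> * cnj (fourier (packet 1 g) \<zeta>))) \<le>
     ennreal ((2 * pi) ^ CARD('n)) * (\<integral>\<^sup>+\<eta>. ennreal (gauss \<eta> * (((cmod (g \<zeta>))\<^sup>2 + (cmod (g (\<zeta> + \<eta>)))\<^sup>2) / 2)) \<partial>lborel)" for \<zeta>
  proof -
    have "ennreal (cmod (g \<zeta> * cnj (fourier (packet 1 g) \<zeta>))) =
       ennreal ((2 * pi) ^ CARD('n)) * (ennreal (cmod (g \<zeta>)) * ennreal (cmod (LINT \<eta>|lborel. of_real (gauss \<eta>) * g (\<zeta> + \<eta>))))"
      by (subst fourier_packet[OF g]) (simp_all add: norm_mult ennreal_mult' norm_power mult_ac)
    also have "\<dots> \<le> ennreal ((2 * pi) ^ CARD('n)) * (ennreal (cmod (g \<zeta>)) * (\<integral>\<^sup>+\<eta>. ennreal (cmod (of_real (gauss \<eta>) * g (\<zeta> + \<eta>))) \<partial>lborel))"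
      by (intro mult_left_mono norm_LINT_le) auto
    also have "(ennreal (cmod (g \<zeta>)) * (\<integral>\<^sup>+\<eta>. ennreal (cmod (of_real (gauss \<eta>) * g (\<zeta> + \<eta>))) \<partial>lborel))
       = (\<integral>\<^sup>+\<eta>. ennreal (cmod (g \<zeta>) * (gauss \<eta> * cmod (g (\<zeta> + \<eta>)))) \<partial>lborel)"
      by (subst nn_integral_cmult[symmetric]) (auto simp: norm_mult ennreal_mult)
    also have "\<dots> \<le> (\<integral>\<^sup>+\<eta>. ennreal (gauss \<eta> * (((cmod (g \<zeta>))\<^sup>2 + (cmod (g (\<zeta> + \<eta>)))\<^sup>2) / 2)) \<partial>lborel)"
    proof (intro nn_integral_mono ennreal_leI)
      fix \<eta>
      have "cmod (g \<zeta>) * cmod (g (\<zeta> + \<eta>)) \<le> ((cmod (g \<zeta>))\<^sup>2 + (cmod (g (\<zeta> + \<eta>)))\<^sup>2) / 2"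
        using sum_squares_bound[of "cmod (g \<zeta>)" "cmod (g (\<zeta> + \<eta>))"] by simp
      from mult_left_mono[OF this gauss_nonneg[of \<eta>]]
      show "cmod (g \<zeta>) * (gauss \<eta> * cmod (g (\<zeta> + \<eta>))) \<le> gauss \<eta> * (((cmod (g \<zeta>))\<^sup>2 + (cmod (g (\<zeta> + \<eta>)))\<^sup>2) / 2)"
        by (simp add: mult_ac)
    qed
    finally show ?thesis by (simp add: mult_left_mono)
  qed
  have half: "(\<integral>\<^sup>+\<zeta>. ennreal (gauss \<eta> * (((cmod (g \<zeta>))\<^sup>2 + (cmod (g (\<zeta> + \<eta>)))\<^sup>2) / 2)) \<partial>lborel) = ennreal (gauss \<eta>) * I" for \<eta>
  proof -
    have sh: "(\<integral>\<^sup>+\<zeta>. ennreal ((cmod (g (\<zeta> + \<eta>)))\<^sup>2) \<partial>lborel) = I"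
      unfolding I_def by (subst nn_integral_affine[of _ 1 \<eta>]) (auto simp: add.commute)
    have "(\<integral>\<^sup>+\<zeta>. ennreal (gauss \<eta> * (((cmod (g \<zeta>))\<^sup>2 + (cmod (g (\<zeta> + \<eta>)))\<^sup>2) / 2)) \<partial>lborel)
       = (\<integral>\<^sup>+\<zeta>. ennreal (gauss \<eta> / 2) * (ennreal ((cmod (g \<zeta>))\<^sup>2) + ennreal ((cmod (g (\<zeta> + \<eta>)))\<^sup>2)) \<partial>lborel)"
      by (simp add: ennreal_mult[symmetric] ennreal_plus[symmetric] del: ennreal_plus)
    also have "\<dots> = ennreal (gauss \<eta> / 2) * (I + I)"
      by (subst nn_integral_cmult, simp, subst nn_integral_add) (auto simp: sh, simp add: I_def)
    also have "\<dots> = ennreal (gauss \<eta> / 2) * 2 * I" by (simp add: mult_2[symmetric] mult_ac)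
    also have "ennreal (gauss \<eta> / 2) * 2 = ennreal (gauss \<eta>)"
      by (simp add: ennreal_mult''[symmetric] flip: ennreal_numeral)
    finally show ?thesis .
  qed
  have "(\<integral>\<^sup>+z\<in>ball 0 2. ennreal ((cmod (synth g z))\<^sup>2) \<partial>lborel) \<le> (\<integral>\<^sup>+z. ennreal (exp 2) * ennreal ((cmod (synth g z))\<^sup>2 * G z) \<partial>lborel)"
  proof (intro nn_integral_mono)
    fix z :: "real^'n"
    show "ennreal ((cmod (synth g z))\<^sup>2) * indicator (ball 0 2) z \<le> ennreal (exp 2) * ennreal ((cmod (synth g z))\<^sup>2 * G z)"
    proof (cases "z \<in> ball 0 2")
      case True
      then have "(norm z)\<^sup>2 \<le> 2\<^sup>2" by (intro power_mono) auto
      then have "1 \<le> exp 2 * G z" by (simp add: G_def exp_add[symmetric] field_simps)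
      then have "(cmod (synth g z))\<^sup>2 * 1 \<le> (cmod (synth g z))\<^sup>2 * (exp 2 * G z)" by (intro mult_left_mono) auto
      then show ?thesis using True G0 by (simp add: ennreal_mult[symmetric] mult_ac ennreal_leI)
    qed simp
  qed
  also have "\<dots> = ennreal (exp 2) * ennreal (LINT z|lborel. (cmod (synth g z))\<^sup>2 * G z)"
    using G0 by (subst nn_integral_cmult) (auto simp: nn_integral_eq_integral[OF int2])
  also have "\<dots> = ennreal (exp 2) * ennreal (cmod (LINT \<zeta>|lborel. g \<zeta> * cnj (fourier (packet 1 g) \<zeta>)))"
    unfolding eq[symmetric] using G0 by (simp add: integral_nonneg_AE)
  also have "\<dots> \<le> ennreal (exp 2) * (\<integral>\<^sup>+\<zeta>. ennreal ((2 * pi) ^ CARD('n)) * (\<integral>\<^sup>+\<eta>. ennreal (gauss \<eta> * (((cmod (g \<zeta>))\<^sup>2 + (cmod (g (\<zeta> + \<eta>)))\<^sup>2) / 2)) \<partial>lborel) \<partial>lborel)"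
    by (intro mult_left_mono order_trans[OF norm_LINT_le] nn_integral_mono ptw) auto
  also have "\<dots> = ennreal (exp 2) * (ennreal ((2 * pi) ^ CARD('n)) * (\<integral>\<^sup>+\<zeta>. (\<integral>\<^sup>+\<eta>. ennreal (gauss \<eta> * (((cmod (g \<zeta>))\<^sup>2 + (cmod (g (\<zeta> + \<eta>)))\<^sup>2) / 2)) \<partial>lborel) \<partial>lborel))"
    by (subst nn_integral_cmult) auto
  also have "(\<integral>\<^sup>+\<zeta>. (\<integral>\<^sup>+\<eta>. ennreal (gauss \<eta> * (((cmod (g \<zeta>))\<^sup>2 + (cmod (g (\<zeta> + \<eta>)))\<^sup>2) / 2)) \<partial>lborel) \<partial>lborel)
      = (\<integral>\<^sup>+\<eta>. (\<integral>\<^sup>+\<zeta>. ennreal (gauss \<eta> * (((cmod (g \<zeta>))\<^sup>2 + (cmod (g (\<zeta> + \<eta>)))\<^sup>2) / 2)) \<partial>lborel) \<partial>lborel)"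
    by (rule lborel_pair.Fubini'[symmetric]) measurable
  also have "\<dots> = I"
    unfolding half by (subst nn_integral_multc) (auto simp: nn_integral_eq_integral[OF integrable_gauss] integral_gauss)
  finally show ?thesis by (simp add: I_def ennreal_mult mult.assoc)
qed

section \<open>Gaussian-damped Fourier integrals as Schwartz functions\<close>

text \<open>On the bounded support of the profile, the second-order Taylor remainder of
  \<open>exp (i h \<cdot> \<xi>)\<close> is at most a constant times \<open>|h|\<^sup>2\<close>.\<close>

lemma synth_has_derivative:
  fixes H :: "real^'n::finite \<Rightarrow> complex"
  assumes H: "tame H"
  shows "(synth H has_derivative (\<lambda>h. \<Sum>i\<in>UNIV. of_real (h $ i) * synth (\<lambda>\<xi>. \<i> * of_real (\<xi> $ i) * H \<xi>) x)) (at x)"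
proof -
  have [measurable]: "H \<in> borel_measurable borel" by (rule tame_measurable[OF H])
  obtain R where R: "\<And>\<xi>. R < norm \<xi> \<Longrightarrow> H \<xi> = 0" using H unfolding tame_def by blast
  let ?D = "\<lambda>h. \<Sum>i\<in>UNIV. of_real (h $ i) * synth (\<lambda>\<xi>. \<i> * of_real (\<xi> $ i) * H \<xi>) x"
  define K where "K = (LINT \<xi>|lborel. R\<^sup>2 / 2 * cmod (H \<xi>))"
  have Ki: "integrable lborel (\<lambda>\<xi>. R\<^sup>2 / 2 * cmod (H \<xi>))" using tame_integrable[OF H] by simp
  have ic: "integrable lborel (\<lambda>\<xi>. cis (y \<bullet> \<xi>) * H \<xi>)" for y
    by (intro integrable_cis_mult tame_integrable[OF H]) simp
  have ici: "integrable lborel (\<lambda>\<xi>. of_real (h $ i) * (cis (x \<bullet> \<xi>) * (\<i> * of_real (\<xi> $ i) * H \<xi>)))" for h :: "real^'n" and i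
    by (intro integrable_mult_right integrable_cis_mult tame_integrable tame_mult_coord[OF H]) simp
  have est: "cmod (synth H y - synth H x - ?D (y - x)) \<le> K * (norm (y - x))\<^sup>2" for y
  proof -
    let ?h = "y - x"
    let ?d = "\<lambda>\<xi>. \<Sum>i\<in>UNIV. of_real (?h $ i) * (cis (x \<bullet> \<xi>) * (\<i> * of_real (\<xi> $ i) * H \<xi>))"
    have "?D ?h = (LINT \<xi>|lborel. ?d \<xi>)"
      unfolding synth_def by (subst Bochner_Integration.integral_sum[OF ici]) simp
    then have "synth H y - synth H x - ?D ?h = (LINT \<xi>|lborel. cis (y \<bullet> \<xi>) * H \<xi> - cis (x \<bullet> \<xi>) * H \<xi> - ?d \<xi>)"
      unfolding synth_def
      by (simp only: Bochner_Integration.integral_diff Bochner_Integration.integrable_diff Bochner_Integration.integrable_sum ic ici)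
    also have "cmod \<dots> \<le> (LINT \<xi>|lborel. R\<^sup>2 / 2 * cmod (H \<xi>) * (norm ?h)\<^sup>2)"
    proof (rule Bochner_Integration.integral_norm_bound_integral)
      show "integrable lborel (\<lambda>\<xi>. cis (y \<bullet> \<xi>) * H \<xi> - cis (x \<bullet> \<xi>) * H \<xi> - ?d \<xi>)"
        by (intro Bochner_Integration.integrable_diff Bochner_Integration.integrable_sum ic ici)
      show "integrable lborel (\<lambda>\<xi>. R\<^sup>2 / 2 * cmod (H \<xi>) * (norm ?h)\<^sup>2)"
        using integrable_mult_left[OF Ki, of "(norm ?h)\<^sup>2"] by simp
      fix \<xi> :: "real^'n"
      have d: "?d \<xi> = cis (x \<bullet> \<xi>) * (\<i> * of_real (?h \<bullet> \<xi>)) * H \<xi>"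
        by (simp add: inner_vec_def sum_distrib_left sum_distrib_right mult_ac)
      have c: "cis (y \<bullet> \<xi>) = cis (x \<bullet> \<xi>) * cis (?h \<bullet> \<xi>)"
        by (simp add: cis_mult inner_diff_left)
      have "cis (y \<bullet> \<xi>) * H \<xi> - cis (x \<bullet> \<xi>) * H \<xi> - ?d \<xi> = cis (x \<bullet> \<xi>) * (cis (?h \<bullet> \<xi>) - 1 - \<i> * of_real (?h \<bullet> \<xi>)) * H \<xi>"
        unfolding d c by (simp add: algebra_simps)
      then have "cmod (cis (y \<bullet> \<xi>) * H \<xi> - cis (x \<bullet> \<xi>) * H \<xi> - ?d \<xi>) = cmod (cis (?h \<bullet> \<xi>) - 1 - \<i> * of_real (?h \<bullet> \<xi>)) * cmod (H \<xi>)"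
        by (simp add: norm_mult)
      also have "\<dots> \<le> (?h \<bullet> \<xi>)\<^sup>2 / 2 * cmod (H \<xi>)"
        using iexp_approx1[of "?h \<bullet> \<xi>" 1]
        by (intro mult_right_mono) (auto simp: cis_conv_exp field_simps power2_eq_square)
      also have "\<dots> \<le> R\<^sup>2 / 2 * cmod (H \<xi>) * (norm ?h)\<^sup>2"
      proof (cases "R < norm \<xi>")
        case False
        have "(?h \<bullet> \<xi>)\<^sup>2 \<le> (norm ?h * R)\<^sup>2"
        proof (rule power2_le_iff_abs_le[THEN iffD2])
          have R0: "0 \<le> R" using False norm_ge_zero[of \<xi>] by linarith
          then show "0 \<le> norm ?h * R" by simp
          have "\<bar>?h \<bullet> \<xi>\<bar> \<le> norm ?h * norm \<xi>" by (rule Cauchy_Schwarz_ineq2)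
          also have "\<dots> \<le> norm ?h * R" using False by (intro mult_left_mono) auto
          finally show "\<bar>?h \<bullet> \<xi>\<bar> \<le> norm ?h * R" .
        qed
        then have "(?h \<bullet> \<xi>)\<^sup>2 / 2 * cmod (H \<xi>) \<le> (norm ?h * R)\<^sup>2 / 2 * cmod (H \<xi>)"
          by (intro mult_right_mono divide_right_mono) auto
        then show ?thesis by (simp add: power_mult_distrib mult_ac)
      qed (simp add: R)
      finally show "cmod (cis (y \<bullet> \<xi>) * H \<xi> - cis (x \<bullet> \<xi>) * H \<xi> - ?d \<xi>) \<le> R\<^sup>2 / 2 * cmod (H \<xi>) * (norm ?h)\<^sup>2" .
    qed
    also have "\<dots> = K * (norm ?h)\<^sup>2" unfolding K_def by (rule integral_mult_left_zero)
    finally show ?thesis .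
  qed
  show ?thesis
  proof (rule has_derivativeI_sandwich[of 1 _ _ _ _ "\<lambda>y. K * norm (y - x)"])
    show "bounded_linear ?D"
      unfolding linear_conv_bounded_linear[symmetric]
    proof (rule Real_Vector_Spaces.linearI)
      show "?D (a + b) = ?D a + ?D b" for a b by (simp add: distrib_right sum.distrib)
      show "?D (r *\<^sub>R b) = r *\<^sub>R ?D b" for r b by (simp add: scaleR_sum_right scaleR_conv_of_real[where 'a=complex] mult_ac sum_distrib_left)
    qed
    show "norm (synth H y - synth H x - ?D (y - x)) / norm (y - x) \<le> K * norm (y - x)" if "y \<noteq> x" for y
      using est[of y] that by (simp add: divide_le_eq power2_eq_square mult_ac)
    have "((\<lambda>y. K * norm (y - x)) \<longlongrightarrow> K * norm (x - x)) (at x)" by (intro tendsto_intros)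
    then show "((\<lambda>y. K * norm (y - x)) \<longlongrightarrow> 0) (at x)" by simp
  qed simp
qed

text \<open>The smallest class containing the packets with a given \<open>\<epsilon>\<close> that is visibly closed under
  partial derivatives: differentiating either multiplies the profile by a coordinate or
  produces a coordinate factor in space.\<close>

inductive packet_like :: "real \<Rightarrow> (real^'n::finite \<Rightarrow> complex) \<Rightarrow> bool" for \<epsilon> where
  packet: "tame H \<Longrightarrow> packet_like \<epsilon> (packet \<epsilon> H)"
| coord: "packet_like \<epsilon> f \<Longrightarrow> packet_like \<epsilon> (\<lambda>x. of_real (x $ i) * f x)"
| add: "packet_like \<epsilon> f \<Longrightarrow> packet_like \<epsilon> g \<Longrightarrow> packet_like \<epsilon> (\<lambda>x. f x + g x)"
| scale: "packet_like \<epsilon> f \<Longrightarrow> packet_like \<epsilon> (\<lambda>x. c * f x)"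

lemma packet_like_derivative:
  assumes "packet_like \<epsilon> (f :: real^'n::finite \<Rightarrow> complex)"
  shows "\<exists>D. (\<forall>x. (f has_derivative D x) (at x)) \<and> (\<forall>i. packet_like \<epsilon> (\<lambda>x. D x (axis i 1)))"
  using assms
proof induction
  case (packet H)
  let ?E = "\<lambda>x::real^'n. exp (- (\<epsilon> * norm x)\<^sup>2 / 2)"
  let ?S = "\<lambda>x h. \<Sum>i\<in>UNIV. of_real (h $ i) * synth (\<lambda>\<xi>. \<i> * of_real (\<xi> $ i) * H \<xi>) x"
  have E: "(?E has_derivative (\<lambda>h. ?E x * (- (\<epsilon>\<^sup>2 * (x \<bullet> h))))) (at x)" for x
  proof -
    have e: "?E = (\<lambda>x. exp (- (\<epsilon>\<^sup>2 / 2 * (x \<bullet> x))))"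
      by (simp add: power_mult_distrib power2_norm_eq_inner)
    show ?thesis
      unfolding e by (auto intro!: derivative_eq_intros simp: inner_commute power_mult_distrib power2_norm_eq_inner)
  qed
  let ?D = "\<lambda>x h. synth H x * of_real (?E x * (- (\<epsilon>\<^sup>2 * (x \<bullet> h)))) + ?S x h * of_real (?E x)"
  show ?case
  proof (intro exI[of _ ?D] conjI allI)
    fix x
    show "(packet \<epsilon> H has_derivative ?D x) (at x)"
      unfolding packet_def[abs_def]
      by (intro has_derivative_mult synth_has_derivative[OF packet] has_derivative_of_real E)
  next
    fix i
    have S: "?S x (axis i 1) = synth (\<lambda>\<xi>. \<i> * of_real (\<xi> $ i) * H \<xi>) x" for x
    proof -
      have "?S x (axis i 1) = (\<Sum>j\<in>UNIV. if j = i then synth (\<lambda>\<xi>. \<i> * of_real (\<xi> $ j) * H \<xi>) x else 0)"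
        by (intro sum.cong refl) (simp add: axis_def)
      then show ?thesis by simp
    qed
    have eq: "(\<lambda>x. ?D x (axis i 1)) = (\<lambda>x. - of_real (\<epsilon>\<^sup>2) * (of_real (x $ i) * packet \<epsilon> H x) + packet \<epsilon> (\<lambda>\<xi>. \<i> * of_real (\<xi> $ i) * H \<xi>) x)"
      unfolding S packet_def by (simp add: inner_axis mult_ac)
    show "packet_like \<epsilon> (\<lambda>x. ?D x (axis i 1))"
      unfolding eq by (intro packet_like.intros packet tame_mult_coord)
  qed
next
  case (coord f j)
  then obtain D where D: "\<And>x. (f has_derivative D x) (at x)" "\<And>i. packet_like \<epsilon> (\<lambda>x. D x (axis i 1))" by blast
  let ?D = "\<lambda>x h. of_real (x $ j) * D x h + of_real (h $ j) * f x"
  show ?case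
  proof (intro exI[of _ ?D] conjI allI)
    show "((\<lambda>x. of_real (x $ j) * f x) has_derivative ?D x) (at x)" for x
      by (intro has_derivative_mult has_derivative_of_real D bounded_linear_imp_has_derivative bounded_linear_vec_nth)
    fix i
    have "packet_like \<epsilon> (\<lambda>x. of_real (x $ j) * D x (axis i 1) + of_real (axis i 1 $ j) * f x)"
      by (intro packet_like.intros D coord)
    then show "packet_like \<epsilon> (\<lambda>x. ?D x (axis i 1))" .
  qed
next
  case (add f g)
  then obtain D E where D: "\<And>x. (f has_derivative D x) (at x)" "\<And>i. packet_like \<epsilon> (\<lambda>x. D x (axis i 1))"
    and E: "\<And>x. (g has_derivative E x) (at x)" "\<And>i. packet_like \<epsilon> (\<lambda>x. E x (axis i 1))" by blast
  show ?case
    by (rule exI[of _ "\<lambda>x h. D x h + E x h"]) (auto intro!: has_derivative_add D E packet_like.add)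
next
  case (scale f c)
  then obtain D where D: "\<And>x. (f has_derivative D x) (at x)" "\<And>i. packet_like \<epsilon> (\<lambda>x. D x (axis i 1))" by blast
  show ?case
    by (rule exI[of _ "\<lambda>x h. c * D x h"]) (auto intro!: has_derivative_mult_right D packet_like.scale)
qed

lemma power_exp_square_bounded:
  assumes "\<epsilon> > 0"
  shows "\<exists>B. \<forall>u\<ge>0. (1 + u) ^ k * exp (- (\<epsilon> * u)\<^sup>2 / 2) \<le> (B::real)"
proof -
  have lim: "((\<lambda>u::real. (1 + u) ^ k * exp (- (\<epsilon> * u)\<^sup>2 / 2)) \<longlongrightarrow> 0) at_top"
    using assms by real_asymp
  then have "eventually (\<lambda>u::real. (1 + u) ^ k * exp (- (\<epsilon> * u)\<^sup>2 / 2) < 1) at_top"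
    by (rule order_tendstoD) simp
  then obtain N where N: "\<And>u. N \<le> u \<Longrightarrow> (1 + u) ^ k * exp (- (\<epsilon> * u)\<^sup>2 / 2) < 1"
    by (auto simp: eventually_at_top_linorder)
  have "(1 + u) ^ k * exp (- (\<epsilon> * u)\<^sup>2 / 2) \<le> 1 + (1 + \<bar>N\<bar>) ^ k" if "0 \<le> u" for u
  proof (cases "N \<le> u")
    case True
    have "0 \<le> (1 + \<bar>N\<bar>) ^ k" by simp
    with N[OF True] show ?thesis by linarith
  next
    case False
    have "(1 + u) ^ k * exp (- (\<epsilon> * u)\<^sup>2 / 2) \<le> (1 + \<bar>N\<bar>) ^ k * 1"
      using False that by (intro mult_mono power_mono) auto
    then show ?thesis by simp
  qed
  then show ?thesis by blast
qed

text \<open>Packets decay like a Gaussian. Multiplication by a coordinate costs one power, which is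
  why the exponent is arbitrary in the induction.\<close>

lemma packet_like_decay:
  assumes "packet_like \<epsilon> (f :: real^'n::finite \<Rightarrow> complex)" and \<epsilon>: "\<epsilon> > 0"
  shows "\<exists>B. \<forall>x. (1 + norm x) ^ k * cmod (f x) \<le> B"
  using assms(1)
proof (induction arbitrary: k)
  case (packet H)
  obtain B where B: "\<And>u. 0 \<le> u \<Longrightarrow> (1 + u) ^ k * exp (- (\<epsilon> * u)\<^sup>2 / 2) \<le> B"
    using power_exp_square_bounded[OF \<epsilon>] by blast
  have "(1 + norm x) ^ k * cmod (packet \<epsilon> H x) \<le> (LINT \<xi>|lborel. cmod (H \<xi>)) * B" for x
  proof -
    have "(1 + norm x) ^ k * cmod (packet \<epsilon> H x) = cmod (synth H x) * ((1 + norm x) ^ k * exp (- (\<epsilon> * norm x)\<^sup>2 / 2))"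
      by (simp add: packet_def norm_mult)
    also have "\<dots> \<le> (LINT \<xi>|lborel. cmod (H \<xi>)) * B"
      by (intro mult_mono norm_synth_le B) auto
    finally show ?thesis .
  qed
  then show ?case by blast
next
  case (coord f i)
  obtain B where B: "\<And>x. (1 + norm x) ^ Suc k * cmod (f x) \<le> B" using coord.IH by blast
  have "(1 + norm x) ^ k * cmod (of_real (x $ i) * f x) \<le> B" for x
  proof -
    have "(1 + norm x) ^ k * cmod (of_real (x $ i) * f x) = (1 + norm x) ^ k * (\<bar>x $ i\<bar> * cmod (f x))"
      by (simp add: norm_mult)
    also have "\<dots> \<le> (1 + norm x) ^ k * ((1 + norm x) * cmod (f x))"
      using component_le_norm_cart[of x i] by (intro mult_left_mono mult_right_mono) auto
    also have "\<dots> \<le> B" using B[of x] by (simp add: mult_ac)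
    finally show ?thesis .
  qed
  then show ?case by blast
next
  case (add f g)
  obtain B C where B: "\<And>x. (1 + norm x) ^ k * cmod (f x) \<le> B" "\<And>x. (1 + norm x) ^ k * cmod (g x) \<le> C"
    using add.IH by blast
  have "(1 + norm x) ^ k * cmod (f x + g x) \<le> B + C" for x
  proof -
    have "(1 + norm x) ^ k * cmod (f x + g x) \<le> (1 + norm x) ^ k * (cmod (f x) + cmod (g x))"
      by (intro mult_left_mono norm_triangle_ineq) auto
    then show ?thesis using B[of x] by (simp add: distrib_left)
  qed
  then show ?case by blast
next
  case (scale f c)
  obtain B where B: "\<And>x. (1 + norm x) ^ k * cmod (f x) \<le> B" using scale.IH by blast
  have "(1 + norm x) ^ k * cmod (c * f x) \<le> cmod c * B" for x
    using mult_left_mono[OF B[of x], of "cmod c"] by (simp add: norm_mult mult_ac)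
  then show ?case by blast
qed

lemma packet_like_iter_partial:
  "packet_like \<epsilon> f \<Longrightarrow> packet_like \<epsilon> (iter_partial is f)"
proof (induction "is")
  case (Cons i "is")
  then obtain D where D: "\<And>x. (iter_partial is f has_derivative D x) (at x)"
    "\<And>i. packet_like \<epsilon> (\<lambda>x. D x (axis i 1))"
    using packet_like_derivative by blast
  have "frechet_derivative (iter_partial is f) (at x) = D x" for x
    using frechet_derivative_at[OF D(1)] by simp
  then show ?case using D(2) by simp
qed simp

lemma schwartz_packet:
  assumes "tame H" "\<epsilon> > 0" shows "schwartz (packet \<epsilon> H)"
proof -
  have *: "packet_like \<epsilon> (iter_partial is (packet \<epsilon> H))" for "is"
    by (intro packet_like_iter_partial packet_like.packet assms)
  show ?thesis unfolding schwartz_def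
  proof (intro conjI allI)
    show "iter_partial is (packet \<epsilon> H) differentiable at x" for "is" x
      using packet_like_derivative[OF *] unfolding differentiable_def by blast
    show "\<exists>B. \<forall>x. (1 + norm x) ^ k * cmod (iter_partial is (packet \<epsilon> H) x) \<le> B" for "is" k
      by (rule packet_like_decay[OF * assms(2)])
  qed
qed

text \<open>The square of the Sobolev norm as a functional of the Fourier transform, since it is later
  evaluated at profiles that are not known to be Fourier transforms of Schwartz functions.\<close>

definition sobolev_sq :: "real \<Rightarrow> (real^'n::finite \<Rightarrow> complex) \<Rightarrow> ennreal" where
  "sobolev_sq \<sigma> F = (\<integral>\<^sup>+\<xi>. ennreal ((1 + (norm \<xi>)\<^sup>2) powr \<sigma> * (cmod (F \<xi>))\<^sup>2) \<partial>lborel)"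

lemma sobolev_norm_eq: "sobolev_norm s f = ennreal_sqrt (sobolev_sq s (fourier f))"
proof -
  have "(ennreal ((1 + (norm \<xi>)\<^sup>2) powr (s / 2) * cmod (fourier f \<xi>)))\<^sup>2 = ennreal ((1 + (norm \<xi>)\<^sup>2) powr s * (cmod (fourier f \<xi>))\<^sup>2)" for \<xi>
  proof -
    have "((1 + (norm \<xi>)\<^sup>2) powr (s / 2))\<^sup>2 = (1 + (norm \<xi>)\<^sup>2) powr s"
      unfolding power2_eq_square[of "_ powr _"] by (subst powr_add[symmetric]) simp
    then show ?thesis by (simp add: ennreal_power power_mult_distrib)
  qed
  then show ?thesis unfolding sobolev_norm_def L2_norm_on_def sobolev_sq_def by simp
qed

text \<open>The inequality of Peetre, which lets Sobolev weights pass through convolutions.\<close>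

lemma Peetre: "1 + (norm (a - b))\<^sup>2 \<le> 2 * (1 + (norm a)\<^sup>2) * (1 + (norm (b::'a::real_normed_vector))\<^sup>2)"
proof -
  have "(norm (a - b))\<^sup>2 \<le> (norm a + norm b)\<^sup>2" by (intro power_mono norm_triangle_ineq4) auto
  also have "\<dots> \<le> 2 * (norm a)\<^sup>2 + 2 * (norm b)\<^sup>2"
    using sum_squares_bound[of "norm a" "norm b"] by (simp add: power2_sum)
  finally have "1 + (norm (a - b))\<^sup>2 \<le> 1 + 2 * (norm a)\<^sup>2 + 2 * (norm b)\<^sup>2" by simp
  also have "\<dots> \<le> 2 * (1 + (norm a)\<^sup>2) * (1 + (norm b)\<^sup>2)"
    by (simp add: algebra_simps)
  finally show ?thesis .
qed

lemma gauss_moment_finite: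
  assumes "\<sigma> > 0"
  shows "(\<integral>\<^sup>+(\<eta>::real^'n). ennreal ((1 + (norm \<eta>)\<^sup>2) powr \<sigma> * gauss \<eta>) \<partial>lborel) < \<infinity>"
proof -
  \<comment> \<open>the maximum of \<open>(1 + u)^\<sigma> exp (- u / 4)\<close> is at most \<open>K\<close>, by \<open>ln x \<le> x\<close> at \<open>x = (1 + u) / (4 \<sigma>)\<close>\<close>
  define K where "K = exp (1/4) * (4 * \<sigma>) powr \<sigma> "
  have b: "(1 + u) powr \<sigma> \<le> K * exp (u / 4)" if "u \<ge> 0" for u :: real
  proof -
    have "ln ((1 + u) / (4 * \<sigma>)) \<le> (1 + u) / (4 * \<sigma>)"
      using that assms ln_le_minus_one[of "(1 + u) / (4 * \<sigma>)"] by simp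
    then have "\<sigma> * ln (1 + u) \<le> (1 + u) / 4 + \<sigma> * ln (4 * \<sigma>)"
      using that assms by (simp add: ln_div field_simps)
    then have "exp (\<sigma> * ln (1 + u)) \<le> exp ((1 + u) / 4 + \<sigma> * ln (4 * \<sigma>))" by simp
    then show ?thesis using that assms by (simp add: powr_def K_def exp_add add_divide_distrib mult_ac)
  qed
  let ?c = "sqrt (1/2) :: real"
  have c: "?c > 0" by simp
  have int: "integrable lborel (\<lambda>\<eta>::real^'n. K * (2 * pi) powr (- real CARD('n) / 2) * exp (- (?c * norm \<eta>)\<^sup>2 / 2))"
    using integrable_exp_square[OF c, where 'a="real^'n"] by simp
  have "(\<integral>\<^sup>+(\<eta>::real^'n). ennreal ((1 + (norm \<eta>)\<^sup>2) powr \<sigma> * gauss \<eta>) \<partial>lborel)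
     \<le> (\<integral>\<^sup>+(\<eta>::real^'n). ennreal (K * (2 * pi) powr (- real CARD('n) / 2) * exp (- (?c * norm \<eta>)\<^sup>2 / 2)) \<partial>lborel)"
  proof (intro nn_integral_mono ennreal_leI)
    fix \<eta> :: "real^'n"
    have "(1 + (norm \<eta>)\<^sup>2) powr \<sigma> * gauss \<eta> \<le> K * exp ((norm \<eta>)\<^sup>2 / 4) * gauss \<eta>"
      by (intro mult_right_mono b) auto
    also have "\<dots> = K * (2 * pi) powr (- real CARD('n) / 2) * (exp ((norm \<eta>)\<^sup>2 / 4) * exp (- (norm \<eta>)\<^sup>2 / 2))"
      by (simp add: gauss_eq)
    also have "exp ((norm \<eta>)\<^sup>2 / 4) * exp (- (norm \<eta>)\<^sup>2 / 2) = exp (- (?c * norm \<eta>)\<^sup>2 / 2)"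
      by (simp add: exp_add[symmetric] power_mult_distrib)
    finally show "(1 + (norm \<eta>)\<^sup>2) powr \<sigma> * gauss \<eta> \<le> K * (2 * pi) powr (- real CARD('n) / 2) * exp (- (?c * norm \<eta>)\<^sup>2 / 2)" .
  qed
  also have "\<dots> < \<infinity>"
    using int by (subst nn_integral_eq_integral) (auto simp: K_def)
  finally show ?thesis .
qed

text \<open>The transform is an average of translates of \<open>H\<close> over a probability density
  (\<open>fourier_packet\<close>). By Cauchy-Schwarz its square is dominated by the average of the
  squares, and translating back changes the weight by a factor that the Gaussian absorbs.
  The bound is uniform in \<open>\<epsilon> \<le> 1\<close>, so it survives the limit \<open>\<epsilon> \<rightarrow> 0\<close>.\<close>

lemma sobolev_sq_fourier_packet:
  fixes H :: "real^'n::finite \<Rightarrow> complex"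
  assumes H: "tame H" and \<epsilon>: "0 < \<epsilon>" "\<epsilon> \<le> 1" and \<sigma>: "\<sigma> > 0"
  shows "sobolev_sq \<sigma> (fourier (packet \<epsilon> H)) \<le> ennreal (((2 * pi) ^ CARD('n))\<^sup>2 * 2 powr \<sigma>)
    * (\<integral>\<^sup>+(\<eta>::real^'n). ennreal ((1 + (norm \<eta>)\<^sup>2) powr \<sigma> * gauss \<eta>) \<partial>lborel) * sobolev_sq \<sigma> H"
proof -
  have [measurable]: "H \<in> borel_measurable borel" by (rule tame_measurable[OF H])
  let ?P = "(2 * pi) ^ CARD('n)"
  let ?w = "\<lambda>\<xi>::real^'n. (1 + (norm \<xi>)\<^sup>2) powr \<sigma>"
  define h where "h \<xi> = (\<integral>\<^sup>+\<eta>. ennreal (gauss \<eta> * (cmod (H (\<xi> + \<epsilon> *\<^sub>R \<eta>)))\<^sup>2) \<partial>lborel)" for \<xi>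
  have [measurable]: "h \<in> borel_measurable borel" unfolding h_def[abs_def] by measurable
  have CS: "ennreal ((cmod (LINT \<eta>|lborel. of_real (gauss \<eta>) * H (\<xi> + \<epsilon> *\<^sub>R \<eta>)))\<^sup>2) \<le> h \<xi>" for \<xi>
  proof -
    have "ennreal ((cmod (LINT \<eta>|lborel. of_real (gauss \<eta>) * H (\<xi> + \<epsilon> *\<^sub>R \<eta>)))\<^sup>2)
        = (ennreal (cmod (LINT \<eta>|lborel. of_real (gauss \<eta>) * H (\<xi> + \<epsilon> *\<^sub>R \<eta>))))\<^sup>2" by (simp add: ennreal_power)
    also have "\<dots> \<le> (\<integral>\<^sup>+\<eta>. ennreal (cmod (of_real (gauss \<eta>) * H (\<xi> + \<epsilon> *\<^sub>R \<eta>))) \<partial>lborel)\<^sup>2"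
      by (intro power_mono norm_LINT_le) auto
    also have "\<dots> = (\<integral>\<^sup>+\<eta>. ennreal (sqrt (gauss \<eta>) * cmod (H (\<xi> + \<epsilon> *\<^sub>R \<eta>))) * ennreal (sqrt (gauss \<eta>)) \<partial>lborel)\<^sup>2"
      by (intro arg_cong[where f="\<lambda>x. x\<^sup>2"] nn_integral_cong) (simp add: norm_mult ennreal_mult[symmetric] mult_ac)
    also have "\<dots> \<le> (\<integral>\<^sup>+\<eta>. (ennreal (sqrt (gauss \<eta>) * cmod (H (\<xi> + \<epsilon> *\<^sub>R \<eta>))))\<^sup>2 \<partial>lborel) * (\<integral>\<^sup>+(\<eta>::real^'n). (ennreal (sqrt (gauss \<eta>)))\<^sup>2 \<partial>lborel)"
      by (rule Cauchy_Schwarz_nn_integral) measurable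
    also have "\<dots> = h \<xi>"
      by (simp add: ennreal_power power_mult_distrib h_def nn_integral_eq_integral[OF integrable_gauss] integral_gauss)
    finally show ?thesis .
  qed
  have "sobolev_sq \<sigma> (fourier (packet \<epsilon> H)) \<le> (\<integral>\<^sup>+\<xi>. ennreal (?P\<^sup>2) * (ennreal (?w \<xi>) * h \<xi>) \<partial>lborel)"
    unfolding sobolev_sq_def
  proof (intro nn_integral_mono)
    fix \<xi> :: "real^'n"
    have "ennreal (?w \<xi> * (cmod (fourier (packet \<epsilon> H) \<xi>))\<^sup>2) = ennreal (?P\<^sup>2) * (ennreal (?w \<xi>) * ennreal ((cmod (LINT \<eta>|lborel. of_real (gauss \<eta>) * H (\<xi> + \<epsilon> *\<^sub>R \<eta>)))\<^sup>2))"
      by (subst fourier_packet[OF H \<epsilon>(1)]) (simp add: norm_mult power_mult_distrib norm_power ennreal_mult[symmetric] mult_ac)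
    also have "\<dots> \<le> ennreal (?P\<^sup>2) * (ennreal (?w \<xi>) * h \<xi>)"
      by (intro mult_left_mono CS) auto
    finally show "ennreal (?w \<xi> * (cmod (fourier (packet \<epsilon> H) \<xi>))\<^sup>2) \<le> \<dots>" .
  qed
  also have "\<dots> = ennreal (?P\<^sup>2) * (\<integral>\<^sup>+\<xi>. (\<integral>\<^sup>+\<eta>. ennreal (?w \<xi> * (gauss \<eta> * (cmod (H (\<xi> + \<epsilon> *\<^sub>R \<eta>)))\<^sup>2)) \<partial>lborel) \<partial>lborel)"
    unfolding h_def
    by (subst nn_integral_cmult, simp, subst nn_integral_cmult[symmetric], simp)
      (simp add: ennreal_mult')
  also have "(\<integral>\<^sup>+\<xi>. (\<integral>\<^sup>+\<eta>. ennreal (?w \<xi> * (gauss \<eta> * (cmod (H (\<xi> + \<epsilon> *\<^sub>R \<eta>)))\<^sup>2)) \<partial>lborel) \<partial>lborel)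
     = (\<integral>\<^sup>+\<eta>. (\<integral>\<^sup>+\<xi>. ennreal (?w \<xi> * (gauss \<eta> * (cmod (H (\<xi> + \<epsilon> *\<^sub>R \<eta>)))\<^sup>2)) \<partial>lborel) \<partial>lborel)"
    by (rule lborel_pair.Fubini'[symmetric]) measurable
  also have "\<dots> \<le> (\<integral>\<^sup>+\<eta>. ennreal (2 powr \<sigma> * (?w \<eta> * gauss \<eta>)) * sobolev_sq \<sigma> H \<partial>lborel)"
  proof (intro nn_integral_mono)
    fix \<eta> :: "real^'n"
    have "(\<integral>\<^sup>+\<xi>. ennreal (?w \<xi> * (gauss \<eta> * (cmod (H (\<xi> + \<epsilon> *\<^sub>R \<eta>)))\<^sup>2)) \<partial>lborel)
       = (\<integral>\<^sup>+\<xi>. ennreal (?w (- (\<epsilon> *\<^sub>R \<eta>) + \<xi>) * (gauss \<eta> * (cmod (H \<xi>))\<^sup>2)) \<partial>lborel)"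
      by (subst nn_integral_affine[of _ 1 "- (\<epsilon> *\<^sub>R \<eta>)"]) auto
    also have "\<dots> \<le> (\<integral>\<^sup>+\<xi>. ennreal (2 powr \<sigma> * (?w \<eta> * gauss \<eta>)) * ennreal (?w \<xi> * (cmod (H \<xi>))\<^sup>2) \<partial>lborel)"
    proof (intro nn_integral_mono)
      fix \<xi> :: "real^'n"
      have "?w (- (\<epsilon> *\<^sub>R \<eta>) + \<xi>) \<le> (2 * (1 + (norm \<xi>)\<^sup>2) * (1 + (norm (\<epsilon> *\<^sub>R \<eta>))\<^sup>2)) powr \<sigma>"
        using Peetre[of \<xi> "\<epsilon> *\<^sub>R \<eta>"] \<sigma> by (intro powr_mono2) (auto simp: add_ac)
      also have "\<dots> \<le> (2 * (1 + (norm \<xi>)\<^sup>2) * (1 + (norm \<eta>)\<^sup>2)) powr \<sigma>"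
      proof (intro powr_mono2 mult_left_mono add_left_mono power_mono)
        show "norm (\<epsilon> *\<^sub>R \<eta>) \<le> norm \<eta>" using \<epsilon> by (simp add: mult_left_le_one_le)
      qed (use \<sigma> in auto)
      also have "\<dots> = 2 powr \<sigma> * (?w \<xi> * ?w \<eta>)" by (simp add: powr_mult mult.assoc del: distrib_left_numeral)
      finally have "?w (- (\<epsilon> *\<^sub>R \<eta>) + \<xi>) * (gauss \<eta> * (cmod (H \<xi>))\<^sup>2) \<le> (2 powr \<sigma> * (?w \<xi> * ?w \<eta>)) * (gauss \<eta> * (cmod (H \<xi>))\<^sup>2)"
        by (intro mult_right_mono) auto
      then show "ennreal (?w (- (\<epsilon> *\<^sub>R \<eta>) + \<xi>) * (gauss \<eta> * (cmod (H \<xi>))\<^sup>2)) \<le> ennreal (2 powr \<sigma> * (?w \<eta> * gauss \<eta>)) * ennreal (?w \<xi> * (cmod (H \<xi>))\<^sup>2)"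
        by (subst ennreal_mult[symmetric]) (auto intro!: ennreal_leI simp: mult_ac)
    qed
    also have "\<dots> = ennreal (2 powr \<sigma> * (?w \<eta> * gauss \<eta>)) * sobolev_sq \<sigma> H"
      unfolding sobolev_sq_def by (rule nn_integral_cmult) measurable
    finally show "(\<integral>\<^sup>+\<xi>. ennreal (?w \<xi> * (gauss \<eta> * (cmod (H (\<xi> + \<epsilon> *\<^sub>R \<eta>)))\<^sup>2)) \<partial>lborel) \<le> \<dots>" .
  qed
  also have "\<dots> = ennreal (2 powr \<sigma>) * (\<integral>\<^sup>+(\<eta>::real^'n). ennreal (?w \<eta> * gauss \<eta>) \<partial>lborel) * sobolev_sq \<sigma> H"
    by (subst nn_integral_multc, measurable, subst nn_integral_cmult[symmetric]) (auto simp: ennreal_mult)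
  finally have "sobolev_sq \<sigma> (fourier (packet \<epsilon> H)) \<le> ennreal (?P\<^sup>2) * (ennreal (2 powr \<sigma>) * (\<integral>\<^sup>+(\<eta>::real^'n). ennreal (?w \<eta> * gauss \<eta>) \<partial>lborel) * sobolev_sq \<sigma> H)"
    by (simp add: mult_left_mono)
  then show ?thesis by (simp only: ennreal_mult'' powr_ge_zero mult.assoc)
qed

lemma powr_norm_continuous:
  assumes "\<alpha> > 0" shows "continuous_on UNIV (\<lambda>\<xi>::'a::real_normed_vector. norm \<xi> powr \<alpha>)"
  using assms by (intro continuous_on_powr' continuous_intros) auto

text \<open>After Fubini and a translation, the average over \<open>\<eta>\<close> acts on the phase, which is
  continuous, so dominated convergence applies. Pointwise convergence suffices for the later
  use of Fatou's lemma.\<close>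

lemma propagator_packet_limit:
  fixes H :: "real^'n::finite \<Rightarrow> complex"
  assumes H: "tame H" and \<alpha>: "\<alpha> > 0"
  shows "(\<lambda>m. propagator \<alpha> t (packet (1 / real (Suc m)) H) x) \<longlonglongrightarrow> wave \<alpha> t H x"
proof -
  have [measurable]: "H \<in> borel_measurable borel" by (rule tame_measurable[OF H])
  have Hi: "integrable lborel (\<lambda>\<xi>. cmod (H \<xi>))" using tame_integrable[OF H] by simp
  define \<Phi> where "\<Phi> \<xi> = x \<bullet> \<xi> + t * norm \<xi> powr \<alpha>" for \<xi> :: "real^'n"
  have [measurable]: "\<Phi> \<in> borel_measurable borel" unfolding \<Phi>_def[abs_def] by measurable
  have \<Phi>c: "continuous_on UNIV \<Phi>" unfolding \<Phi>_def[abs_def]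
    by (intro continuous_intros powr_norm_continuous \<alpha>)
  define J where "J \<epsilon> \<eta> = (LINT \<xi>|lborel. cis (\<Phi> (- (\<epsilon> *\<^sub>R \<eta>) + \<xi>)) * H \<xi>)" for \<epsilon> and \<eta> :: "real^'n"
  have [measurable]: "J \<epsilon> \<in> borel_measurable borel" for \<epsilon> unfolding J_def[abs_def] by measurable
  have eq: "propagator \<alpha> t (packet \<epsilon> H) x = (LINT \<eta>|lborel. of_real (gauss \<eta>) * J \<epsilon> \<eta>)" if \<epsilon>: "\<epsilon> > 0" for \<epsilon>
  proof -
    define f where "f = (\<lambda>(\<eta>, \<xi>). cis (\<Phi> \<xi>) * (of_real (gauss \<eta>) * H (\<xi> + \<epsilon> *\<^sub>R \<eta>)))"
    have sh: "integrable lborel (\<lambda>\<xi>. cmod (H (\<xi> + \<epsilon> *\<^sub>R \<eta>)))" for \<eta>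
      using integrable_affine[OF Hi, of 1 "\<epsilon> *\<^sub>R \<eta>"] by (simp add: add.commute)
    have shi: "(LINT \<xi>|lborel. cmod (H (\<xi> + \<epsilon> *\<^sub>R \<eta>))) = (LINT \<xi>|lborel. cmod (H \<xi>))" for \<eta>
      using integral_affine[of "\<lambda>\<xi>. cmod (H \<xi>)" 1 "\<epsilon> *\<^sub>R \<eta>"] by (simp add: add.commute)
    have fi: "integrable (lborel \<Otimes>\<^sub>M lborel) f"
    proof (rule lborel_pair.Fubini_integrable)
      show fm: "f \<in> borel_measurable (lborel \<Otimes>\<^sub>M lborel)" unfolding f_def by measurable
      have "(LINT \<xi>|lborel. norm (f (\<eta>, \<xi>))) = gauss \<eta> * (LINT \<xi>|lborel. cmod (H \<xi>))" for \<eta>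
        unfolding f_def shi[of \<eta>, symmetric] by (simp add: norm_mult)
      then show "integrable lborel (\<lambda>\<eta>. LINT \<xi>|lborel. norm (f (\<eta>, \<xi>)))"
        using integrable_gauss[where 'a="real^'n"] by (auto intro!: integrable_mult_left)
      show "AE \<eta> in lborel. integrable lborel (\<lambda>\<xi>. f (\<eta>, \<xi>))"
      proof (intro AE_I2)
        fix \<eta>
        have "integrable lborel (\<lambda>\<xi>. gauss \<eta> * cmod (H (\<xi> + \<epsilon> *\<^sub>R \<eta>)))"
          using sh by simp
        then show "integrable lborel (\<lambda>\<xi>. f (\<eta>, \<xi>))"
          by (rule Bochner_Integration.integrable_bound) (auto simp: f_def norm_mult)
      qed
    qed
    have "propagator \<alpha> t (packet \<epsilon> H) x = of_real (1 / (2 * pi) ^ CARD('n)) * (LINT \<xi>|lborel. of_real ((2 * pi) ^ CARD('n)) * (LINT \<eta>|lborel. f (\<eta>, \<xi>)))"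
      unfolding propagator_def \<Phi>_def[symmetric] fourier_packet[OF H \<epsilon>] f_def
      by (simp add: mult_ac)
    also have "\<dots> = (LINT \<xi>|lborel. (LINT \<eta>|lborel. f (\<eta>, \<xi>)))"
      by (subst integral_mult_right_zero) simp
    also have "\<dots> = (LINT \<eta>|lborel. (LINT \<xi>|lborel. f (\<eta>, \<xi>)))"
      using fi by (intro lborel_pair.Fubini_integral) simp
    also have "\<dots> = (LINT \<eta>|lborel. of_real (gauss \<eta>) * J \<epsilon> \<eta>)"
    proof (intro Bochner_Integration.integral_cong refl)
      fix \<eta>
      have "(LINT \<xi>|lborel. f (\<eta>, \<xi>)) = (LINT \<xi>|lborel. f (\<eta>, - (\<epsilon> *\<^sub>R \<eta>) + \<xi>))"
        unfolding f_def by (subst integral_affine[of _ 1 "- (\<epsilon> *\<^sub>R \<eta>)"]) auto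
      also have "\<dots> = (LINT \<xi>|lborel. of_real (gauss \<eta>) * (cis (\<Phi> (- (\<epsilon> *\<^sub>R \<eta>) + \<xi>)) * H \<xi>))"
        by (simp add: f_def mult_ac)
      also have "\<dots> = of_real (gauss \<eta>) * J \<epsilon> \<eta>"
        unfolding J_def by (rule integral_mult_right_zero)
      finally show "(LINT \<xi>|lborel. f (\<eta>, \<xi>)) = of_real (gauss \<eta>) * J \<epsilon> \<eta>" .
    qed
    finally show ?thesis .
  qed
  have e0: "(\<lambda>m. 1 / real (Suc m)) \<longlonglongrightarrow> 0"
    using LIMSEQ_inverse_real_of_nat by (simp add: inverse_eq_divide)
  have Jlim: "(\<lambda>m. J (1 / real (Suc m)) \<eta>) \<longlonglongrightarrow> wave \<alpha> t H x" for \<eta>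
    unfolding J_def wave_def \<Phi>_def[symmetric]
  proof (rule integral_dominated_convergence[OF _ _ Hi])
    show "AE \<xi> in lborel. (\<lambda>m. cis (\<Phi> (- ((1 / real (Suc m)) *\<^sub>R \<eta>) + \<xi>)) * H \<xi>) \<longlonglongrightarrow> cis (\<Phi> \<xi>) * H \<xi>"
    proof (intro AE_I2 tendsto_mult tendsto_const)
      fix \<xi>
      have "(\<lambda>m. - ((1 / real (Suc m)) *\<^sub>R \<eta>) + \<xi>) \<longlonglongrightarrow> - (0 *\<^sub>R \<eta>) + \<xi>"
        by (intro tendsto_intros e0)
      then have l: "(\<lambda>m. - ((1 / real (Suc m)) *\<^sub>R \<eta>) + \<xi>) \<longlonglongrightarrow> \<xi>" by simp
      have "(\<lambda>m. \<Phi> (- ((1 / real (Suc m)) *\<^sub>R \<eta>) + \<xi>)) \<longlonglongrightarrow> \<Phi> \<xi>"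
        by (rule continuous_on_tendsto_compose[OF \<Phi>c l]) auto
      then show "(\<lambda>m. cis (\<Phi> (- ((1 / real (Suc m)) *\<^sub>R \<eta>) + \<xi>))) \<longlonglongrightarrow> cis (\<Phi> \<xi>)"
        by (intro tendsto_cis)
    qed
  qed (auto simp: norm_mult)
  have "(\<lambda>m. LINT \<eta>|lborel. of_real (gauss \<eta>) * J (1 / real (Suc m)) \<eta>) \<longlonglongrightarrow> (LINT \<eta>|lborel. of_real (gauss (\<eta>::real^'n)) * wave \<alpha> t H x)"
  proof (rule integral_dominated_convergence[where w="\<lambda>\<eta>. gauss \<eta> * (LINT \<xi>|lborel. cmod (H \<xi>))"])
    show "integrable lborel (\<lambda>\<eta>::real^'n. gauss \<eta> * (LINT \<xi>|lborel. cmod (H \<xi>)))"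
      using integrable_gauss[where 'a="real^'n"] by simp
    show "AE \<eta> in lborel. (\<lambda>m. of_real (gauss \<eta>) * J (1 / real (Suc m)) \<eta>) \<longlonglongrightarrow> of_real (gauss \<eta>) * wave \<alpha> t H x"
      by (intro AE_I2 tendsto_mult tendsto_const Jlim)
    have "cmod (J \<epsilon> \<eta>) \<le> (LINT \<xi>|lborel. cmod (H \<xi>))" for \<epsilon> \<eta>
      unfolding J_def by (rule order_trans[OF integral_norm_bound]) (simp add: norm_mult)
    then show "AE \<eta> in lborel. norm (of_real (gauss \<eta>) * J (1 / real (Suc m)) \<eta>) \<le> gauss \<eta> * (LINT \<xi>|lborel. cmod (H \<xi>))" for m
      by (auto simp: norm_mult intro!: mult_left_mono)
  qed auto
  also have "(LINT \<eta>|lborel. of_real (gauss (\<eta>::real^'n)) * wave \<alpha> t H x) = wave \<alpha> t H x"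
    by (subst integral_mult_left_zero) (simp add: integral_gauss)
  finally show ?thesis by (simp add: eq)
qed

lemma ball_pred_measurable [measurable]: "Measurable.pred borel (\<lambda>x::'a::metric_space. x \<in> ball a r)"
  by (simp add: pred_def del: mem_ball)

section \<open>From Schwartz functions to bounded frequency profiles\<close>

text \<open>Suprema are taken over sequences of times to keep them measurable, and of squares because
  the estimates are quadratic.\<close>

definition max_wave :: "real \<Rightarrow> (nat \<Rightarrow> real) \<Rightarrow> (real^'n::finite \<Rightarrow> complex) \<Rightarrow> real^'n \<Rightarrow> ennreal" where
  "max_wave \<alpha> \<tau> F x = (SUP k. ennreal ((cmod (wave \<alpha> (\<tau> k) F x))\<^sup>2))"

lemma max_wave_measurable [measurable (raw)]:
  assumes [measurable]: "F \<in> borel_measurable borel" "g \<in> borel_measurable M"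
  shows "(\<lambda>p. max_wave \<alpha> \<tau> F (g p)) \<in> borel_measurable M"
  unfolding max_wave_def by measurable

definition frostman :: "real \<Rightarrow> real \<Rightarrow> (real^'n::finite) measure \<Rightarrow> bool" where
  "frostman \<gamma> D \<mu> \<longleftrightarrow> sets \<mu> = sets borel \<and> D \<in> ball_growth_constants \<gamma> \<mu>"

lemma frostman_gamma_dimensional: "frostman \<gamma> D \<mu> \<Longrightarrow> gamma_dimensional \<gamma> \<mu>"
  by (auto simp: frostman_def gamma_dimensional_def)

lemma frostman_sets: "frostman \<gamma> D \<mu> \<Longrightarrow> sets \<mu> = sets borel"
  by (simp add: frostman_def)

lemma frostman_nonneg: "frostman \<gamma> D \<mu> \<Longrightarrow> 0 \<le> D"
  by (simp add: frostman_def ball_growth_constants_def)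

text \<open>Stated for squares and for every admissible growth constant \<open>D\<close>, so that neither square
  roots nor infima appear in the argument. The argument \<open>ty\<close> only fixes the dimension.\<close>

definition maximal_bound :: "'n::finite itself \<Rightarrow> real \<Rightarrow> real \<Rightarrow> real \<Rightarrow> real set \<Rightarrow> real \<Rightarrow> bool" where
  "maximal_bound ty \<alpha> \<gamma> \<sigma> T C \<longleftrightarrow> 0 \<le> C \<and>
     (\<forall>(H :: real^'n \<Rightarrow> complex) \<mu> D \<tau>. tame H \<longrightarrow> frostman \<gamma> D \<mu> \<longrightarrow> (\<forall>k. \<tau> k \<in> T) \<longrightarrow>
        (\<integral>\<^sup>+x\<in>ball 0 1. max_wave \<alpha> \<tau> H x \<partial>\<mu>) \<le> ennreal (C * D) * sobolev_sq \<sigma> H)"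

lemma maximal_boundD:
  assumes "maximal_bound TYPE('n::finite) \<alpha> \<gamma> \<sigma> T C" "tame (H :: real^'n \<Rightarrow> complex)" "frostman \<gamma> D \<mu>" "\<And>k. \<tau> k \<in> T"
  shows "(\<integral>\<^sup>+x\<in>ball 0 1. max_wave \<alpha> \<tau> H x \<partial>\<mu>) \<le> ennreal (C * D) * sobolev_sq \<sigma> H"
  using assms unfolding maximal_bound_def by blast

text \<open>The hypothesis is applied to packets with \<open>\<epsilon> = 1 / (m + 1)\<close>. Their Sobolev norms are
  bounded uniformly in \<open>m\<close> and their evolutions converge pointwise, so Fatou's lemma
  applies.\<close>

lemma maximal_bound_tame:
  fixes C :: real
  assumes \<alpha>: "\<alpha> > 0" and \<sigma>: "\<sigma> > 0" and C: "C \<ge> 0"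
    and hyp: "\<And>(f :: real^'n::finite \<Rightarrow> complex) \<mu>. schwartz f \<Longrightarrow> gamma_dimensional \<gamma> \<mu> \<Longrightarrow>
           L2_norm_on \<mu> (ball 0 1) (\<lambda>x. SUP \<tau>\<in>{0<..<1}. ennreal (cmod (propagator \<alpha> \<tau> f x)))
           \<le> ennreal (C * sqrt (dim_const \<gamma> \<mu>)) * sobolev_norm \<sigma> f"
  shows "\<exists>C'. maximal_bound TYPE('n) \<alpha> \<gamma> \<sigma> {0<..<1} C'"
proof -
  define K where "K = enn2real (\<integral>\<^sup>+(\<eta>::real^'n). ennreal ((1 + (norm \<eta>)\<^sup>2) powr \<sigma> * gauss \<eta>) \<partial>lborel)"
  have K: "(\<integral>\<^sup>+(\<eta>::real^'n). ennreal ((1 + (norm \<eta>)\<^sup>2) powr \<sigma> * gauss \<eta>) \<partial>lborel) = ennreal K"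
    unfolding K_def using gauss_moment_finite[OF \<sigma>, where 'n='n] by (simp add: ennreal_enn2real)
  have K0: "0 \<le> K" by (simp add: K_def)
  define C' where "C' = C\<^sup>2 * (((2 * pi) ^ CARD('n))\<^sup>2 * 2 powr \<sigma> * K)"
  have "(\<integral>\<^sup>+x\<in>ball 0 1. max_wave \<alpha> \<tau> H x \<partial>\<mu>) \<le> ennreal (C' * D) * sobolev_sq \<sigma> H"
    if H: "tame H" and \<mu>: "frostman \<gamma> D \<mu>" and \<tau>: "\<And>k. \<tau> k \<in> {0<..<1}"
    for H :: "real^'n \<Rightarrow> complex" and \<mu> D \<tau>
  proof -
    have [measurable]: "H \<in> borel_measurable borel" by (rule tame_measurable[OF H])
    have [measurable_cong]: "sets \<mu> = sets borel" by (rule frostman_sets[OF \<mu>])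
    have D: "dim_const \<gamma> \<mu> \<le> D" using \<mu> by (intro dim_const_le) (simp add: frostman_def)
    have d0: "0 \<le> dim_const \<gamma> \<mu>" by (rule dim_const_nonneg[OF frostman_gamma_dimensional[OF \<mu>]])
    define f where "f m = packet (1 / real (Suc m)) H" for m
    have fS: "schwartz (f m)" for m unfolding f_def by (rule schwartz_packet[OF H]) simp
    define M where "M m x = (SUP k. ennreal ((cmod (propagator \<alpha> (\<tau> k) (f m) x))\<^sup>2))" for m x
    have fm[measurable]: "fourier (f m) \<in> borel_measurable borel" for m
    proof -
      have [measurable]: "f m \<in> borel_measurable borel" unfolding f_def packet_def[abs_def] by measurable
      show ?thesis unfolding fourier_def[abs_def] by measurable
    qed
    have [measurable]: "M m \<in> borel_measurable borel" for m
      unfolding M_def[abs_def] propagator_def by measurable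
    have M: "(\<integral>\<^sup>+x\<in>ball 0 1. M m x \<partial>\<mu>) \<le> ennreal (C' * D) * sobolev_sq \<sigma> H" for m
    proof -
      have "L2_norm_on \<mu> (ball 0 1) (\<lambda>x. SUP \<tau>\<in>{0<..<1}. ennreal (cmod (propagator \<alpha> \<tau> (f m) x)))
           \<le> ennreal (C * sqrt (dim_const \<gamma> \<mu>)) * sobolev_norm \<sigma> (f m)"
        by (rule hyp[OF fS frostman_gamma_dimensional[OF \<mu>]])
      then have "(\<integral>\<^sup>+x\<in>ball 0 1. (SUP \<tau>\<in>{0<..<1}. ennreal (cmod (propagator \<alpha> \<tau> (f m) x)))\<^sup>2 \<partial>\<mu>)
          \<le> ennreal ((C * sqrt (dim_const \<gamma> \<mu>))\<^sup>2) * sobolev_sq \<sigma> (fourier (f m))"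
        unfolding L2_norm_on_def sobolev_norm_eq using C d0 by (subst (asm) ennreal_sqrt_le_iff) auto
      also have "ennreal ((C * sqrt (dim_const \<gamma> \<mu>))\<^sup>2) \<le> ennreal (C\<^sup>2 * D)"
        using D d0 by (intro ennreal_leI) (simp add: power_mult_distrib mult_left_mono)
      also have "sobolev_sq \<sigma> (fourier (f m)) \<le> ennreal (((2 * pi) ^ CARD('n))\<^sup>2 * 2 powr \<sigma>) * ennreal K * sobolev_sq \<sigma> H"
        unfolding f_def K[symmetric] by (rule sobolev_sq_fourier_packet[OF H _ _ \<sigma>]) auto
      also have "ennreal (C\<^sup>2 * D) * (ennreal (((2 * pi) ^ CARD('n))\<^sup>2 * 2 powr \<sigma>) * ennreal K * sobolev_sq \<sigma> H) = ennreal (C' * D) * sobolev_sq \<sigma> H"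
        using K0 D d0 C unfolding C'_def by (simp add: ennreal_mult[symmetric] mult.assoc[symmetric]) (simp add: mult_ac)
      finally have *: "(\<integral>\<^sup>+x\<in>ball 0 1. (SUP \<tau>\<in>{0<..<1}. ennreal (cmod (propagator \<alpha> \<tau> (f m) x)))\<^sup>2 \<partial>\<mu>) \<le> ennreal (C' * D) * sobolev_sq \<sigma> H"
        by (simp add: mult_left_mono mult_right_mono)
      have "M m x \<le> (SUP \<tau>\<in>{0<..<1}. ennreal (cmod (propagator \<alpha> \<tau> (f m) x)))\<^sup>2" for x
        unfolding M_def
      proof (intro SUP_least)
        fix k
        have "ennreal ((cmod (propagator \<alpha> (\<tau> k) (f m) x))\<^sup>2) = (ennreal (cmod (propagator \<alpha> (\<tau> k) (f m) x)))\<^sup>2"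
          by (simp add: ennreal_power)
        also have "\<dots> \<le> (SUP \<tau>\<in>{0<..<1}. ennreal (cmod (propagator \<alpha> \<tau> (f m) x)))\<^sup>2"
          by (intro power_mono SUP_upper \<tau>) auto
        finally show "ennreal ((cmod (propagator \<alpha> (\<tau> k) (f m) x))\<^sup>2) \<le> \<dots>" .
      qed
      then have "(\<integral>\<^sup>+x\<in>ball 0 1. M m x \<partial>\<mu>) \<le> (\<integral>\<^sup>+x\<in>ball 0 1. (SUP \<tau>\<in>{0<..<1}. ennreal (cmod (propagator \<alpha> \<tau> (f m) x)))\<^sup>2 \<partial>\<mu>)"
        by (intro nn_integral_mono mult_right_mono) auto
      with * show ?thesis by (rule order_trans[rotated])
    qed
    have lim: "max_wave \<alpha> \<tau> H x \<le> liminf (\<lambda>m. M m x)" for x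
      unfolding max_wave_def
    proof (intro SUP_least)
      fix k
      have "(\<lambda>m. ennreal ((cmod (propagator \<alpha> (\<tau> k) (f m) x))\<^sup>2)) \<longlonglongrightarrow> ennreal ((cmod (wave \<alpha> (\<tau> k) H x))\<^sup>2)"
        unfolding f_def by (intro tendsto_ennrealI tendsto_intros propagator_packet_limit H \<alpha>)
      then have "ennreal ((cmod (wave \<alpha> (\<tau> k) H x))\<^sup>2) = liminf (\<lambda>m. ennreal ((cmod (propagator \<alpha> (\<tau> k) (f m) x))\<^sup>2))"
        by (intro lim_imp_Liminf[symmetric]) auto
      also have "\<dots> \<le> liminf (\<lambda>m. M m x)"
        unfolding M_def by (intro Liminf_mono always_eventually allI SUP_upper) auto
      finally show "ennreal ((cmod (wave \<alpha> (\<tau> k) H x))\<^sup>2) \<le> liminf (\<lambda>m. M m x)" .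
    qed
    have "(\<integral>\<^sup>+x\<in>ball 0 1. max_wave \<alpha> \<tau> H x \<partial>\<mu>) \<le> (\<integral>\<^sup>+x. liminf (\<lambda>m. M m x * indicator (ball 0 1) x) \<partial>\<mu>)"
    proof (intro nn_integral_mono)
      fix x
      show "max_wave \<alpha> \<tau> H x * indicator (ball 0 1) x \<le> liminf (\<lambda>m. M m x * indicator (ball 0 1) x)"
        using lim[of x] by (cases "x \<in> ball 0 1") auto
    qed
    also have "\<dots> \<le> liminf (\<lambda>m. \<integral>\<^sup>+x\<in>ball 0 1. M m x \<partial>\<mu>)"
      by (intro nn_integral_liminf) measurable
    also have "\<dots> \<le> ennreal (C' * D) * sobolev_sq \<sigma> H"
      by (intro Liminf_le always_eventually allI M) auto
    finally show ?thesis .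
  qed
  moreover have "0 \<le> C'" unfolding C'_def using K0 C by simp
  ultimately show ?thesis unfolding maximal_bound_def by blast
qed

text \<open>This reduces other time intervals to \<open>(0, 1)\<close> and other fixed times to \<open>0\<close>, since
  modulating the profile changes no norm.\<close>

lemma wave_shift: "wave \<alpha> (t + q) H x = wave \<alpha> t (\<lambda>\<xi>. cis (q * norm \<xi> powr \<alpha>) * H \<xi>) x"
  unfolding wave_def
  by (simp add: mult.assoc[symmetric] cis_mult algebra_simps)

lemma tame_modulate: "tame H \<Longrightarrow> tame (\<lambda>\<xi>. cis (q * norm \<xi> powr \<alpha>) * H \<xi>)"
  by (rule tame_mult[where K=1]) auto

lemma sobolev_sq_modulate: "sobolev_sq \<sigma> (\<lambda>\<xi>. cis (q \<xi>) * H \<xi>) = sobolev_sq \<sigma> H"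
  by (simp add: sobolev_sq_def norm_mult)

text \<open>Every time in \<open>[-M, M]\<close> lies in \<open>(q/2, q/2 + 1)\<close> for some integer \<open>q\<close> from a finite set.
  Half-integer steps are needed because the interval \<open>(0, 1)\<close> is open.\<close>

lemma maximal_bound_long_time:
  assumes b: "maximal_bound TYPE('n::finite) \<alpha> \<gamma> \<sigma> {0<..<1} C"
  shows "\<exists>C'. maximal_bound TYPE('n) \<alpha> \<gamma> \<sigma> {-M..M} C'"
proof -
  define J where "J = {- \<lceil>2 * M\<rceil> - 1 .. \<lceil>2 * M\<rceil>}"
  have C: "0 \<le> C" using b by (simp add: maximal_bound_def)
  have "(\<integral>\<^sup>+x\<in>ball 0 1. max_wave \<alpha> \<tau> H x \<partial>\<mu>) \<le> ennreal (real (card J) * C * D) * sobolev_sq \<sigma> H"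
    if H: "tame H" and \<mu>: "frostman \<gamma> D \<mu>" and \<tau>: "\<And>k. \<tau> k \<in> {-M..M}"
    for H :: "real^'n \<Rightarrow> complex" and \<mu> D \<tau>
  proof -
    have [measurable]: "H \<in> borel_measurable borel" by (rule tame_measurable[OF H])
    have [measurable_cong]: "sets \<mu> = sets borel" by (rule frostman_sets[OF \<mu>])
    \<comment> \<open>times outside \<open>(q/2, q/2 + 1)\<close> are replaced by a dummy value inside the interval\<close>
    define T where "T q k = (if 0 < \<tau> k - q / 2 \<and> \<tau> k - q / 2 < 1 then \<tau> k - q / 2 else 1 / 2)" for q :: int and k
    define Hq where "Hq q \<xi> = cis (of_int q / 2 * norm \<xi> powr \<alpha>) * H \<xi>" for q :: int and \<xi>
    have [measurable]: "Hq q \<in> borel_measurable borel" for q unfolding Hq_def[abs_def] by measurable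
    have le: "max_wave \<alpha> \<tau> H x \<le> (\<Sum>q\<in>J. max_wave \<alpha> (T q) (Hq q) x)" for x
      unfolding max_wave_def[of \<alpha> \<tau>]
    proof (intro SUP_least)
      fix k
      define q where "q = \<lceil>2 * \<tau> k\<rceil> - 1"
      have q: "of_int q < 2 * \<tau> k" "2 * \<tau> k \<le> of_int q + 1" unfolding q_def by linarith+
      have "q \<in> J" using \<tau>[of k] q unfolding J_def by (auto; linarith)
      have "T q k + q / 2 = \<tau> k" using q by (simp add: T_def)
      then have "wave \<alpha> (\<tau> k) H x = wave \<alpha> (T q k) (Hq q) x"
        using wave_shift[of \<alpha> "T q k" "q / 2" H x] by (simp add: Hq_def[abs_def])
      then have "ennreal ((cmod (wave \<alpha> (\<tau> k) H x))\<^sup>2) \<le> max_wave \<alpha> (T q) (Hq q) x"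
        unfolding max_wave_def by (auto intro: SUP_upper2[where i=k])
      also have "\<dots> \<le> (\<Sum>q\<in>J. max_wave \<alpha> (T q) (Hq q) x)"
        by (rule member_le_sum[OF \<open>q \<in> J\<close>]) (auto simp: J_def)
      finally show "ennreal ((cmod (wave \<alpha> (\<tau> k) H x))\<^sup>2) \<le> \<dots>" .
    qed
    have "(\<integral>\<^sup>+x\<in>ball 0 1. max_wave \<alpha> \<tau> H x \<partial>\<mu>) \<le> (\<integral>\<^sup>+x. (\<Sum>q\<in>J. max_wave \<alpha> (T q) (Hq q) x * indicator (ball 0 1) x) \<partial>\<mu>)"
      unfolding sum_distrib_right[symmetric] by (intro nn_integral_mono mult_right_mono le) auto
    also have "\<dots> = (\<Sum>q\<in>J. \<integral>\<^sup>+x\<in>ball 0 1. max_wave \<alpha> (T q) (Hq q) x \<partial>\<mu>)"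
      by (intro nn_integral_sum) measurable
    also have "\<dots> \<le> (\<Sum>q\<in>J. ennreal (C * D) * sobolev_sq \<sigma> H)"
    proof (intro sum_mono)
      fix q
      have "(\<integral>\<^sup>+x\<in>ball 0 1. max_wave \<alpha> (T q) (Hq q) x \<partial>\<mu>) \<le> ennreal (C * D) * sobolev_sq \<sigma> (Hq q)"
        by (rule maximal_boundD[OF b _ \<mu>]) (unfold Hq_def[abs_def], rule tame_modulate[OF H], auto simp: T_def)
      then show "(\<integral>\<^sup>+x\<in>ball 0 1. max_wave \<alpha> (T q) (Hq q) x \<partial>\<mu>) \<le> ennreal (C * D) * sobolev_sq \<sigma> H"
        unfolding Hq_def[abs_def] sobolev_sq_modulate .
    qed
    also have "\<dots> = ennreal (real (card J) * C * D) * sobolev_sq \<sigma> H"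
      using frostman_nonneg[OF \<mu>] C by (simp add: ennreal_mult mult.assoc ennreal_of_nat_eq_real_of_nat)
    finally show ?thesis .
  qed
  then show ?thesis using C unfolding maximal_bound_def by (intro exI[of _ "real (card J) * C"]) auto
qed

text \<open>The measure \<open>l^\<gamma> \<mu>\<close>, transported by \<open>x \<mapsto> l (x - z)\<close>, has the same growth constant as \<open>\<mu>\<close>,
  because \<open>\<gamma>\<close>-dimensionality is scale invariant. Under this dilation the time \<open>t\<close> becomes
  \<open>t l^\<alpha>\<close>.\<close>

lemma maximal_bound_rescaled:
  fixes H :: "real^'n::finite \<Rightarrow> complex"
  assumes b: "maximal_bound TYPE('n) \<alpha> \<gamma> \<sigma> {-1..1} C"
    and H: "tame H" and \<mu>: "frostman \<gamma> D \<mu>" and l: "l > 0" and \<tau>: "\<And>k. \<bar>\<tau> k\<bar> * l powr \<alpha> \<le> 1"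
  shows "(\<integral>\<^sup>+x\<in>ball z (1 / l). max_wave \<alpha> \<tau> H (x - z) \<partial>\<mu>)
    \<le> ennreal (C * D * l powr (real CARD('n) - \<gamma>)) * (\<integral>\<^sup>+\<omega>. ennreal ((1 + (norm \<omega> / l)\<^sup>2) powr \<sigma> * (cmod (H \<omega>))\<^sup>2) \<partial>lborel)"
proof -
  have [measurable]: "H \<in> borel_measurable borel" by (rule tame_measurable[OF H])
  have S[measurable_cong]: "sets \<mu> = sets borel" by (rule frostman_sets[OF \<mu>])
  have C: "0 \<le> C" using b by (simp add: maximal_bound_def)
  have D: "0 \<le> D" by (rule frostman_nonneg[OF \<mu>])
  define T where "T x = l *\<^sub>R (x - z)" for x
  have [measurable]: "T \<in> borel_measurable borel" unfolding T_def[abs_def] by measurable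
  define \<nu> where "\<nu> = scale_measure (ennreal (l powr \<gamma>)) (distr \<mu> borel T)"
  have \<nu>: "frostman \<gamma> D \<nu>"
    unfolding frostman_def ball_growth_constants_def
  proof (intro conjI CollectI allI impI D)
    show "sets \<nu> = sets borel" by (simp add: \<nu>_def)
    fix y and \<rho> :: real assume \<rho>: "0 < \<rho>"
    have "T -` ball y \<rho> = ball (z + (1 / l) *\<^sub>R y) (\<rho> / l)"
    proof (intro set_eqI)
      fix x
      have "y - T x = l *\<^sub>R ((z + (1 / l) *\<^sub>R y) - x)" using l by (simp add: T_def algebra_simps)
      then have "norm (y - T x) = l * norm ((z + (1 / l) *\<^sub>R y) - x)" using l by simp
      then show "x \<in> T -` ball y \<rho> \<longleftrightarrow> x \<in> ball (z + (1 / l) *\<^sub>R y) (\<rho> / l)"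
        using l by (simp add: dist_norm field_simps)
    qed
    then have "emeasure \<nu> (ball y \<rho>) = ennreal (l powr \<gamma>) * emeasure \<mu> (ball (z + (1 / l) *\<^sub>R y) (\<rho> / l))"
      by (simp add: \<nu>_def emeasure_distr sets_eq_imp_space_eq[OF S])
    also have "\<dots> \<le> ennreal (l powr \<gamma>) * ennreal (D * (\<rho> / l) powr \<gamma>)"
      using \<mu> \<rho> l by (intro mult_left_mono) (auto simp: frostman_def ball_growth_constants_def)
    also have "\<dots> = ennreal (D * \<rho> powr \<gamma>)"
      using \<rho> l by (subst ennreal_mult'[symmetric]) (auto simp: powr_divide)
    finally show "emeasure \<nu> (ball y \<rho>) \<le> ennreal (D * \<rho> powr \<gamma>)" .
  qed
  let ?d = "CARD('n)"
  define H' where "H' \<omega> = of_real (l ^ ?d) * H (l *\<^sub>R \<omega>)" for \<omega>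
  have H': "tame H'"
  proof -
    obtain B R where B: "\<And>\<xi>. cmod (H \<xi>) \<le> B" and R: "\<And>\<xi>. R < norm \<xi> \<Longrightarrow> H \<xi> = 0"
      using H unfolding tame_def by blast
    have "cmod (H' \<xi>) \<le> l ^ ?d * B" for \<xi>
      unfolding H'_def norm_mult using l by (auto simp: norm_power intro!: mult_left_mono B)
    moreover have "H' \<xi> = 0" if "R / l < norm \<xi>" for \<xi>
      unfolding H'_def using that l by (simp add: R field_simps)
    moreover have "H' \<in> borel_measurable borel" unfolding H'_def[abs_def] by measurable
    ultimately show ?thesis unfolding tame_def by blast
  qed
  have [measurable]: "H' \<in> borel_measurable borel" by (rule tame_measurable[OF H'])
  have w: "wave \<alpha> (t * l powr \<alpha>) H' (l *\<^sub>R y) = wave \<alpha> t H y" for t y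
  proof -
    have "wave \<alpha> t H y = l ^ ?d *\<^sub>R (LINT \<omega>|lborel. cis (y \<bullet> (0 + l *\<^sub>R \<omega>) + t * norm (0 + l *\<^sub>R \<omega>) powr \<alpha>) * H (0 + l *\<^sub>R \<omega>))"
      unfolding wave_def using l by (subst integral_affine[of _ l 0]) auto
    also have "\<dots> = of_real (l ^ ?d) * (LINT \<omega>|lborel. cis ((l *\<^sub>R y) \<bullet> \<omega> + t * l powr \<alpha> * norm \<omega> powr \<alpha>) * H (l *\<^sub>R \<omega>))"
      using l by (simp add: scaleR_conv_of_real[where 'a=complex] powr_mult mult_ac)
    also have "\<dots> = wave \<alpha> (t * l powr \<alpha>) H' (l *\<^sub>R y)"
      unfolding wave_def H'_def integral_mult_right_zero[symmetric] by (simp add: mult_ac)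
    finally show ?thesis ..
  qed
  define \<tau>' where "\<tau>' k = \<tau> k * l powr \<alpha>" for k
  have mw: "max_wave \<alpha> \<tau>' H' (T x) = max_wave \<alpha> \<tau> H (x - z)" for x
    unfolding max_wave_def \<tau>'_def T_def w ..
  have ind: "indicator (ball 0 1) (T x) = (indicator (ball z (1 / l)) x :: ennreal)" for x
  proof -
    have "norm (T x) < 1 \<longleftrightarrow> norm (z - x) < 1 / l"
      unfolding T_def norm_scaleR norm_minus_commute[of z x] using l by (simp add: field_simps)
    then show ?thesis by (simp add: indicator_def dist_norm)
  qed
  define S0 where "S0 = (\<integral>\<^sup>+\<omega>. ennreal ((1 + (norm \<omega> / l)\<^sup>2) powr \<sigma> * (cmod (H \<omega>))\<^sup>2) \<partial>lborel)"
  have sob: "sobolev_sq \<sigma> H' = ennreal (l ^ ?d) * S0"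
  proof -
    have "S0 = ennreal (l ^ ?d) * (\<integral>\<^sup>+\<omega>. ennreal ((1 + (norm \<omega>)\<^sup>2) powr \<sigma> * (cmod (H (l *\<^sub>R \<omega>)))\<^sup>2) \<partial>lborel)"
      unfolding S0_def using l by (subst nn_integral_affine[of _ l 0]) (auto simp: ennreal_power)
    then have "ennreal (l ^ ?d) * S0 = (\<integral>\<^sup>+\<omega>. ennreal (l ^ ?d) * (ennreal (l ^ ?d) * ennreal ((1 + (norm \<omega>)\<^sup>2) powr \<sigma> * (cmod (H (l *\<^sub>R \<omega>)))\<^sup>2)) \<partial>lborel)"
      by (simp add: nn_integral_cmult)
    also have "\<dots> = sobolev_sq \<sigma> H'"
      unfolding sobolev_sq_def H'_def using l
      by (intro nn_integral_cong) (simp add: norm_mult power_mult_distrib ennreal_mult[symmetric] norm_power power2_eq_square mult_ac)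
    finally show ?thesis ..
  qed
  have "ennreal (l powr \<gamma>) * (\<integral>\<^sup>+x\<in>ball z (1 / l). max_wave \<alpha> \<tau> H (x - z) \<partial>\<mu>) = (\<integral>\<^sup>+x\<in>ball 0 1. max_wave \<alpha> \<tau>' H' x \<partial>\<nu>)"
    unfolding \<nu>_def by (simp add: nn_integral_scale_measure nn_integral_distr mw ind)
  also have "\<dots> \<le> ennreal (C * D) * sobolev_sq \<sigma> H'"
  proof (rule maximal_boundD[OF b H' \<nu>])
    fix k
    have "\<bar>\<tau>' k\<bar> \<le> 1" using \<tau>[of k] by (simp add: \<tau>'_def abs_mult)
    then show "\<tau>' k \<in> {-1..1}" by (simp add: abs_le_iff)
  qed
  finally have "ennreal (l powr - \<gamma>) * (ennreal (l powr \<gamma>) * (\<integral>\<^sup>+x\<in>ball z (1 / l). max_wave \<alpha> \<tau> H (x - z) \<partial>\<mu>)) \<le> ennreal (l powr - \<gamma>) * (ennreal (C * D) * sobolev_sq \<sigma> H')"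
    by (intro mult_left_mono) auto
  also have "ennreal (l powr - \<gamma>) * (ennreal (l powr \<gamma>) * (\<integral>\<^sup>+x\<in>ball z (1 / l). max_wave \<alpha> \<tau> H (x - z) \<partial>\<mu>)) = (\<integral>\<^sup>+x\<in>ball z (1 / l). max_wave \<alpha> \<tau> H (x - z) \<partial>\<mu>)"
    using l by (simp add: mult.assoc[symmetric] ennreal_mult[symmetric] powr_add[symmetric])
  also have "ennreal (l powr - \<gamma>) * (ennreal (C * D) * sobolev_sq \<sigma> H') = ennreal (C * D * l powr (real ?d - \<gamma>)) * S0"
  proof -
    have "l powr (real ?d - \<gamma>) = l powr - \<gamma> * l ^ ?d"
      using l by (simp add: powr_diff powr_realpow powr_minus field_simps)
    then show ?thesis unfolding sob using C D l by (simp add: ennreal_mult mult_ac)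
  qed
  finally show ?thesis unfolding S0_def .
qed

section \<open>Removal of a bounded phase\<close>

lemma suminf_exp_series_ennreal:
  assumes "0 \<le> K" shows "(\<Sum>j. ennreal (K ^ j / fact j)) = ennreal (exp K)"
proof -
  have "(\<lambda>j. K ^ j / fact j) sums exp K" using exp_converges[of K] by (simp add: divide_inverse mult.commute)
  then show ?thesis using assms by (intro sums_unique[symmetric] sums_ennreal[THEN iffD2]) auto
qed

text \<open>Cauchy-Schwarz for the weights \<open>K^j / j!\<close>, whose total mass is \<open>exp K\<close>.\<close>

lemma weighted_series_square_le:
  fixes y :: "nat \<Rightarrow> ennreal"
  assumes "K > 0"
  shows "(\<Sum>j. ennreal (K ^ j / fact j) * y j)\<^sup>2 \<le> ennreal (exp K) * (\<Sum>j. ennreal (K ^ j / fact j) * (y j)\<^sup>2)"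
proof -
  let ?w = "\<lambda>j. K ^ j / fact j"
  have w: "(\<Sum>j. ennreal (?w j)) = ennreal (exp K)" using assms by (intro suminf_exp_series_ennreal) simp
  have s: "ennreal (sqrt (?w j)) * ennreal (sqrt (?w j)) = ennreal (?w j)" for j
    using assms by (subst ennreal_mult[symmetric]) auto
  have "(\<Sum>j. ennreal (?w j) * y j)\<^sup>2 = (\<integral>\<^sup>+j. (ennreal (sqrt (?w j)) * y j) * ennreal (sqrt (?w j)) \<partial>count_space UNIV)\<^sup>2"
    unfolding nn_integral_count_space_nat by (simp add: s[symmetric] mult_ac)
  also have "\<dots> \<le> (\<integral>\<^sup>+j. (ennreal (sqrt (?w j)) * y j)\<^sup>2 \<partial>count_space UNIV) * (\<integral>\<^sup>+j. (ennreal (sqrt (?w j)))\<^sup>2 \<partial>count_space UNIV)"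
    by (rule Cauchy_Schwarz_nn_integral) auto
  also have "\<dots> = ennreal (exp K) * (\<Sum>j. ennreal (?w j) * (y j)\<^sup>2)"
    unfolding nn_integral_count_space_nat power_mult_distrib by (simp add: power2_eq_square s w mult.commute)
  finally show ?thesis .
qed

lemma norm_suminf_le_ennreal:
  fixes f :: "nat \<Rightarrow> complex"
  assumes "f sums s"
  shows "ennreal (cmod s) \<le> (\<Sum>j. ennreal (cmod (f j)))"
proof (cases "summable (\<lambda>j. cmod (f j))")
  case True
  have "cmod s \<le> (\<Sum>j. cmod (f j))" using summable_norm[OF True] sums_unique[OF assms] by simp
  then show ?thesis by (subst suminf_ennreal2[OF _ True]) (auto intro: ennreal_leI)
next
  case False
  then have "(\<Sum>j. ennreal (cmod (f j))) = top"
    using summable_suminf_not_top[of "\<lambda>j. cmod (f j)"] norm_ge_zero by blast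
  then show ?thesis by simp
qed

text \<open>In the expansion of \<open>exp (i u b)\<close> the powers of \<open>u\<close> are bounded by one and leave the
  integral over \<open>w\<close>, and the powers of \<open>b\<close> are absorbed into the multiplier \<open>m\<close>, which is
  arbitrary in the assumption \<open>bound\<close>. The \<open>j\<close>-th term costs \<open>K^j / j!\<close>.\<close>

lemma phase_factor:
  fixes e :: "nat \<Rightarrow> 'p \<Rightarrow> 'w \<Rightarrow> complex" and u :: "nat \<Rightarrow> 'p \<Rightarrow> real" and b :: "'w \<Rightarrow> real"
  assumes W: "sigma_finite_measure W" and K: "K > 0"
    and e[measurable]: "\<And>k. (\<lambda>(p, w). e k p w) \<in> borel_measurable (P \<Otimes>\<^sub>M W)"
    and int: "\<And>k p. integrable W (e k p)"
    and u[measurable]: "\<And>k. u k \<in> borel_measurable P" and u1: "AE p in P. \<forall>k. \<bar>u k p\<bar> \<le> 1"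
    and b[measurable]: "b \<in> borel_measurable W" and bK: "\<And>w. \<bar>b w\<bar> \<le> K"
    and bound: "\<And>m M. m \<in> borel_measurable W \<Longrightarrow> 0 \<le> M \<Longrightarrow> (\<And>w. cmod (m w) \<le> M) \<Longrightarrow>
       (\<integral>\<^sup>+p. (SUP k. ennreal ((cmod (LINT w|W. e k p w * m w))\<^sup>2)) \<partial>P) \<le> A * ennreal (M\<^sup>2)"
    and m[measurable]: "m \<in> borel_measurable W" and M: "0 \<le> M" "\<And>w. cmod (m w) \<le> M"
  shows "(\<integral>\<^sup>+p. (SUP k. ennreal ((cmod (LINT w|W. e k p w * cis (u k p * b w) * m w))\<^sup>2)) \<partial>P)
     \<le> A * ennreal (exp (2 * K)) * ennreal (M\<^sup>2)"
proof -
  interpret W: sigma_finite_measure W by (rule W)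
  define mj where "mj j w = (\<i> * of_real (b w)) ^ j * m w" for j :: nat and w
  have [measurable]: "mj j \<in> borel_measurable W" for j unfolding mj_def[abs_def] by measurable
  have mj: "cmod (mj j w) \<le> K ^ j * M" for j w
    unfolding mj_def norm_mult norm_power using M K bK
    by (intro mult_mono) (auto simp: norm_mult intro!: power_mono)
  define E where "E j k p = (LINT w|W. e k p w * mj j w)" for j :: nat and k p
  define S where "S j p = (SUP k. ennreal ((cmod (E j k p))\<^sup>2))" for j p
  have [measurable]: "E j k \<in> borel_measurable P" for j k
    unfolding E_def[abs_def] by measurable
  have [measurable]: "S j \<in> borel_measurable P" for j unfolding S_def[abs_def] by measurable
  let ?w = "\<lambda>j. K ^ j / fact j"
  have sw: "summable ?w" using summable_exp[of K] by (simp add: divide_inverse mult.commute)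
  have expand: "(\<lambda>j. of_real (u k p ^ j / fact j) * E j k p) sums (LINT w|W. e k p w * cis (u k p * b w) * m w)"
    if up: "\<bar>u k p\<bar> \<le> 1" for k p
  proof -
    define f where "f j w = of_real (u k p ^ j / fact j) * (e k p w * mj j w)" for j :: nat and w
    have emi: "integrable W (\<lambda>w. e k p w * mj j w)" for j
    proof (rule Bochner_Integration.integrable_bound)
      show "integrable W (\<lambda>w. (K ^ j * M) * cmod (e k p w))" using int[of k p] by simp
      have [measurable]: "e k p \<in> borel_measurable W" using int[of k p] by simp
      show "(\<lambda>w. e k p w * mj j w) \<in> borel_measurable W" by measurable
      show "AE w in W. cmod (e k p w * mj j w) \<le> norm ((K ^ j * M) * cmod (e k p w))"
      proof (intro AE_I2)
        fix w
        have "cmod (e k p w) * cmod (mj j w) \<le> cmod (e k p w) * (K ^ j * M)" by (intro mult_left_mono mj) auto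
        then show "cmod (e k p w * mj j w) \<le> norm ((K ^ j * M) * cmod (e k p w))"
          using K M by (simp add: norm_mult mult_ac abs_mult)
      qed
    qed
    have nf: "cmod (f j w) \<le> ?w j * M * cmod (e k p w)" for j w
    proof -
      have "cmod (f j w) = \<bar>u k p\<bar> ^ j / fact j * (cmod (e k p w) * cmod (mj j w))"
        by (simp add: f_def norm_mult norm_divide norm_power)
      also have "\<dots> \<le> 1 ^ j / fact j * (cmod (e k p w) * (K ^ j * M))"
        using up by (intro mult_mono divide_right_mono power_mono mj) auto
      finally show ?thesis by (simp add: mult_ac)
    qed
    have fs: "(\<lambda>j. f j w) sums (e k p w * cis (u k p * b w) * m w)" for w
    proof -
      have "(\<lambda>j. (\<i> * of_real (u k p * b w)) ^ j /\<^sub>R fact j) sums cis (u k p * b w)"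
        unfolding cis_conv_exp by (rule exp_converges)
      then have "(\<lambda>j. e k p w * ((\<i> * of_real (u k p * b w)) ^ j /\<^sub>R fact j) * m w) sums (e k p w * cis (u k p * b w) * m w)"
        by (intro sums_mult sums_mult2)
      moreover have "e k p w * ((\<i> * of_real (u k p * b w)) ^ j /\<^sub>R fact j) * m w = f j w" for j
        by (simp add: f_def mj_def scaleR_conv_of_real power_mult_distrib field_simps)
      ultimately show ?thesis by simp
    qed
    have fi: "integrable W (f j)" for j unfolding f_def using emi by simp
    have "(\<lambda>j. integral\<^sup>L W (f j)) sums (LINT w|W. (\<Sum>j. f j w))"
    proof (rule sums_integral[OF fi])
      show "AE w in W. summable (\<lambda>j. norm (f j w))"
      proof (intro AE_I2)
        fix w show "summable (\<lambda>j. norm (f j w))"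
        proof (rule summable_comparison_test'[of "\<lambda>j. ?w j * (M * cmod (e k p w))" 0])
          show "summable (\<lambda>j. ?w j * (M * cmod (e k p w)))" by (intro summable_mult2 sw)
        qed (use nf in \<open>simp add: mult.assoc\<close>)
      qed
      show "summable (\<lambda>j. LINT w|W. norm (f j w))"
      proof (rule summable_comparison_test'[of "\<lambda>j. ?w j * (M * (LINT w|W. cmod (e k p w)))" 0])
        show "summable (\<lambda>j. ?w j * (M * (LINT w|W. cmod (e k p w))))" by (intro summable_mult2 sw)
        fix j :: nat
        have "(LINT w|W. norm (f j w)) \<le> (LINT w|W. ?w j * M * cmod (e k p w))"
          using fi int[of k p] nf by (intro Bochner_Integration.integral_mono) auto
        also have "\<dots> = ?w j * (M * (LINT w|W. cmod (e k p w)))"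
          by simp
        finally show "norm (LINT w|W. norm (f j w)) \<le> ?w j * (M * (LINT w|W. cmod (e k p w)))" by simp
      qed
    qed
    moreover have "(\<Sum>j. f j w) = e k p w * cis (u k p * b w) * m w" for w
      using fs sums_unique by metis
    moreover have "integral\<^sup>L W (f j) = of_real (u k p ^ j / fact j) * E j k p" for j
      unfolding f_def[abs_def] E_def by (rule integral_mult_right_zero)
    ultimately show ?thesis by simp
  qed
  have ptw: "(SUP k. ennreal ((cmod (LINT w|W. e k p w * cis (u k p * b w) * m w))\<^sup>2))
      \<le> ennreal (exp K) * (\<Sum>j. ennreal (?w j) * (ennreal (1 / (K ^ j)\<^sup>2) * S j p))"
    if up: "\<forall>k. \<bar>u k p\<bar> \<le> 1" for p
  proof (intro SUP_least)
    fix k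
    let ?y = "\<lambda>j. ennreal (cmod (E j k p) / K ^ j)"
    have "ennreal (cmod (LINT w|W. e k p w * cis (u k p * b w) * m w)) \<le> (\<Sum>j. ennreal (cmod (of_real (u k p ^ j / fact j) * E j k p)))"
      by (rule norm_suminf_le_ennreal[OF expand]) (use up in simp)
    also have "\<dots> \<le> (\<Sum>j. ennreal (?w j) * ?y j)"
    proof (intro suminf_le summableI)
      fix j
      have "cmod (of_real (u k p ^ j / fact j) * E j k p) = \<bar>u k p\<bar> ^ j / fact j * cmod (E j k p)"
        by (simp add: norm_mult norm_divide norm_power)
      also have "\<dots> \<le> 1 ^ j / fact j * cmod (E j k p)"
        using up by (intro mult_right_mono divide_right_mono power_mono) auto
      also have "\<dots> = ?w j * (cmod (E j k p) / K ^ j)" using K by simp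
      finally show "ennreal (cmod (of_real (u k p ^ j / fact j) * E j k p)) \<le> ennreal (?w j) * ?y j"
        using K by (subst ennreal_mult[symmetric]) (auto intro: ennreal_leI)
    qed
    finally have "(ennreal (cmod (LINT w|W. e k p w * cis (u k p * b w) * m w)))\<^sup>2 \<le> (\<Sum>j. ennreal (?w j) * ?y j)\<^sup>2"
      by (intro power_mono) auto
    also have "\<dots> \<le> ennreal (exp K) * (\<Sum>j. ennreal (?w j) * (?y j)\<^sup>2)"
      by (rule weighted_series_square_le[OF K])
    also have "\<dots> \<le> ennreal (exp K) * (\<Sum>j. ennreal (?w j) * (ennreal (1 / (K ^ j)\<^sup>2) * S j p))"
    proof (intro mult_left_mono suminf_le summableI)
      fix j
      have "(?y j)\<^sup>2 = ennreal (1 / (K ^ j)\<^sup>2) * ennreal ((cmod (E j k p))\<^sup>2)"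
        using K by (simp add: ennreal_power ennreal_mult[symmetric] power_divide)
      also have "\<dots> \<le> ennreal (1 / (K ^ j)\<^sup>2) * S j p"
        unfolding S_def by (intro mult_left_mono SUP_upper) auto
      finally show "(?y j)\<^sup>2 \<le> ennreal (1 / (K ^ j)\<^sup>2) * S j p" .
    qed auto
    finally show "ennreal ((cmod (LINT w|W. e k p w * cis (u k p * b w) * m w))\<^sup>2) \<le> \<dots>"
      by (simp add: ennreal_power)
  qed
  have "(\<integral>\<^sup>+p. (SUP k. ennreal ((cmod (LINT w|W. e k p w * cis (u k p * b w) * m w))\<^sup>2)) \<partial>P)
     \<le> (\<integral>\<^sup>+p. ennreal (exp K) * (\<Sum>j. ennreal (?w j) * (ennreal (1 / (K ^ j)\<^sup>2) * S j p)) \<partial>P)"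
    using u1 by (intro nn_integral_mono_AE) (auto intro: ptw)
  also have "\<dots> = ennreal (exp K) * (\<Sum>j. ennreal (?w j) * (ennreal (1 / (K ^ j)\<^sup>2) * (\<integral>\<^sup>+p. S j p \<partial>P)))"
    by (simp add: nn_integral_cmult nn_integral_suminf)
  also have "\<dots> \<le> ennreal (exp K) * (\<Sum>j. ennreal (?w j) * (A * ennreal (M\<^sup>2)))"
  proof (intro mult_left_mono suminf_le summableI)
    fix j
    have "(\<integral>\<^sup>+p. S j p \<partial>P) \<le> A * ennreal ((K ^ j * M)\<^sup>2)"
      unfolding S_def E_def using K M by (intro bound mj) auto
    then have "ennreal (1 / (K ^ j)\<^sup>2) * (\<integral>\<^sup>+p. S j p \<partial>P) \<le> ennreal (1 / (K ^ j)\<^sup>2) * (A * ennreal ((K ^ j * M)\<^sup>2))"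
      by (intro mult_left_mono) auto
    also have "\<dots> = A * (ennreal (1 / (K ^ j)\<^sup>2) * ennreal ((K ^ j * M)\<^sup>2))" by (simp add: mult_ac)
    also have "ennreal (1 / (K ^ j)\<^sup>2) * ennreal ((K ^ j * M)\<^sup>2) = ennreal (M\<^sup>2)"
      using K by (subst ennreal_mult[symmetric]) (auto simp: power_mult_distrib)
    finally show "ennreal (1 / (K ^ j)\<^sup>2) * (\<integral>\<^sup>+p. S j p \<partial>P) \<le> A * ennreal (M\<^sup>2)" .
  qed auto
  also have "\<dots> = ennreal (exp K) * (\<Sum>j. ennreal (?w j)) * (A * ennreal (M\<^sup>2))"
    by (simp add: mult.assoc)
  also have "(\<Sum>j. ennreal (?w j)) = ennreal (exp K)" using K by (intro suminf_exp_series_ennreal) simp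
  also have "ennreal (exp K) * ennreal (exp K) * (A * ennreal (M\<^sup>2)) = A * ennreal (exp (2 * K)) * ennreal (M\<^sup>2)"
    by (simp add: ennreal_mult[symmetric] exp_add[symmetric] mult_ac)
  finally show ?thesis .
qed

text \<open>Induction on the number of phases: the multiplier in the hypothesis is arbitrary, so the
  phases can be removed one at a time.\<close>

lemma phase_factors:
  fixes e :: "nat \<Rightarrow> 'p \<Rightarrow> 'w \<Rightarrow> complex" and u :: "'i \<Rightarrow> nat \<Rightarrow> 'p \<Rightarrow> real" and b :: "'i \<Rightarrow> 'w \<Rightarrow> real"
  assumes I: "finite I" and W: "sigma_finite_measure W" and K: "K > 0"
    and e[measurable]: "\<And>k. (\<lambda>(p, w). e k p w) \<in> borel_measurable (P \<Otimes>\<^sub>M W)"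
    and int: "\<And>k p. integrable W (e k p)"
    and u[measurable]: "\<And>i k. u i k \<in> borel_measurable P" and u1: "\<And>i. AE p in P. \<forall>k. \<bar>u i k p\<bar> \<le> 1"
    and b[measurable]: "\<And>i. b i \<in> borel_measurable W" and bK: "\<And>i w. \<bar>b i w\<bar> \<le> K"
    and bound: "\<And>m M. m \<in> borel_measurable W \<Longrightarrow> 0 \<le> M \<Longrightarrow> (\<And>w. cmod (m w) \<le> M) \<Longrightarrow>
       (\<integral>\<^sup>+p. (SUP k. ennreal ((cmod (LINT w|W. e k p w * m w))\<^sup>2)) \<partial>P) \<le> A * ennreal (M\<^sup>2)"
    and m: "m \<in> borel_measurable W" "0 \<le> M" "\<And>w. cmod (m w) \<le> M"
  shows "(\<integral>\<^sup>+p. (SUP k. ennreal ((cmod (LINT w|W. e k p w * cis (\<Sum>i\<in>I. u i k p * b i w) * m w))\<^sup>2)) \<partial>P)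
     \<le> A * ennreal (exp (2 * K) ^ card I) * ennreal (M\<^sup>2)"
  using I m
proof (induction I arbitrary: m M rule: finite_induct)
  case empty
  then show ?case using bound[of m M] by simp
next
  case (insert i I)
  let ?e = "\<lambda>k p w. e k p w * cis (\<Sum>i\<in>I. u i k p * b i w)"
  have "(\<integral>\<^sup>+p. (SUP k. ennreal ((cmod (LINT w|W. ?e k p w * cis (u i k p * b i w) * m w))\<^sup>2)) \<partial>P)
     \<le> (A * ennreal (exp (2 * K) ^ card I)) * ennreal (exp (2 * K)) * ennreal (M\<^sup>2)"
  proof (rule phase_factor[OF W K _ _ u u1 b bK _ insert.prems])
    show "(\<lambda>(p, w). ?e k p w) \<in> borel_measurable (P \<Otimes>\<^sub>M W)" for k
      using e[of k] unfolding split_beta' by measurable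
    show "integrable W (?e k p)" for k p
      using integrable_cis_mult[OF int[of k p], of "\<lambda>w. \<Sum>i\<in>I. u i k p * b i w"] by (simp add: mult.commute)
  qed (rule insert.IH)
  moreover have "?e k p w * cis (u i k p * b i w) = e k p w * cis (\<Sum>i\<in>insert i I. u i k p * b i w)" for k p w
    using insert.hyps by (simp add: mult.assoc cis_mult add.commute)
  moreover have "A * ennreal (exp (2 * K) ^ card I) * ennreal (exp (2 * K)) = A * ennreal (exp (2 * K) ^ card (insert i I))"
    using insert.hyps by (simp add: mult.assoc ennreal_mult[symmetric]) (simp add: mult.commute)
  ultimately show ?case by (simp only:)
qed

section \<open>The short-time maximal estimate\<close>

lemma frostman_sigma_finite:
  assumes "frostman \<gamma> D \<mu>" shows "sigma_finite_measure \<mu>"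
proof
  have S: "sets \<mu> = sets borel" by (rule frostman_sets[OF assms])
  show "\<exists>A. countable A \<and> A \<subseteq> sets \<mu> \<and> \<Union> A = space \<mu> \<and> (\<forall>a\<in>A. emeasure \<mu> a \<noteq> \<infinity>)"
  proof (intro exI[of _ "range (\<lambda>n. ball 0 (real (Suc n)))"] conjI ballI)
    show "range (\<lambda>n. ball 0 (real (Suc n))) \<subseteq> sets \<mu>" by (auto simp: S)
    show "\<Union> (range (\<lambda>n. ball 0 (real (Suc n)))) = space \<mu>"
      unfolding sets_eq_imp_space_eq[OF S]
    proof (intro set_eqI iffI)
      fix x :: "real^'a"
      obtain n where "norm x < real n" using reals_Archimedean2 by blast
      then show "x \<in> \<Union> (range (\<lambda>n. ball 0 (real (Suc n))))" by (intro UN_I[of n]) auto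
    qed auto
    fix a assume "a \<in> range (\<lambda>n. ball (0::real^'a) (real (Suc n)))"
    then obtain n where n: "a = ball 0 (real (Suc n))" by auto
    have "emeasure \<mu> a \<le> ennreal (D * real (Suc n) powr \<gamma>)"
      using assms unfolding n frostman_def ball_growth_constants_def by simp
    then show "emeasure \<mu> a \<noteq> \<infinity>" by (auto simp: top_unique)
  qed auto
qed


text \<open>Subadditivity of \<open>x \<mapsto> x^\<alpha>\<close>, which follows from \<open>x \<le> x^\<alpha>\<close> on the unit interval.\<close>

lemma powr_increment_le_one:
  fixes a b :: real
  assumes "0 < \<alpha>" "\<alpha> \<le> 1" "0 \<le> a" "0 \<le> b"
  shows "\<bar>a powr \<alpha> - b powr \<alpha>\<bar> \<le> \<bar>a - b\<bar> powr \<alpha>"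
proof -
  have *: "a powr \<alpha> - b powr \<alpha> \<le> (a - b) powr \<alpha>" if "0 \<le> b" "b < a" for a b :: real
  proof -
    have x: "x \<le> x powr \<alpha>" if "0 \<le> x" "x \<le> 1" for x :: real
      using that assms powr_mono'[of \<alpha> 1 x] by (cases "x = 0") auto
    have "b / a + (a - b) / a \<le> (b / a) powr \<alpha> + ((a - b) / a) powr \<alpha>"
      using that by (intro add_mono x) auto
    moreover have "b / a + (a - b) / a = 1" using that by (simp add: field_simps)
    ultimately have "a powr \<alpha> * 1 \<le> a powr \<alpha> * ((b / a) powr \<alpha> + ((a - b) / a) powr \<alpha>)"
      by (intro mult_left_mono) auto
    also have "\<dots> = b powr \<alpha> + (a - b) powr \<alpha>"
      using that by (simp add: powr_divide field_simps)
    finally show ?thesis by simp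
  qed
  show ?thesis
  proof (cases a b rule: linorder_cases)
    case less
    have "a powr \<alpha> \<le> b powr \<alpha>" using less assms by (intro powr_mono2) auto
    then show ?thesis using *[of a b] less assms by (simp add: abs_minus_commute)
  next
    case greater
    have "b powr \<alpha> \<le> a powr \<alpha>" using greater assms by (intro powr_mono2) auto
    then show ?thesis using *[of b a] greater assms by simp
  qed simp
qed

lemma powr_increment_ge_one:
  fixes a b :: real
  assumes "1 \<le> \<alpha>" "0 \<le> a" "a \<le> L" "0 \<le> b" "b \<le> L"
  shows "\<bar>a powr \<alpha> - b powr \<alpha>\<bar> \<le> \<alpha> * L powr (\<alpha> - 1) * \<bar>a - b\<bar>"
proof -
  have *: "a powr \<alpha> - b powr \<alpha> \<le> \<alpha> * L powr (\<alpha> - 1) * (a - b)" if "0 \<le> b" "b < a" "a \<le> L" for a b :: real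
  proof -
    have "continuous_on {b..a} (\<lambda>x. x powr \<alpha>)"
      using assms that by (intro continuous_on_powr' continuous_intros) auto
    moreover have "((\<lambda>x. x powr \<alpha>) has_derivative (\<lambda>h. (\<alpha> * x powr (\<alpha> - 1)) * h)) (at x)" if "b < x" "x < a" for x
      using has_real_derivative_powr[of x \<alpha>] that \<open>0 \<le> b\<close> by (simp add: has_field_derivative_def)
    ultimately obtain c where c: "b < c" "c < a" "a powr \<alpha> - b powr \<alpha> = \<alpha> * c powr (\<alpha> - 1) * (a - b)"
      using mvt[OF \<open>b < a\<close>, of "\<lambda>x. x powr \<alpha>" "\<lambda>x h. (\<alpha> * x powr (\<alpha> - 1)) * h"] by blast
    have "c powr (\<alpha> - 1) \<le> L powr (\<alpha> - 1)" using c that assms by (intro powr_mono2) auto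
    then show ?thesis unfolding c(3) using that assms by (intro mult_right_mono mult_left_mono) auto
  qed
  show ?thesis
  proof (cases a b rule: linorder_cases)
    case less
    have "a powr \<alpha> \<le> b powr \<alpha>" using less assms by (intro powr_mono2) auto
    then show ?thesis using *[of a b] less assms by simp
  next
    case greater
    have "b powr \<alpha> \<le> a powr \<alpha>" using greater assms by (intro powr_mono2) auto
    then show ?thesis using *[of b a] greater assms by simp
  qed simp
qed

text \<open>The dispersive part of the phase varies boundedly over frequency balls of radius \<open>R / N\<close>
  during times \<open>N^\<theta> R^(-\<alpha>)\<close>. For \<open>\<alpha> \<le> 1\<close> this is the Hoelder continuity of \<open>|\<xi>|^\<alpha>\<close>, for
  \<open>\<alpha> > 1\<close> its Lipschitz bound on a ball of radius \<open>2 R\<close>. This is the finite speed of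
  propagation, and it dictates the exponent \<open>\<theta> = min \<alpha> 1\<close>.\<close>

lemma phase_increment_bounded:
  fixes \<zeta> \<omega> :: "'a::real_normed_vector"
  assumes \<alpha>: "0 < \<alpha>" and N: "1 \<le> N" "N \<le> R" and \<zeta>: "norm \<zeta> \<le> R" "dist \<zeta> \<omega> < R / N"
  shows "N powr min \<alpha> 1 * R powr - \<alpha> * \<bar>norm \<zeta> powr \<alpha> - norm \<omega> powr \<alpha>\<bar> \<le> 1 + \<alpha> * 2 powr \<alpha>"
proof (cases "\<alpha> \<le> 1")
  case True
  have d: "\<bar>norm \<zeta> - norm \<omega>\<bar> \<le> R / N" using norm_triangle_ineq3[of \<zeta> \<omega>] \<zeta> by (simp add: dist_norm)
  have "N powr min \<alpha> 1 * R powr - \<alpha> * \<bar>norm \<zeta> powr \<alpha> - norm \<omega> powr \<alpha>\<bar>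
      \<le> N powr \<alpha> * R powr - \<alpha> * (R / N) powr \<alpha>"
  proof (rule mult_mono)
    have "\<bar>norm \<zeta> powr \<alpha> - norm \<omega> powr \<alpha>\<bar> \<le> \<bar>norm \<zeta> - norm \<omega>\<bar> powr \<alpha>"
      by (rule powr_increment_le_one[OF \<alpha> True]) auto
    also have "\<dots> \<le> (R / N) powr \<alpha>" using d \<alpha> by (intro powr_mono2) auto
    finally show "\<bar>norm \<zeta> powr \<alpha> - norm \<omega> powr \<alpha>\<bar> \<le> (R / N) powr \<alpha>" .
  qed (use True in auto)
  also have "\<dots> = 1" using N by (simp add: powr_divide powr_minus field_simps)
  finally show ?thesis using \<alpha> by (smt (verit) mult_nonneg_nonneg powr_ge_zero)
next
  case False
  have d: "\<bar>norm \<zeta> - norm \<omega>\<bar> \<le> R / N" using norm_triangle_ineq3[of \<zeta> \<omega>] \<zeta> by (simp add: dist_norm)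
  have RN: "R / N \<le> R" using N by (simp add: field_simps mult_left_mono)
  have "norm \<omega> \<le> 2 * R" using d \<zeta> RN by linarith
  then have "\<bar>norm \<zeta> powr \<alpha> - norm \<omega> powr \<alpha>\<bar> \<le> \<alpha> * (2 * R) powr (\<alpha> - 1) * \<bar>norm \<zeta> - norm \<omega>\<bar>"
    using False \<zeta> N by (intro powr_increment_ge_one) auto
  also have "\<dots> \<le> \<alpha> * (2 * R) powr (\<alpha> - 1) * (R / N)"
    using d \<alpha> by (intro mult_left_mono) auto
  finally have "N powr min \<alpha> 1 * R powr - \<alpha> * \<bar>norm \<zeta> powr \<alpha> - norm \<omega> powr \<alpha>\<bar>
      \<le> N powr min \<alpha> 1 * R powr - \<alpha> * (\<alpha> * (2 * R) powr (\<alpha> - 1) * (R / N))"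
    by (intro mult_left_mono) auto
  also have "\<dots> = \<alpha> * 2 powr (\<alpha> - 1)"
    using False N by (simp add: powr_mult powr_diff powr_minus field_simps)
  also have "\<dots> \<le> \<alpha> * 2 powr \<alpha>" using \<alpha> by (intro mult_left_mono powr_mono) auto
  finally show ?thesis by simp
qed

text \<open>A function rather than an indicator of a set, because both arguments occur as integration
  variables.\<close>

definition window :: "real \<Rightarrow> 'a::metric_space \<Rightarrow> 'a \<Rightarrow> real" where
  "window l \<zeta> \<omega> = (if dist \<zeta> \<omega> < l then 1 else 0)"

lemma window_measurable [measurable (raw)]:
  fixes f g :: "'b \<Rightarrow> 'a::euclidean_space"
  assumes [measurable]: "f \<in> borel_measurable M" "g \<in> borel_measurable M"
  shows "(\<lambda>x. window l (f x) (g x)) \<in> borel_measurable M"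
  unfolding window_def by measurable

lemma nn_integral_window:
  fixes x :: "'a::euclidean_space"
  assumes "r > 0"
  shows "(\<integral>\<^sup>+z. ennreal (window r x z) \<partial>lborel) = ennreal (r ^ DIM('a) * measure lborel (ball (0::'a) 1))"
proof -
  have "(\<integral>\<^sup>+z. ennreal (window r x z) \<partial>lborel) = (\<integral>\<^sup>+z. indicator (ball x r) z \<partial>lborel)"
    by (intro nn_integral_cong) (auto simp: window_def indicator_def)
  also have "\<dots> = emeasure lborel (ball x r)" by simp
  also have "\<dots> = ennreal (measure lborel (ball x r))"
    using emeasure_lborel_ball_finite[of x r] by (intro emeasure_eq_ennreal_measure) auto
  also have "measure lborel (ball x r) = r ^ DIM('a) * measure lborel (ball (0::'a) 1)"
    using content_ball_conv_unit_ball[of r x] assms by simp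
  finally show ?thesis .
qed

lemma integral_window:
  fixes x :: "'a::euclidean_space"
  assumes "r > 0"
  shows "integrable lborel (window r x)" "(LINT z|lborel. window r x z) = r ^ DIM('a) * measure lborel (ball (0::'a) 1)"
proof -
  have n: "(\<integral>\<^sup>+z. ennreal (window r x z) \<partial>lborel) = ennreal (r ^ DIM('a) * measure lborel (ball (0::'a) 1))"
    by (rule nn_integral_window[OF assms])
  have w: "0 \<le> window r x z" for z by (simp add: window_def)
  show "integrable lborel (window r x)" using w n by (intro integrableI_nonneg) auto
  show "(LINT z|lborel. window r x z) = r ^ DIM('a) * measure lborel (ball (0::'a) 1)"
    using w n assms by (simp add: integral_eq_nn_integral)
qed

lemma windowed_integrable:
  fixes F :: "real^'n::finite \<Rightarrow> complex" and m :: "(real^'n) \<times> (real^'n) \<Rightarrow> complex"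
  assumes F: "tame F" and FR: "\<And>\<xi>. R < norm \<xi> \<Longrightarrow> F \<xi> = 0" and l: "0 < l" "l \<le> R"
    and [measurable]: "m \<in> borel_measurable (borel \<Otimes>\<^sub>M borel)" "g \<in> borel_measurable (borel \<Otimes>\<^sub>M borel)"
    and M: "0 \<le> M" "\<And>w. cmod (m w) \<le> M"
  shows "integrable (lborel \<Otimes>\<^sub>M lborel)
    (\<lambda>w. of_real (window l (fst w) (snd w)) * F (fst w) * cis (g w) * m w)" (is "integrable _ ?f")
proof (rule integrable_pair_dominated)
  have [measurable]: "F \<in> borel_measurable borel" by (rule tame_measurable[OF F])
  show "?f \<in> borel_measurable borel" unfolding borel_prod[symmetric] by measurable
  show "integrable lborel (\<lambda>\<zeta>. cmod (F \<zeta>) * M)" using tame_integrable[OF F] by simp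
  show "integrable lborel (indicator (cball (0::real^'n) (2 * R)) :: _ \<Rightarrow> real)"
    using emeasure_lborel_cball_finite[of "0::real^'n" "2 * R"] by simp
  fix \<zeta> \<omega>
  have n: "cmod (?f (\<zeta>, \<omega>)) \<le> window l \<zeta> \<omega> * cmod (F \<zeta>) * M"
    using M by (auto simp: norm_mult window_def intro!: mult_left_mono)
  have "window l \<zeta> \<omega> * cmod (F \<zeta>) \<le> indicator (cball 0 (2 * R)) \<omega> * cmod (F \<zeta>)"
  proof (cases "R < norm \<zeta>")
    case False
    have "norm \<omega> \<le> 2 * R" if "dist \<zeta> \<omega> < l" using False that l norm_triangle_ineq2[of \<omega> \<zeta>] by (simp add: dist_norm norm_minus_commute)
    then show ?thesis by (intro mult_right_mono) (auto simp: window_def indicator_def)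
  qed (simp add: FR)
  from mult_right_mono[OF this M(1)] n show "cmod (?f (\<zeta>, \<omega>)) \<le> cmod (F \<zeta>) * M * indicator (cball 0 (2 * R)) \<omega>"
    by (simp add: mult_ac)
qed

text \<open>For fixed \<open>z\<close> the double integral over \<open>w = (\<zeta>, \<omega>)\<close> is, by Fubini, the wave at \<open>x - z\<close>
  with profile \<open>H z \<omega> = \<integral> exp (i z \<cdot> \<zeta>) g \<omega> \<zeta> d\<zeta>\<close>, where \<open>g \<omega>\<close> is \<open>F m\<close> cut off to the ball
  of radius \<open>l\<close> around \<open>\<omega>\<close>. The rescaled maximal estimate applies for every \<open>z\<close>, the Sobolev
  weight being at most \<open>(5 N\<^sup>2)^\<sigma>\<close> on the support. As a function of \<open>z\<close>, \<open>H z \<omega>\<close> is a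
  Fourier integral, so integrating over \<open>z\<close> with \<open>local_Bessel\<close> returns the energy of \<open>F\<close>
  times the volume of a ball of radius \<open>l\<close>.\<close>

lemma windowed_wave_bound:
  fixes \<tau> :: "nat \<Rightarrow> real" and F :: "real^'n::finite \<Rightarrow> complex" and m :: "(real^'n) \<times> (real^'n) \<Rightarrow> complex"
  assumes b: "maximal_bound TYPE('n) \<alpha> \<gamma> \<sigma> {-1..1} C" and \<sigma>: "\<sigma> > 0"
    and F: "tame F" and FR: "\<And>\<xi>. R < norm \<xi> \<Longrightarrow> F \<xi> = 0" and \<mu>: "frostman \<gamma> D \<mu>"
    and N: "1 \<le> N" "N \<le> R" and l: "l = R / N" and \<tau>: "\<And>k. \<bar>\<tau> k\<bar> * l powr \<alpha> \<le> 1"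
    and m[measurable]: "m \<in> borel_measurable (borel \<Otimes>\<^sub>M borel)" and M: "0 \<le> M" "\<And>w. cmod (m w) \<le> M"
  shows "(\<integral>\<^sup>+z\<in>ball 0 2. (\<integral>\<^sup>+x\<in>ball z (1 / l). (SUP k. ennreal ((cmod (LINT w|lborel.
      of_real (window l (fst w) (snd w)) * F (fst w) * cis (z \<bullet> fst w + (x - z) \<bullet> snd w + \<tau> k * norm (snd w) powr \<alpha>) * m w))\<^sup>2)) \<partial>\<mu>) \<partial>lborel)
    \<le> ennreal (C * D * l powr (real CARD('n) - \<gamma>) * (5 * N\<^sup>2) powr \<sigma> * (exp 2 * (2 * pi) ^ CARD('n)) * (l ^ CARD('n) * measure lborel (ball (0::real^'n) 1)))
      * (energy F) * ennreal (M\<^sup>2)"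
proof -
  have [measurable]: "F \<in> borel_measurable borel" by (rule tame_measurable[OF F])
  have l0: "0 < l" "l \<le> R" using N unfolding l by (auto simp: field_simps mult_left_mono)
  have C: "0 \<le> C" using b by (simp add: maximal_bound_def)
  have D: "0 \<le> D" by (rule frostman_nonneg[OF \<mu>])
  define g where "g \<omega> \<zeta> = of_real (window l \<zeta> \<omega>) * F \<zeta> * m (\<zeta>, \<omega>)" for \<omega> \<zeta>
  have [measurable]: "(\<lambda>p. g (fst p) (snd p)) \<in> borel_measurable (borel \<Otimes>\<^sub>M borel)" unfolding g_def by measurable
  have gm[measurable]: "g \<omega> \<in> borel_measurable borel" for \<omega> unfolding g_def[abs_def] by measurable
  have gle: "cmod (g \<omega> \<zeta>) \<le> window l \<zeta> \<omega> * cmod (F \<zeta>) * M" for \<omega> \<zeta>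
    unfolding g_def norm_mult using M by (intro mult_mono) (auto simp: window_def)
  have gt: "tame (g \<omega>)" for \<omega>
  proof -
    have "tame (\<lambda>\<zeta>. (of_real (window l \<zeta> \<omega>) * m (\<zeta>, \<omega>)) * F \<zeta>)"
      by (rule tame_mult[OF F, of _ M]) (use M in \<open>auto simp: norm_mult window_def\<close>)
    then show ?thesis by (simp add: g_def[abs_def] mult_ac)
  qed
  define H where "H z \<omega> = synth (g \<omega>) z" for z \<omega>
  have Hm2[measurable]: "(\<lambda>p. H (fst p) (snd p)) \<in> borel_measurable (borel \<Otimes>\<^sub>M borel)"
    unfolding H_def synth_def g_def by measurable
  have [measurable]: "H z \<in> borel_measurable borel" for z
    unfolding H_def[abs_def] synth_def g_def by measurable
  have H0: "H z \<omega> = 0" if "2 * R < norm \<omega>" for z \<omega>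
  proof -
    have "g \<omega> \<zeta> = 0" for \<zeta>
    proof (cases "R < norm \<zeta>")
      case False
      have "dist \<zeta> \<omega> \<ge> l" using False that l0 norm_triangle_ineq2[of \<omega> \<zeta>] by (simp add: dist_norm norm_minus_commute)
      then show ?thesis by (simp add: g_def window_def)
    qed (simp add: g_def FR)
    then show ?thesis by (simp add: H_def synth_def)
  qed
  have Ht: "tame (H z)" for z
  proof -
    have "cmod (H z \<omega>) \<le> (LINT \<zeta>|lborel. cmod (F \<zeta>) * M)" for \<omega>
    proof -
      have "cmod (H z \<omega>) \<le> (LINT \<zeta>|lborel. cmod (g \<omega> \<zeta>))" unfolding H_def by (rule norm_synth_le)
      also have "\<dots> \<le> (LINT \<zeta>|lborel. cmod (F \<zeta>) * M)"
      proof (intro Bochner_Integration.integral_mono integrable_norm tame_integrable gt integrable_mult_left F)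
        show "cmod (g \<omega> \<zeta>) \<le> cmod (F \<zeta>) * M" for \<zeta>
          using gle[of \<omega> \<zeta>] M by (auto simp: window_def split: if_splits)
      qed
      finally show ?thesis .
    qed
    moreover have "H z \<in> borel_measurable borel" by measurable
    ultimately show ?thesis unfolding tame_def
      by (intro conjI exI[of _ "LINT \<zeta>|lborel. cmod (F \<zeta>) * M"] exI[of _ "2 * R"]) (auto simp: H0)
  qed
  have eq: "(LINT w|lborel. of_real (window l (fst w) (snd w)) * F (fst w) * cis (z \<bullet> fst w + (x - z) \<bullet> snd w + t * norm (snd w) powr \<alpha>) * m w) = wave \<alpha> t (H z) (x - z)" for t z x
  proof -
    define f where "f = (\<lambda>(\<zeta>, \<omega>). of_real (window l \<zeta> \<omega>) * F \<zeta> * cis (z \<bullet> \<zeta> + (x - z) \<bullet> \<omega> + t * norm \<omega> powr \<alpha>) * m (\<zeta>, \<omega>))"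
    have fi: "integrable (lborel \<Otimes>\<^sub>M lborel) f"
      using windowed_integrable[OF F FR l0 m _ M, of "\<lambda>w. z \<bullet> fst w + (x - z) \<bullet> snd w + t * norm (snd w) powr \<alpha>"]
      by (simp add: f_def split_beta')
    have "(LINT w|lborel. of_real (window l (fst w) (snd w)) * F (fst w) * cis (z \<bullet> fst w + (x - z) \<bullet> snd w + t * norm (snd w) powr \<alpha>) * m w) = (LINT w|lborel. f w)"
      by (simp add: f_def split_beta)
    also have "\<dots> = (LINT w|(lborel \<Otimes>\<^sub>M lborel). f w)" by (simp add: lborel_prod)
    also have "\<dots> = (LINT \<omega>|lborel. (LINT \<zeta>|lborel. f (\<zeta>, \<omega>)))"
      using lborel_pair.integral_snd[of "\<lambda>\<zeta> \<omega>. f (\<zeta>, \<omega>)"] fi by simp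
    also have "\<dots> = wave \<alpha> t (H z) (x - z)"
      unfolding wave_def H_def synth_def
    proof (intro Bochner_Integration.integral_cong refl)
      fix \<omega>
      have "(LINT \<zeta>|lborel. f (\<zeta>, \<omega>)) = (LINT \<zeta>|lborel. cis ((x - z) \<bullet> \<omega> + t * norm \<omega> powr \<alpha>) * (cis (z \<bullet> \<zeta>) * g \<omega> \<zeta>))"
        unfolding f_def g_def by (intro Bochner_Integration.integral_cong refl) (simp add: cis_mult[symmetric] mult_ac)
      also have "\<dots> = cis ((x - z) \<bullet> \<omega> + t * norm \<omega> powr \<alpha>) * (LINT \<zeta>|lborel. cis (z \<bullet> \<zeta>) * g \<omega> \<zeta>)"
        by (rule integral_mult_right_zero)
      finally show "(LINT \<zeta>|lborel. f (\<zeta>, \<omega>)) = \<dots>" .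
    qed
    finally show ?thesis .
  qed
  let ?c = "ennreal (C * D * l powr (real CARD('n) - \<gamma>))" and ?q = "ennreal ((5 * N\<^sup>2) powr \<sigma>)"
    and ?B = "ennreal (exp 2 * (2 * pi) ^ CARD('n))" and ?v = "ennreal (l ^ CARD('n) * measure lborel (ball (0::real^'n) 1))"
  have inner: "(\<integral>\<^sup>+x\<in>ball z (1 / l). (SUP k. ennreal ((cmod (LINT w|lborel.
      of_real (window l (fst w) (snd w)) * F (fst w) * cis (z \<bullet> fst w + (x - z) \<bullet> snd w + \<tau> k * norm (snd w) powr \<alpha>) * m w))\<^sup>2)) \<partial>\<mu>)
     \<le> ?c * ?q * (energy (H z))" for z
  proof -
    have "(\<integral>\<^sup>+x\<in>ball z (1 / l). max_wave \<alpha> \<tau> (H z) (x - z) \<partial>\<mu>) \<le> ?c * (\<integral>\<^sup>+\<omega>. ennreal ((1 + (norm \<omega> / l)\<^sup>2) powr \<sigma> * (cmod (H z \<omega>))\<^sup>2) \<partial>lborel)"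
      by (rule maximal_bound_rescaled[OF b Ht \<mu> l0(1) \<tau>])
    also have "\<dots> \<le> ?c * (\<integral>\<^sup>+\<omega>. ?q * ennreal ((cmod (H z \<omega>))\<^sup>2) \<partial>lborel)"
    proof (intro mult_left_mono nn_integral_mono)
      fix \<omega>
      show "ennreal ((1 + (norm \<omega> / l)\<^sup>2) powr \<sigma> * (cmod (H z \<omega>))\<^sup>2) \<le> ?q * ennreal ((cmod (H z \<omega>))\<^sup>2)"
      proof (cases "2 * R < norm \<omega>")
        case False
        have "norm \<omega> / l \<le> 2 * N" using False N l0 by (simp add: l field_simps)
        then have "(norm \<omega> / l)\<^sup>2 \<le> (2 * N)\<^sup>2" using l0 by (intro power_mono) auto
        moreover have "1 \<le> N\<^sup>2" using N by simp
        ultimately have "1 + (norm \<omega> / l)\<^sup>2 \<le> 5 * N\<^sup>2" by (simp add: power_mult_distrib)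
        then have "(1 + (norm \<omega> / l)\<^sup>2) powr \<sigma> \<le> (5 * N\<^sup>2) powr \<sigma>" using \<sigma> by (intro powr_mono2) (auto intro: add_nonneg_nonneg)
        then show ?thesis by (subst ennreal_mult[symmetric]) (auto intro!: ennreal_leI mult_right_mono)
      qed (simp add: H0)
    qed auto
    also have "\<dots> = ?c * ?q * (energy (H z))"
      by (subst nn_integral_cmult) (auto simp: mult.assoc)
    finally show ?thesis unfolding eq max_wave_def .
  qed
  let ?I = "\<integral>\<^sup>+\<xi>. ennreal ((cmod (F \<xi>))\<^sup>2) \<partial>lborel"
  have "(\<integral>\<^sup>+z\<in>ball 0 2. (energy (H z)) \<partial>lborel)
     = (\<integral>\<^sup>+z. (\<integral>\<^sup>+\<omega>. ennreal ((cmod (H z \<omega>))\<^sup>2) * indicator (ball 0 2) z \<partial>lborel) \<partial>lborel)"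
    by (subst nn_integral_multc) auto
  also have "\<dots> = (\<integral>\<^sup>+\<omega>. (\<integral>\<^sup>+z\<in>ball 0 2. ennreal ((cmod (H z \<omega>))\<^sup>2) \<partial>lborel) \<partial>lborel)"
    using Hm2 by (intro lborel_pair.Fubini'[symmetric]) (unfold split_beta', measurable)
  also have "\<dots> \<le> (\<integral>\<^sup>+\<omega>. ?B * (energy (g \<omega>)) \<partial>lborel)"
    unfolding H_def by (intro nn_integral_mono local_Bessel gt)
  also have "\<dots> \<le> (\<integral>\<^sup>+\<omega>. ?B * (\<integral>\<^sup>+\<zeta>. ennreal (window l \<zeta> \<omega> * (cmod (F \<zeta>) * M)\<^sup>2) \<partial>lborel) \<partial>lborel)"
  proof (intro nn_integral_mono mult_left_mono ennreal_leI)
    fix \<omega> \<zeta>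
    have "(cmod (g \<omega> \<zeta>))\<^sup>2 \<le> (window l \<zeta> \<omega> * cmod (F \<zeta>) * M)\<^sup>2" by (intro power_mono gle) auto
    then show "(cmod (g \<omega> \<zeta>))\<^sup>2 \<le> window l \<zeta> \<omega> * (cmod (F \<zeta>) * M)\<^sup>2"
      by (simp add: window_def split: if_splits)
  qed auto
  also have "\<dots> = ?B * (\<integral>\<^sup>+\<omega>. (\<integral>\<^sup>+\<zeta>. ennreal (window l \<zeta> \<omega> * (cmod (F \<zeta>) * M)\<^sup>2) \<partial>lborel) \<partial>lborel)"
    by (rule nn_integral_cmult) measurable
  also have "(\<integral>\<^sup>+\<omega>. (\<integral>\<^sup>+\<zeta>. ennreal (window l \<zeta> \<omega> * (cmod (F \<zeta>) * M)\<^sup>2) \<partial>lborel) \<partial>lborel)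
      = (\<integral>\<^sup>+\<zeta>. (\<integral>\<^sup>+\<omega>. ennreal (window l \<zeta> \<omega> * (cmod (F \<zeta>) * M)\<^sup>2) \<partial>lborel) \<partial>lborel)"
    by (rule lborel_pair.Fubini') measurable
  also have "\<dots> = (\<integral>\<^sup>+\<zeta>. ?v * (ennreal ((cmod (F \<zeta>))\<^sup>2) * ennreal (M\<^sup>2)) \<partial>lborel)"
  proof (intro nn_integral_cong)
    fix \<zeta>
    have "(\<integral>\<^sup>+\<omega>. ennreal (window l \<zeta> \<omega> * (cmod (F \<zeta>) * M)\<^sup>2) \<partial>lborel) = (\<integral>\<^sup>+\<omega>. ennreal (window l \<zeta> \<omega>) * ennreal ((cmod (F \<zeta>) * M)\<^sup>2) \<partial>lborel)"
      by (simp add: ennreal_mult'')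
    also have "\<dots> = ?v * ennreal ((cmod (F \<zeta>) * M)\<^sup>2)"
      by (subst nn_integral_multc, measurable, subst nn_integral_window[OF l0(1)]) simp
    finally show "(\<integral>\<^sup>+\<omega>. ennreal (window l \<zeta> \<omega> * (cmod (F \<zeta>) * M)\<^sup>2) \<partial>lborel) = ?v * (ennreal ((cmod (F \<zeta>))\<^sup>2) * ennreal (M\<^sup>2))"
      by (simp add: power_mult_distrib ennreal_mult'')
  qed
  also have "\<dots> = ?v * (?I * ennreal (M\<^sup>2))"
    by (simp add: nn_integral_cmult nn_integral_multc)
  finally have outer: "(\<integral>\<^sup>+z\<in>ball 0 2. (energy (H z)) \<partial>lborel) \<le> ?B * (?v * (?I * ennreal (M\<^sup>2)))" .
  have "(\<integral>\<^sup>+z\<in>ball 0 2. (\<integral>\<^sup>+x\<in>ball z (1 / l). (SUP k. ennreal ((cmod (LINT w|lborel.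
      of_real (window l (fst w) (snd w)) * F (fst w) * cis (z \<bullet> fst w + (x - z) \<bullet> snd w + \<tau> k * norm (snd w) powr \<alpha>) * m w))\<^sup>2)) \<partial>\<mu>) \<partial>lborel)
      \<le> (\<integral>\<^sup>+z\<in>ball 0 2. (?c * ?q * (energy (H z))) \<partial>lborel)"
    by (intro nn_integral_mono mult_right_mono inner) auto
  also have "\<dots> = ?c * ?q * (\<integral>\<^sup>+z\<in>ball 0 2. (energy (H z)) \<partial>lborel)"
    unfolding mult.assoc[of "?c * ?q"] by (rule nn_integral_cmult) measurable
  also have "\<dots> \<le> ?c * ?q * (?B * (?v * (?I * ennreal (M\<^sup>2))))"
    by (intro mult_left_mono outer) auto
  also have "\<dots> = (?c * ?q * ?B * ?v) * ?I * ennreal (M\<^sup>2)" by (simp only: mult.assoc)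
  also have "?c * ?q * ?B * ?v = ennreal (C * D * l powr (real CARD('n) - \<gamma>) * (5 * N\<^sup>2) powr \<sigma> * (exp 2 * (2 * pi) ^ CARD('n)) * (l ^ CARD('n) * measure lborel (ball (0::real^'n) 1)))"
    using C D l0 by (simp only: ennreal_mult[symmetric] mult_nonneg_nonneg powr_ge_zero measure_nonneg zero_le_power less_imp_le exp_ge_zero pi_ge_zero zero_le_numeral)
  finally show ?thesis .
qed

lemma ennreal_le_divideI:
  assumes "ennreal a * X \<le> ennreal c * Y" "0 < a" "0 \<le> c"
  shows "X \<le> ennreal (c / a) * (Y::ennreal)"
proof -
  have "ennreal (1 / a) * (ennreal a * X) \<le> ennreal (1 / a) * (ennreal c * Y)"
    by (intro mult_left_mono assms) auto
  moreover have "ennreal (1 / a) * (ennreal a * X) = X"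
    unfolding mult.assoc[symmetric] using assms by (subst ennreal_mult[symmetric]) auto
  moreover have "ennreal (1 / a) * (ennreal c * Y) = ennreal (c / a) * Y"
    unfolding mult.assoc[symmetric] using assms by (subst ennreal_mult[symmetric]) auto
  ultimately show ?thesis by simp
qed

lemma SUP_ennreal_scaled_square:
  "(SUP k. ennreal ((cmod (of_real c * f k))\<^sup>2)) = ennreal (c\<^sup>2) * (SUP k. ennreal ((cmod (f k))\<^sup>2))"
  by (simp add: norm_mult power_mult_distrib ennreal_mult SUP_mult_left_ennreal)

lemma vec_nth_measurable [measurable (raw)]:
  fixes f :: "'a \<Rightarrow> real^'n::finite"
  assumes "f \<in> borel_measurable M" shows "(\<lambda>x. f x $ i) \<in> borel_measurable M"
  by (rule measurable_compose[OF assms borel_measurable_continuous_onI]) (intro continuous_intros)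

text \<open>The range of times is the one in which a wave of frequency \<open>R\<close> travels a distance of order
  at most \<open>N / R\<close>. In the application \<open>p\<close> is twice the loss of derivatives \<open>s_star\<close>, because
  the estimate is squared.\<close>

definition local_maximal_bound :: "'n::finite itself \<Rightarrow> real \<Rightarrow> real \<Rightarrow> real \<Rightarrow> real \<Rightarrow> bool" where
  "local_maximal_bound ty \<alpha> \<gamma> p C \<longleftrightarrow> 0 \<le> C \<and>
     (\<forall>(F :: real^'n \<Rightarrow> complex) \<mu> D R N \<tau>. tame F \<longrightarrow> (\<forall>\<xi>. R < norm \<xi> \<longrightarrow> F \<xi> = 0) \<longrightarrow>
        frostman \<gamma> D \<mu> \<longrightarrow> 1 \<le> N \<longrightarrow> N \<le> R \<longrightarrow> (\<forall>k. \<bar>\<tau> k\<bar> \<le> N powr min \<alpha> 1 * R powr - \<alpha>) \<longrightarrow>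
        (\<integral>\<^sup>+x\<in>ball 0 1. max_wave \<alpha> \<tau> F x \<partial>\<mu>)
          \<le> ennreal (C * D * (R powr (real CARD('n) - \<gamma>) * N powr p)) * energy F)"

text \<open>A point \<open>x\<close> of the unit ball is averaged over all \<open>z\<close> at distance less than \<open>1/l\<close>, and a
  frequency \<open>\<zeta>\<close> over all \<open>\<omega>\<close> at distance less than \<open>l\<close>. The identity \<open>phase\<close> below writes
  the true phase as the phase of \<open>windowed_wave_bound\<close> plus \<open>d + 1\<close> bounded products: one
  for each coordinate of \<open>(x - z) \<cdot> (\<zeta> - \<omega>)\<close>, and one for the dispersive increment.\<close>

lemma local_maximal_estimate:
  assumes b: "maximal_bound TYPE('n::finite) \<alpha> \<gamma> \<sigma> {-1..1} C" and \<sigma>: "\<sigma> > 0" and \<alpha>: "\<alpha> > 0"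
  shows "\<exists>C'. local_maximal_bound TYPE('n) \<alpha> \<gamma> (2 * \<sigma> - (real CARD('n) - \<gamma>)) C'"
proof -
  have C: "0 \<le> C" using b by (simp add: maximal_bound_def)
  define v where "v = measure lborel (ball (0::real^'n) 1)"
  have v: "v > 0" unfolding v_def using content_ball_pos[of 1 "0::real^'n"] by simp
  define K where "K = 1 + \<alpha> * 2 powr \<alpha>"
  have K: "K \<ge> 1" using \<alpha> by (simp add: K_def)
  let ?d = "CARD('n)"
  define C' where "C' = C * 5 powr \<sigma> * (exp 2 * (2 * pi) ^ ?d) * exp (2 * K) ^ Suc ?d / v\<^sup>2"
  have C'0: "0 \<le> C'" unfolding C'_def using C v by simp
  have "(\<integral>\<^sup>+x\<in>ball 0 1. max_wave \<alpha> \<tau> F x \<partial>\<mu>)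
       \<le> ennreal (C' * D * (R powr (real ?d - \<gamma>) * N powr (2 * \<sigma> - (real ?d - \<gamma>))))
          * (energy F)"
    if F: "tame F" and FR: "\<And>\<xi>. R < norm \<xi> \<Longrightarrow> F \<xi> = 0" and \<mu>: "frostman \<gamma> D \<mu>"
      and N: "1 \<le> N" "N \<le> R" and \<tau>: "\<And>k. \<bar>\<tau> k\<bar> \<le> N powr min \<alpha> 1 * R powr - \<alpha>"
    for F :: "real^'n \<Rightarrow> complex" and \<mu> D R N and \<tau> :: "nat \<Rightarrow> real"
  proof -
    have [measurable]: "F \<in> borel_measurable borel" by (rule tame_measurable[OF F])
    have S[measurable_cong]: "sets \<mu> = sets borel" by (rule frostman_sets[OF \<mu>])
    have D: "0 \<le> D" by (rule frostman_nonneg[OF \<mu>])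
    interpret \<mu>: sigma_finite_measure \<mu> by (rule frostman_sigma_finite[OF \<mu>])
    interpret LM: pair_sigma_finite "lborel :: (real^'n) measure" \<mu> ..
    define l where "l = R / N"
    have l: "0 < l" "l \<le> R" "1 \<le> l" using N unfolding l_def by (auto simp: field_simps mult_left_mono)
    define \<eta> where "\<eta> = N powr min \<alpha> 1 * R powr - \<alpha>"
    have \<eta>: "\<eta> > 0" using N by (simp add: \<eta>_def)
    have \<eta>l: "\<eta> * l powr \<alpha> \<le> 1"
    proof -
      have "\<eta> * l powr \<alpha> = N powr (min \<alpha> 1 - \<alpha>)"
        using N by (simp add: \<eta>_def l_def powr_divide powr_minus powr_diff field_simps)
      also have "\<dots> \<le> N powr 0" using N by (intro powr_mono) auto
      finally show ?thesis using N by simp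
    qed
    have \<tau>l: "\<bar>\<tau> k\<bar> * l powr \<alpha> \<le> 1" for k
      using mult_right_mono[OF \<tau>[of k], of "l powr \<alpha>"] \<eta>l unfolding \<eta>_def by simp
    \<comment> \<open>\<open>z\<close> is within \<open>1/l\<close> of a point \<open>x\<close> of the unit ball; as \<open>l \<ge> 1\<close>, such \<open>z\<close> lie in \<open>ball 0 2\<close>\<close>
    define dens where "dens p = indicator (ball 0 2) (fst p) * (ennreal (window (1 / l) (fst p) (snd p)) * indicator (ball 0 1) (snd p))" for p :: "(real^'n) \<times> (real^'n)"
    have [measurable]: "dens \<in> borel_measurable (lborel \<Otimes>\<^sub>M \<mu>)" unfolding dens_def[abs_def] by measurable
    define P where "P = density (lborel \<Otimes>\<^sub>M \<mu>) dens"
    have P[measurable_cong]: "sets P = sets (lborel \<Otimes>\<^sub>M \<mu>)" by (simp add: P_def)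
    define W where "W = (lborel \<Otimes>\<^sub>M lborel :: ((real^'n) \<times> (real^'n)) measure)"
    have Wl: "W = lborel" unfolding W_def by (rule lborel_prod)
    have [measurable_cong]: "sets W = sets (borel \<Otimes>\<^sub>M borel)" unfolding W_def by simp
    define e where "e k p w = of_real (window l (fst w) (snd w)) * F (fst w)
        * cis (fst p \<bullet> fst w + (snd p - fst p) \<bullet> snd w + \<tau> k * norm (snd w) powr \<alpha>)" for k and p w :: "(real^'n) \<times> (real^'n)"
    have em[measurable]: "(\<lambda>(p, w). e k p w) \<in> borel_measurable (P \<Otimes>\<^sub>M W)" for k
      unfolding e_def split_beta' by measurable
    have ei: "integrable W (e k p)" for k p
      using windowed_integrable[OF F FR l(1,2), of "\<lambda>w. 1" "\<lambda>w. fst p \<bullet> fst w + (snd p - fst p) \<bullet> snd w + \<tau> k * norm (snd w) powr \<alpha>" 1]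
      unfolding W_def e_def[abs_def] by simp
    define I where "I = (energy F)"
    define A where "A = C * D * l powr (real ?d - \<gamma>) * (5 * N\<^sup>2) powr \<sigma> * (exp 2 * (2 * pi) ^ ?d) * (l ^ ?d * v)"
    have A0: "0 \<le> A" unfolding A_def using C D l v by simp
    have base: "(\<integral>\<^sup>+p. (SUP k. ennreal ((cmod (LINT w|W. e k p w * m w))\<^sup>2)) \<partial>P) \<le> (ennreal A * I) * ennreal (M\<^sup>2)"
      if m[measurable]: "m \<in> borel_measurable W" and M: "0 \<le> M" "\<And>w. cmod (m w) \<le> M" for m M
    proof -
      interpret W: sigma_finite_measure W unfolding Wl by (rule sigma_finite_lborel)
      define G where "G p = (SUP k. ennreal ((cmod (LINT w|W. e k p w * m w))\<^sup>2))" for p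
      have "(\<lambda>p. G p) \<in> borel_measurable P" unfolding G_def by measurable
      then have [measurable]: "G \<in> borel_measurable (lborel \<Otimes>\<^sub>M \<mu>)" by (simp add: P_def)
      have "(\<integral>\<^sup>+p. G p \<partial>P) = (\<integral>\<^sup>+p. dens p * G p \<partial>(lborel \<Otimes>\<^sub>M \<mu>))"
        unfolding P_def by (rule nn_integral_density) measurable
      also have "\<dots> = (\<integral>\<^sup>+z. (\<integral>\<^sup>+x. dens (z, x) * G (z, x) \<partial>\<mu>) \<partial>lborel)"
        by (rule \<mu>.nn_integral_fst[symmetric]) measurable
      also have "\<dots> \<le> (\<integral>\<^sup>+z. (\<integral>\<^sup>+x. (G (z, x) * indicator (ball z (1 / l)) x) * indicator (ball 0 2) z \<partial>\<mu>) \<partial>lborel)"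
        by (intro nn_integral_mono) (auto simp: dens_def window_def indicator_def)
      also have "\<dots> = (\<integral>\<^sup>+z\<in>ball 0 2. (\<integral>\<^sup>+x\<in>ball z (1 / l). G (z, x) \<partial>\<mu>) \<partial>lborel)"
        by (intro nn_integral_cong nn_integral_multc) measurable
      also have "\<dots> \<le> (ennreal A * I) * ennreal (M\<^sup>2)"
        unfolding G_def e_def fst_conv snd_conv Wl A_def I_def v_def
        by (rule windowed_wave_bound[OF b \<sigma> F FR \<mu> N l_def \<tau>l _ M]) (use m in \<open>simp_all add: W_def\<close>)
      finally show ?thesis unfolding G_def .
    qed
    \<comment> \<open>\<open>None\<close> indexes the dispersive increment, \<open>Some j\<close> the \<open>j\<close>-th coordinate; the splitting makes \<open>|u| \<le> 1\<close> and \<open>|bb| \<le> K\<close>\<close>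
    define u where "u i k p = (case i of None \<Rightarrow> \<tau> k / \<eta> | Some j \<Rightarrow> l * (snd p - fst p) $ j)" for i :: "'n option" and k and p :: "(real^'n) \<times> (real^'n)"
    define bb where "bb i w = (case i of None \<Rightarrow> (if dist (fst w) (snd w) < l \<and> norm (fst w) \<le> R then \<eta> * (norm (fst w) powr \<alpha> - norm (snd w) powr \<alpha>) else 0)
        | Some j \<Rightarrow> (if dist (fst w) (snd w) < l then (fst w - snd w) $ j / l else 0))" for i :: "'n option" and w :: "(real^'n) \<times> (real^'n)"
    have phase: "e k p w * cis (\<Sum>i\<in>UNIV. u i k p * bb i w) * 1
       = of_real (window l (fst w) (snd w)) * F (fst w) * cis (snd p \<bullet> fst w + \<tau> k * norm (fst w) powr \<alpha>) * 1" for k p w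
    proof (cases "dist (fst w) (snd w) < l \<and> norm (fst w) \<le> R")
      case True
      have "(\<Sum>i\<in>UNIV. u i k p * bb i w) = \<tau> k * (norm (fst w) powr \<alpha> - norm (snd w) powr \<alpha>) + (\<Sum>j\<in>UNIV. (snd p - fst p) $ j * (fst w - snd w) $ j)"
        unfolding UNIV_option_conv using True \<eta> l
        by (subst sum.insert) (auto simp: sum.reindex u_def bb_def)
      also have "(\<Sum>j\<in>UNIV. (snd p - fst p) $ j * (fst w - snd w) $ j) = (snd p - fst p) \<bullet> (fst w - snd w)"
        by (simp add: inner_vec_def)
      finally have s: "(\<Sum>i\<in>UNIV. u i k p * bb i w) = \<tau> k * (norm (fst w) powr \<alpha> - norm (snd w) powr \<alpha>) + (snd p - fst p) \<bullet> (fst w - snd w)" .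
      show ?thesis unfolding e_def s
        by (simp add: mult.assoc cis_mult) (simp add: inner_diff_left inner_diff_right algebra_simps)
    next
      case False
      then show ?thesis by (auto simp: e_def window_def FR)
    qed
    have "(\<integral>\<^sup>+p. (SUP k. ennreal ((cmod (LINT w|W. e k p w * cis (\<Sum>i\<in>UNIV. u i k p * bb i w) * 1))\<^sup>2)) \<partial>P)
       \<le> (ennreal A * I) * ennreal (exp (2 * K) ^ card (UNIV :: 'n option set)) * ennreal (1\<^sup>2)"
    proof (rule phase_factors[OF _ _ _ em ei _ _ _ _ base])
      show "finite (UNIV :: 'n option set)" by simp
      show "sigma_finite_measure W" unfolding Wl by (rule sigma_finite_lborel)
      show "u i k \<in> borel_measurable P" for i k
        unfolding u_def[abs_def] by (cases i) (auto simp del: vector_minus_component)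
      show "bb i \<in> borel_measurable W" for i
        unfolding bb_def[abs_def] by (cases i) (auto simp del: vector_minus_component)
      show "AE p in P. \<forall>k. \<bar>u i k p\<bar> \<le> 1" for i
        unfolding P_def
      proof (subst AE_density, measurable, intro AE_I2 impI allI)
        fix p k assume "0 < dens p"
        then have p: "dist (fst p) (snd p) < 1 / l" by (auto simp: dens_def window_def split: if_splits)
        show "\<bar>u i k p\<bar> \<le> 1"
        proof (cases i)
          case None
          then show ?thesis using \<tau>[of k] \<eta> by (simp add: u_def \<eta>_def)
        next
          case (Some j)
          have "l * \<bar>(snd p - fst p) $ j\<bar> \<le> l * (1 / l)"
            using p l component_le_norm_cart[of "snd p - fst p" j] by (intro mult_left_mono) (auto simp: dist_norm norm_minus_commute)
          then show ?thesis using Some l by (simp add: u_def abs_mult)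
        qed
      qed
      show "\<bar>bb i w\<bar> \<le> K" for i w
      proof (cases i)
        case None
        have "\<bar>\<eta> * (norm (fst w) powr \<alpha> - norm (snd w) powr \<alpha>)\<bar> \<le> K" if "dist (fst w) (snd w) < l" "norm (fst w) \<le> R"
          using phase_increment_bounded[OF \<alpha> N that(2) that(1)[unfolded l_def]] \<eta>
          by (simp add: K_def \<eta>_def abs_mult)
        then show ?thesis using K None by (auto simp: bb_def)
      next
        case (Some j)
        have "\<bar>(fst w - snd w) $ j\<bar> / l \<le> 1" if "dist (fst w) (snd w) < l"
          using component_le_norm_cart[of "fst w - snd w" j] that l by (simp add: dist_norm)
        then have "\<bar>(fst w - snd w) $ j\<bar> / l \<le> K" if "dist (fst w) (snd w) < l"
          using that K by fastforce
        then show ?thesis using K Some l by (auto simp: bb_def)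
      qed
    qed (use K in auto)
    also have "(ennreal A * I) * ennreal (exp (2 * K) ^ card (UNIV :: 'n option set)) * ennreal (1\<^sup>2) = ennreal (A * exp (2 * K) ^ Suc ?d) * I"
      using A0 by (simp add: card_UNIV_option ennreal_mult mult_ac)
    finally have upper: "(\<integral>\<^sup>+p. (SUP k. ennreal ((cmod (LINT w|W. e k p w * cis (\<Sum>i\<in>UNIV. u i k p * bb i w) * 1))\<^sup>2)) \<partial>P)
       \<le> ennreal (A * exp (2 * K) ^ Suc ?d) * I" .
    have avg: "(LINT w|W. e k p w * cis (\<Sum>i\<in>UNIV. u i k p * bb i w) * 1) = of_real (l ^ ?d * v) * wave \<alpha> (\<tau> k) F (snd p)" for k p
    proof -
      define f where "f w = of_real (window l (fst w) (snd w)) * F (fst w) * cis (snd p \<bullet> fst w + \<tau> k * norm (fst w) powr \<alpha>) * 1" for w :: "(real^'n) \<times> (real^'n)"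
      have fi: "integrable (lborel \<Otimes>\<^sub>M lborel) f"
        unfolding f_def by (rule windowed_integrable[OF F FR l(1,2), where M=1]) auto
      have "(LINT w|W. e k p w * cis (\<Sum>i\<in>UNIV. u i k p * bb i w) * 1) = (LINT w|(lborel \<Otimes>\<^sub>M lborel). f w)"
        unfolding phase f_def W_def ..
      also have "\<dots> = (LINT \<zeta>|lborel. (LINT \<omega>|lborel. f (\<zeta>, \<omega>)))"
        using lborel_pair.integral_fst[of "\<lambda>\<zeta> \<omega>. f (\<zeta>, \<omega>)"] fi by simp
      also have "\<dots> = (LINT \<zeta>|lborel. of_real (l ^ ?d * v) * (cis (snd p \<bullet> \<zeta> + \<tau> k * norm \<zeta> powr \<alpha>) * F \<zeta>))"
      proof (intro Bochner_Integration.integral_cong refl)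
        fix \<zeta>
        have "(LINT \<omega>|lborel. f (\<zeta>, \<omega>)) = (LINT \<omega>|lborel. of_real (window l \<zeta> \<omega>) * (cis (snd p \<bullet> \<zeta> + \<tau> k * norm \<zeta> powr \<alpha>) * F \<zeta>))"
          by (simp add: f_def mult_ac)
        also have "\<dots> = (LINT \<omega>|lborel. of_real (window l \<zeta> \<omega>)) * (cis (snd p \<bullet> \<zeta> + \<tau> k * norm \<zeta> powr \<alpha>) * F \<zeta>)"
          by (rule integral_mult_left_zero)
        also have "(LINT \<omega>|lborel. of_real (window l \<zeta> \<omega>)) = complex_of_real (l ^ ?d * v)"
          unfolding integral_complex_of_real v_def by (simp add: integral_window(2)[OF l(1)])
        finally show "(LINT \<omega>|lborel. f (\<zeta>, \<omega>)) = of_real (l ^ ?d * v) * (cis (snd p \<bullet> \<zeta> + \<tau> k * norm \<zeta> powr \<alpha>) * F \<zeta>)" .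
      qed
      also have "\<dots> = of_real (l ^ ?d * v) * wave \<alpha> (\<tau> k) F (snd p)"
        unfolding wave_def by (rule integral_mult_right_zero)
      finally show ?thesis .
    qed
    define X where "X = (\<integral>\<^sup>+x\<in>ball 0 1. max_wave \<alpha> \<tau> F x \<partial>\<mu>)"
    have inner: "(\<integral>\<^sup>+z. indicator (ball 0 2) z * ennreal (window (1 / l) z x) \<partial>lborel) = ennreal ((1 / l) ^ ?d * v)" if "x \<in> ball 0 1" for x :: "real^'n"
    proof -
      have "indicator (ball 0 2) z * ennreal (window (1 / l) z x) = ennreal (window (1 / l) x z)" for z
      proof (cases "dist z x < 1 / l")
        case True
        have "norm z \<le> norm x + dist z x" using norm_triangle_ineq2[of z x] by (simp add: dist_norm)
        moreover have "1 / l \<le> 1" using l by simp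
        ultimately have "norm z < 2" using True that by simp
        then show ?thesis using True by (simp add: window_def dist_commute)
      qed (simp add: window_def dist_commute)
      then show ?thesis using nn_integral_window[of "1 / l" x] l by (simp add: v_def)
    qed
    have "(\<integral>\<^sup>+p. ennreal ((l ^ ?d * v)\<^sup>2) * max_wave \<alpha> \<tau> F (snd p) \<partial>P)
        = (\<integral>\<^sup>+p. dens p * (ennreal ((l ^ ?d * v)\<^sup>2) * max_wave \<alpha> \<tau> F (snd p)) \<partial>(lborel \<Otimes>\<^sub>M \<mu>))"
      unfolding P_def by (rule nn_integral_density) measurable
    also have "\<dots> = (\<integral>\<^sup>+x. (\<integral>\<^sup>+z. dens (z, x) * (ennreal ((l ^ ?d * v)\<^sup>2) * max_wave \<alpha> \<tau> F x) \<partial>lborel) \<partial>\<mu>)"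
      by (subst LM.nn_integral_snd[symmetric]) auto
    also have "\<dots> = (\<integral>\<^sup>+x. ennreal ((l ^ ?d * v)\<^sup>2 * ((1 / l) ^ ?d * v)) * (max_wave \<alpha> \<tau> F x * indicator (ball 0 1) x) \<partial>\<mu>)"
    proof (intro nn_integral_cong)
      fix x
      have "(\<integral>\<^sup>+z. dens (z, x) * (ennreal ((l ^ ?d * v)\<^sup>2) * max_wave \<alpha> \<tau> F x) \<partial>lborel)
         = (\<integral>\<^sup>+z. (indicator (ball 0 2) z * ennreal (window (1 / l) z x)) * (indicator (ball 0 1) x * (ennreal ((l ^ ?d * v)\<^sup>2) * max_wave \<alpha> \<tau> F x)) \<partial>lborel)"
        by (simp add: dens_def mult_ac)
      also have "\<dots> = (\<integral>\<^sup>+z. (indicator (ball 0 2) z * ennreal (window (1 / l) z x)) \<partial>lborel) * (indicator (ball 0 1) x * (ennreal ((l ^ ?d * v)\<^sup>2) * max_wave \<alpha> \<tau> F x))"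
        by (rule nn_integral_multc) measurable
      also have "\<dots> = ennreal ((l ^ ?d * v)\<^sup>2 * ((1 / l) ^ ?d * v)) * (max_wave \<alpha> \<tau> F x * indicator (ball 0 1) x)"
      proof (cases "x \<in> ball 0 1")
        case True
        show ?thesis unfolding inner[OF True] using True v l by (simp add: ennreal_mult' mult_ac)
      qed simp
      finally show "(\<integral>\<^sup>+z. dens (z, x) * (ennreal ((l ^ ?d * v)\<^sup>2) * max_wave \<alpha> \<tau> F x) \<partial>lborel) = \<dots>" .
    qed
    also have "\<dots> = ennreal ((l ^ ?d * v)\<^sup>2 * ((1 / l) ^ ?d * v)) * X"
      unfolding X_def by (rule nn_integral_cmult) measurable
    finally have lower: "(\<integral>\<^sup>+p. (SUP k. ennreal ((cmod (LINT w|W. e k p w * cis (\<Sum>i\<in>UNIV. u i k p * bb i w) * 1))\<^sup>2)) \<partial>P)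
       = ennreal ((l ^ ?d * v)\<^sup>2 * ((1 / l) ^ ?d * v)) * X"
      unfolding avg SUP_ennreal_scaled_square max_wave_def .
    have "X \<le> ennreal ((A * exp (2 * K) ^ Suc ?d) / ((l ^ ?d * v)\<^sup>2 * ((1 / l) ^ ?d * v))) * I"
      using upper unfolding lower by (rule ennreal_le_divideI) (use A0 l v in auto)
    also have "(A * exp (2 * K) ^ Suc ?d) / ((l ^ ?d * v)\<^sup>2 * ((1 / l) ^ ?d * v)) = C' * D * (l powr (real ?d - \<gamma>) * (N\<^sup>2) powr \<sigma>)"
    proof -
      have q: "(5 * N\<^sup>2) powr \<sigma> = 5 powr \<sigma> * (N\<^sup>2) powr \<sigma>" using N by (simp add: powr_mult)
      have alg: "(C * D * a * (p * q) * B * (L * v) * E) / ((L * v)\<^sup>2 * (1 / L * v)) = C * p * B * E / v\<^sup>2 * D * (a * q)"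
        if "L > 0" for L a p q B E :: real
      proof -
        have den: "(L * v)\<^sup>2 * (1 / L * v) = (L * v) * v\<^sup>2" using that by (simp add: power2_eq_square)
        have num: "C * D * a * (p * q) * B * (L * v) * E = (L * v) * (C * p * B * E * D * (a * q))"
          by (simp only: mult_ac)
        show ?thesis unfolding den num using that v by simp
      qed
      show ?thesis unfolding A_def C'_def q power_one_over by (rule alg) (use l in simp)
    qed
    also have "l powr (real ?d - \<gamma>) * (N\<^sup>2) powr \<sigma> = R powr (real ?d - \<gamma>) * N powr (2 * \<sigma> - (real ?d - \<gamma>))"
    proof -
      have "(N\<^sup>2) powr \<sigma> = N powr (2 * \<sigma>)" 
      proof -
        have "N powr (2 * \<sigma>) = (N powr 2) powr \<sigma>" by (simp only: powr_powr)
        also have "N powr 2 = N\<^sup>2" using N by simp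
        finally show ?thesis ..
      qed
      then show ?thesis unfolding l_def powr_diff[of N "2 * \<sigma>"] using N by (simp add: powr_divide)
    qed
    finally show ?thesis unfolding X_def I_def .
  qed
  then show ?thesis using C'0 unfolding local_maximal_bound_def by blast
qed

section \<open>A single frequency along a sequence of times\<close>

lemma ennreal_mult_assoc:
  "0 \<le> a \<Longrightarrow> 0 \<le> b \<Longrightarrow> ennreal a * (ennreal b * X) = ennreal (a * b) * X"
  by (simp add: ennreal_mult mult.assoc)

lemma weak_ell_card:
  assumes "t \<in> weak_ell r"
  obtains K where "0 \<le> K" "\<And>\<delta>. 0 < \<delta> \<Longrightarrow> real (card {n. \<delta> \<le> \<bar>t n\<bar>}) \<le> K * \<delta> powr - r"
proof -
  from assms obtain K where K: "\<And>\<delta>. 0 < \<delta> \<Longrightarrow> \<delta> powr r * real (card {n. \<delta> \<le> \<bar>t n\<bar>}) \<le> K"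
    unfolding weak_ell_def bdd_above_def by auto
  have "real (card {n. \<delta> \<le> \<bar>t n\<bar>}) \<le> K * \<delta> powr - r" if "0 < \<delta>" for \<delta>
    using K[OF that] that by (simp add: powr_minus field_simps)
  moreover have "0 \<le> K" using order_trans[OF _ K[of 1]] by simp
  ultimately show ?thesis using that by blast
qed

lemma weak_ell_finite: "t \<in> weak_ell r \<Longrightarrow> 0 < \<delta> \<Longrightarrow> finite {n. \<delta> \<le> \<bar>t n\<bar>}"
  unfolding weak_ell_def by simp

text \<open>The part of the sequence with \<open>|t n| / \<delta>\<close> between \<open>2^j\<close> and \<open>2^(j+1)\<close> has at most
  \<open>K (2^j \<delta>)^(-r)\<close> members, and \<open>e < r\<close> makes the resulting series geometric.\<close>

lemma weak_ell_power_sum: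
  assumes t: "t \<in> weak_ell r" and e: "0 < e" "e < r"
  shows "\<exists>K\<ge>0. \<forall>\<delta>>0. (\<Sum>n | \<delta> \<le> \<bar>t n\<bar>. (\<bar>t n\<bar> / \<delta>) powr e) \<le> K * \<delta> powr - r"
proof -
  obtain K where K: "0 \<le> K" "\<And>\<delta>. 0 < \<delta> \<Longrightarrow> real (card {n. \<delta> \<le> \<bar>t n\<bar>}) \<le> K * \<delta> powr - r"
    using weak_ell_card[OF t] by blast
  define q where "q = (2::real) powr (e - r)"
  have q: "0 < q" "q < 1" unfolding q_def using e powr_less_mono[of "e - r" 0 2] by auto
  have "(\<Sum>n | \<delta> \<le> \<bar>t n\<bar>. (\<bar>t n\<bar> / \<delta>) powr e) \<le> (2 powr e * K / (1 - q)) * \<delta> powr - r" if \<delta>: "0 < \<delta>" for \<delta>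
  proof -
    define L where "L = {n. \<delta> \<le> \<bar>t n\<bar>}"
    have L: "finite L" unfolding L_def by (rule weak_ell_finite[OF t \<delta>])
    define i where "i n = nat \<lfloor>log 2 (\<bar>t n\<bar> / \<delta>)\<rfloor>" for n
    have i: "2 ^ i n * \<delta> \<le> \<bar>t n\<bar>" "(\<bar>t n\<bar> / \<delta>) powr e \<le> 2 powr e * (2 ^ i n) powr e" if "n \<in> L" for n
    proof -
      have x: "1 \<le> \<bar>t n\<bar> / \<delta>" using that \<delta> by (simp add: L_def)
      then have l: "0 \<le> log 2 (\<bar>t n\<bar> / \<delta>)" by simp
      have le: "real (i n) \<le> log 2 (\<bar>t n\<bar> / \<delta>)" "log 2 (\<bar>t n\<bar> / \<delta>) \<le> real (i n) + 1"
        unfolding i_def using l by linarith+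
      have p: "2 powr log 2 (\<bar>t n\<bar> / \<delta>) = \<bar>t n\<bar> / \<delta>" using x by simp
      have "2 ^ i n \<le> \<bar>t n\<bar> / \<delta>" using powr_mono[OF le(1), of 2] p by (simp add: powr_realpow)
      then show "2 ^ i n * \<delta> \<le> \<bar>t n\<bar>" using \<delta> by (simp add: field_simps)
      have "\<bar>t n\<bar> / \<delta> \<le> 2 * 2 ^ i n" using powr_mono[OF le(2), of 2] p by (simp add: powr_add powr_realpow)
      then have "(\<bar>t n\<bar> / \<delta>) powr e \<le> (2 * 2 ^ i n) powr e" using x e by (intro powr_mono2) auto
      then show "(\<bar>t n\<bar> / \<delta>) powr e \<le> 2 powr e * (2 ^ i n) powr e" by (simp add: powr_mult)
    qed
    define m where "m = Suc (Max (insert 0 (i ` L)))"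
    have im: "i n < m" if "n \<in> L" for n unfolding m_def using L that by (simp add: le_imp_less_Suc)
    have "(\<Sum>n\<in>L. (\<bar>t n\<bar> / \<delta>) powr e) \<le> (\<Sum>n\<in>L. \<Sum>j<m. if 2 ^ j * \<delta> \<le> \<bar>t n\<bar> then 2 powr e * (2 ^ j) powr e else 0)"
    proof (intro sum_mono)
      fix n assume n: "n \<in> L"
      have "(\<bar>t n\<bar> / \<delta>) powr e \<le> (if 2 ^ i n * \<delta> \<le> \<bar>t n\<bar> then 2 powr e * (2 ^ i n) powr e else 0)" using i[OF n] by simp
      also have "\<dots> \<le> (\<Sum>j<m. if 2 ^ j * \<delta> \<le> \<bar>t n\<bar> then 2 powr e * (2 ^ j) powr e else 0)"
        using im[OF n] by (intro member_le_sum) auto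
      finally show "(\<bar>t n\<bar> / \<delta>) powr e \<le> \<dots>" .
    qed
    also have "\<dots> = (\<Sum>j<m. \<Sum>n\<in>L. if 2 ^ j * \<delta> \<le> \<bar>t n\<bar> then 2 powr e * (2 ^ j) powr e else 0)" by (rule sum.swap)
    also have "\<dots> \<le> (\<Sum>j<m. 2 powr e * K * \<delta> powr - r * q ^ j)"
    proof (intro sum_mono)
      fix j
      have "(\<Sum>n\<in>L. if 2 ^ j * \<delta> \<le> \<bar>t n\<bar> then 2 powr e * (2 ^ j) powr e else 0) = real (card {n\<in>L. 2 ^ j * \<delta> \<le> \<bar>t n\<bar>}) * (2 powr e * (2 ^ j) powr e)"
        using L by (simp add: sum.inter_filter[symmetric])
      also have "\<dots> \<le> real (card {n. 2 ^ j * \<delta> \<le> \<bar>t n\<bar>}) * (2 powr e * (2 ^ j) powr e)"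
        using weak_ell_finite[OF t, of "2 ^ j * \<delta>"] \<delta> by (intro mult_right_mono) (auto intro!: card_mono)
      also have "\<dots> \<le> (K * (2 ^ j * \<delta>) powr - r) * (2 powr e * (2 ^ j) powr e)"
        using K(2)[of "2 ^ j * \<delta>"] \<delta> by (intro mult_right_mono) auto
      also have "\<dots> = 2 powr e * K * \<delta> powr - r * ((2 ^ j) powr - r * (2 ^ j) powr e)" using \<delta> by (simp add: powr_mult)
      also have "(2 ^ j) powr - r * (2 ^ j) powr e = q ^ j"
        unfolding q_def powr_add[symmetric] by (simp add: powr_realpow[symmetric] powr_powr mult.commute)
      finally show "(\<Sum>n\<in>L. if 2 ^ j * \<delta> \<le> \<bar>t n\<bar> then 2 powr e * (2 ^ j) powr e else 0) \<le> 2 powr e * K * \<delta> powr - r * q ^ j" .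
    qed
    also have "\<dots> = 2 powr e * K * \<delta> powr - r * (\<Sum>j<m. q ^ j)" by (simp add: sum_distrib_left)
    also have "\<dots> \<le> 2 powr e * K * \<delta> powr - r * (1 / (1 - q))"
    proof (intro mult_left_mono)
      have "(\<Sum>j<m. q ^ j) \<le> (\<Sum>j. q ^ j)" using q by (intro sum_le_suminf summable_geometric) auto
      then show "(\<Sum>j<m. q ^ j) \<le> 1 / (1 - q)" using q by (simp add: suminf_geometric)
    qed (use K in auto)
    finally show ?thesis by (simp add: L_def mult_ac)
  qed
  moreover have "0 \<le> 2 powr e * K / (1 - q)" using K q by simp
  ultimately show ?thesis by blast
qed

text \<open>The weight is largest at the critical time \<open>|t| = R^(-a)\<close> and decays like a power on both
  sides of it. The first summand keeps it from vanishing at very small times, where the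
  estimates have no loss in \<open>R\<close> at all. At \<open>t = 0\<close> the minimum is \<open>0\<close>, since \<open>0 powr e = 0\<close>.\<close>

definition freq_weight :: "real \<Rightarrow> real \<Rightarrow> real \<Rightarrow> real \<Rightarrow> real \<Rightarrow> real" where
  "freq_weight S a e R t = R powr (- (2 * S)) + min ((\<bar>t\<bar> * R powr a) powr e) ((\<bar>t\<bar> * R powr a) powr - e)"

lemma freq_weight_pos: "R > 0 \<Longrightarrow> 0 < freq_weight S a e R t"
  unfolding freq_weight_def by (intro add_pos_nonneg) auto

lemma inverse_freq_weight_le:
  assumes R: "R > 0" and e: "e > 0"
  shows "inverse (freq_weight S a e R t) \<le> R powr (2 * S)"
    and "1 \<le> \<bar>t\<bar> * R powr a \<Longrightarrow> inverse (freq_weight S a e R t) \<le> (\<bar>t\<bar> * R powr a) powr e"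
    and "0 < \<bar>t\<bar> * R powr a \<Longrightarrow> \<bar>t\<bar> * R powr a \<le> 1 \<Longrightarrow> inverse (freq_weight S a e R t) \<le> (\<bar>t\<bar> * R powr a) powr - e"
proof -
  let ?\<rho> = "\<bar>t\<bar> * R powr a"
  have "R powr (- (2 * S)) \<le> freq_weight S a e R t" unfolding freq_weight_def by simp
  then have "inverse (freq_weight S a e R t) \<le> inverse (R powr (- (2 * S)))"
    using R by (intro le_imp_inverse_le) auto
  then show "inverse (freq_weight S a e R t) \<le> R powr (2 * S)" by (simp add: powr_minus)
  show "inverse (freq_weight S a e R t) \<le> ?\<rho> powr e" if "1 \<le> ?\<rho>"
  proof -
    have "?\<rho> powr - e \<le> ?\<rho> powr e" using that e by (intro powr_mono) auto
    then have "?\<rho> powr - e \<le> freq_weight S a e R t" unfolding freq_weight_def by simp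
    then have "inverse (freq_weight S a e R t) \<le> inverse (?\<rho> powr - e)"
      using that by (intro le_imp_inverse_le) auto
    then show ?thesis by (simp add: powr_minus)
  qed
  show "inverse (freq_weight S a e R t) \<le> ?\<rho> powr - e" if "0 < ?\<rho>" "?\<rho> \<le> 1"
  proof -
    have "?\<rho> powr e \<le> ?\<rho> powr - e" using that e by (intro powr_mono') auto
    then have "?\<rho> powr e \<le> freq_weight S a e R t" unfolding freq_weight_def by simp
    then have "inverse (freq_weight S a e R t) \<le> inverse (?\<rho> powr e)"
      using that by (intro le_imp_inverse_le) auto
    then show ?thesis by (simp add: powr_minus)
  qed
qed

text \<open>The summands \<open>min (x c^j) (1 / (x c^j))\<close> rise geometrically to at most one and then fall
  geometrically. The correction \<open>- x / (c - 1)\<close> makes the claim for \<open>x < 1\<close> inductive under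
  \<open>x \<mapsto> x c\<close>.\<close>

lemma sum_min_geometric:
  fixes x c :: real
  assumes c: "c > 1"
  shows "(1 \<le> x \<longrightarrow> (\<Sum>j<n. min (x * c ^ j) (1 / (x * c ^ j))) \<le> c / (c - 1) / x) \<and>
    (0 \<le> x \<longrightarrow> x < 1 \<longrightarrow> (\<Sum>j<n. min (x * c ^ j) (1 / (x * c ^ j))) \<le> 2 * c / (c - 1) - x / (c - 1))"
proof (induction n arbitrary: x)
  case 0
  have "x / (c - 1) \<le> 2 * c / (c - 1)" if "x < 1" using that c by (intro divide_right_mono) auto
  then show ?case using c by auto
next
  case (Suc n)
  let ?f = "\<lambda>n x. \<Sum>j<n. min (x * c ^ j) (1 / (x * c ^ j))"
  have step: "?f (Suc n) x = min x (1 / x) + ?f n (x * c)"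
    by (subst sum.lessThan_Suc_shift) (simp add: mult_ac)
  show ?case unfolding step
  proof (intro conjI impI)
    assume x: "1 \<le> x"
    then have "1 \<le> x * c" using c mult_mono[of 1 x 1 c] by simp
    then have "?f n (x * c) \<le> c / (c - 1) / (x * c)" using Suc.IH by blast
    also have "\<dots> = 1 / (c - 1) / x" using c x by (simp add: field_simps)
    finally have "min x (1 / x) + ?f n (x * c) \<le> 1 / x + 1 / (c - 1) / x" by (intro add_mono) auto
    also have "\<dots> = c / (c - 1) / x" using c x by (simp add: field_simps)
    finally show "min x (1 / x) + ?f n (x * c) \<le> c / (c - 1) / x" .
  next
    assume x: "0 \<le> x" "x < 1"
    show "min x (1 / x) + ?f n (x * c) \<le> 2 * c / (c - 1) - x / (c - 1)"
    proof (cases "x * c < 1")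
      case True
      then have "?f n (x * c) \<le> 2 * c / (c - 1) - (x * c) / (c - 1)" using Suc.IH[of "x * c"] x c by simp
      then have "min x (1 / x) + ?f n (x * c) \<le> x + (2 * c / (c - 1) - (x * c) / (c - 1))" by (intro add_mono) auto
      also have "\<dots> = 2 * c / (c - 1) - x / (c - 1)"
      proof -
        have "x * c / (c - 1) - x / (c - 1) = x * (c - 1) / (c - 1)"
          by (simp only: diff_divide_distrib[symmetric] right_diff_distrib mult_1_right)
        also have "\<dots> = x" using c by simp
        finally show ?thesis by linarith
      qed
      finally show ?thesis .
    next
      case False
      then have "1 \<le> x * c" by simp
      then have "?f n (x * c) \<le> c / (c - 1) / (x * c)" using Suc.IH by blast
      also have "\<dots> \<le> c / (c - 1) / 1" using False c by (intro divide_left_mono) auto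
      finally have "min x (1 / x) + ?f n (x * c) \<le> x + c / (c - 1)" by (intro add_mono) auto
      also have "\<dots> \<le> 2 * c / (c - 1) - x / (c - 1)"
      proof -
        have "x * c \<le> c" using x c by simp
        then have "x * c / (c - 1) \<le> c / (c - 1)" using c by (intro divide_right_mono) auto
        moreover have "x * c / (c - 1) - x / (c - 1) = x * (c - 1) / (c - 1)"
          by (simp only: diff_divide_distrib[symmetric] right_diff_distrib mult_1_right)
        moreover have "x * (c - 1) / (c - 1) = x" using c by simp
        moreover have "2 * c / (c - 1) = c / (c - 1) + c / (c - 1)" by (simp add: add_divide_distrib[symmetric])
        ultimately show ?thesis by linarith
      qed
      finally show ?thesis .
    qed
  qed
qed

lemma sum_freq_weight_bounded:
  assumes S: "S > 0" and a: "a > 0" and e: "e > 0"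
  shows "\<exists>K\<ge>0. \<forall>t n. (\<Sum>j<n. freq_weight S a e (2 ^ j) t) \<le> K"
proof -
  define q where "q = (2::real) powr (- (2 * S))"
  have q: "0 < q" "q < 1" unfolding q_def using S powr_less_mono[of "- (2 * S)" 0 2] by auto
  define c where "c = (2::real) powr (a * e)"
  have c: "c > 1" unfolding c_def using a e powr_less_mono[of 0 "a * e" 2] by simp
  have "(\<Sum>j<n. freq_weight S a e (2 ^ j) t) \<le> 1 / (1 - q) + 2 * c / (c - 1)" for t n
  proof -
    define x where "x = \<bar>t\<bar> powr e"
    have p: "(2 ^ j) powr u = (2 powr u) ^ j" for j :: nat and u :: real
      by (simp add: powr_realpow[symmetric] powr_powr mult.commute)
    have xc: "(\<bar>t\<bar> * (2 ^ j) powr a) powr e = x * c ^ j" for j :: nat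
      by (simp add: x_def c_def powr_mult powr_powr p[of j a] powr_power) (simp add: powr_realpow[symmetric] powr_powr mult_ac)
    have "freq_weight S a e (2 ^ j) t = q ^ j + min (x * c ^ j) (1 / (x * c ^ j))" for j :: nat
      unfolding freq_weight_def xc powr_minus_divide[of _ e] p[of j "- (2 * S)"] q_def ..
    then have "(\<Sum>j<n. freq_weight S a e (2 ^ j) t) = (\<Sum>j<n. q ^ j) + (\<Sum>j<n. min (x * c ^ j) (1 / (x * c ^ j)))"
      by (simp add: sum.distrib)
    also have "\<dots> \<le> 1 / (1 - q) + 2 * c / (c - 1)"
    proof (intro add_mono)
      have "(\<Sum>j<n. q ^ j) \<le> (\<Sum>j. q ^ j)" using q by (intro sum_le_suminf summable_geometric) auto
      then show "(\<Sum>j<n. q ^ j) \<le> 1 / (1 - q)" using q by (simp add: suminf_geometric)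
      have x0: "0 \<le> x" by (simp add: x_def)
      show "(\<Sum>j<n. min (x * c ^ j) (1 / (x * c ^ j))) \<le> 2 * c / (c - 1)"
      proof (cases "1 \<le> x")
        case True
        have "c / (c - 1) / x \<le> c / (c - 1) / 1" using True c by (intro divide_left_mono) auto
        also have "\<dots> \<le> 2 * c / (c - 1)" using c by (simp add: divide_right_mono)
        finally show ?thesis using sum_min_geometric[OF c, of x n] True by linarith
      next
        case False
        have "0 \<le> x / (c - 1)" using x0 c by simp
        then show ?thesis using sum_min_geometric[OF c, of x n] False x0 by linarith
      qed
    qed
    finally show ?thesis .
  qed
  moreover have "0 \<le> 1 / (1 - q) + 2 * c / (c - 1)" using q c by simp
  ultimately show ?thesis by blast
qed

text \<open>The power of \<open>R\<close> is that of the endpoint. The inverse weight is the room that pays for the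
  summation over \<open>R\<close>.\<close>

definition weighted_bound :: "'n::finite itself \<Rightarrow> real \<Rightarrow> real \<Rightarrow> real \<Rightarrow> real \<Rightarrow> real \<Rightarrow> (nat \<Rightarrow> real) \<Rightarrow> real \<Rightarrow> bool" where
  "weighted_bound ty \<alpha> \<gamma> S a e t C \<longleftrightarrow> 0 \<le> C \<and>
     (\<forall>(F :: real^'n \<Rightarrow> complex) \<mu> D R. tame F \<longrightarrow> (\<forall>\<xi>. R < norm \<xi> \<longrightarrow> F \<xi> = 0) \<longrightarrow> frostman \<gamma> D \<mu> \<longrightarrow> 1 \<le> R \<longrightarrow>
        (\<integral>\<^sup>+x\<in>ball 0 1. (SUP n. ennreal (inverse (freq_weight S a e R (t n)) * (cmod (wave \<alpha> (t n) F x))\<^sup>2)) \<partial>\<mu>)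
          \<le> ennreal (C * D * R powr (real CARD('n) - \<gamma> + 2 * S)) * energy F)"

text \<open>Times are split into three ranges. At the finitely many times with \<open>|t| \<ge> R^(-a)\<close> the
  fixed-time estimate is summed, which \<open>weak_ell_power_sum\<close> controls. The times between
  \<open>R^(-\<alpha>)\<close> and \<open>R^(-a)\<close> are decomposed into the ranges of the short-time estimate with
  \<open>N = R^b 2^(-i)\<close>. There the gain \<open>2^(-2 i s0)\<close> beats the inverse weight, which is at most
  of order \<open>2^(i s0)\<close> because \<open>\<theta> e \<le> s0\<close>. For times below \<open>R^(-\<alpha>)\<close> the estimate with \<open>N = 1\<close>
  leaves room for the whole inverse weight \<open>R^(2 S)\<close>.\<close>

lemma single_frequency_estimate:
  fixes t :: "nat \<Rightarrow> real"
  assumes C1: "local_maximal_bound TYPE('n::finite) \<alpha> \<gamma> (2 * s0) C1" and t: "t \<in> weak_ell r"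
    and par: "0 < S" "0 < a" "0 < b" "b \<le> 1" "0 < min \<alpha> 1" "0 < s0" "a * r = 2 * S" "b * s0 = S" "\<alpha> = a + b * min \<alpha> 1"
      "0 < e" "e < r" "min \<alpha> 1 * e \<le> s0"
  shows "\<exists>C2. weighted_bound TYPE('n) \<alpha> \<gamma> S a e t C2"
proof -
  define \<theta> where "\<theta> = min \<alpha> 1"
  define \<kappa> where "\<kappa> = real CARD('n) - \<gamma>"
  note par = par[folded \<theta>_def]
  have C10: "0 \<le> C1" using C1 by (simp add: local_maximal_bound_def)
  have LM: "(\<integral>\<^sup>+x\<in>ball 0 1. max_wave \<alpha> \<tau> F x \<partial>\<mu>) \<le> ennreal (C1 * D * (R powr \<kappa> * N powr (2 * s0))) * energy F"
    if "tame F" "\<And>\<xi>. R < norm \<xi> \<Longrightarrow> F \<xi> = 0" "frostman \<gamma> D \<mu>" "1 \<le> N" "N \<le> R" "\<And>k. \<bar>\<tau> k\<bar> \<le> N powr \<theta> * R powr - \<alpha>"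
    for F :: "real^'n \<Rightarrow> complex" and \<mu> D R N \<tau>
    using C1 that unfolding local_maximal_bound_def \<theta>_def \<kappa>_def by blast
  obtain K where K: "0 \<le> K" "\<And>\<delta>. \<delta> > 0 \<Longrightarrow> (\<Sum>n | \<delta> \<le> \<bar>t n\<bar>. (\<bar>t n\<bar> / \<delta>) powr e) \<le> K * \<delta> powr - r"
    using weak_ell_power_sum[OF t par(10,11)] by blast
  define q where "q = (2::real) powr (- s0)"
  have q: "0 < q" "q < 1" unfolding q_def using par powr_less_mono[of "- s0" 0 2] by auto
  define C2 where "C2 = C1 * (1 + K + 2 powr s0 * (1 / (1 - q)))"
  have "(\<integral>\<^sup>+x\<in>ball 0 1. (SUP n. ennreal (inverse (freq_weight S a e R (t n)) * (cmod (wave \<alpha> (t n) F x))\<^sup>2)) \<partial>\<mu>)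
       \<le> ennreal (C2 * D * R powr (\<kappa> + 2 * S)) * (energy F)"
    if F: "tame F" and FR: "\<And>\<xi>. R < norm \<xi> \<Longrightarrow> F \<xi> = 0" and \<mu>: "frostman \<gamma> D \<mu>" and R: "1 \<le> R"
    for F :: "real^'n \<Rightarrow> complex" and \<mu> D R
  proof -
    have [measurable]: "F \<in> borel_measurable borel" by (rule tame_measurable[OF F])
    have [measurable_cong]: "sets \<mu> = sets borel" by (rule frostman_sets[OF \<mu>])
    have D: "0 \<le> D" by (rule frostman_nonneg[OF \<mu>])
    define I where "I = (energy F)"
    define N where "N i = R powr b * (1 / 2) ^ i" for i :: nat
    \<comment> \<open>times outside the respective range are replaced by \<open>0\<close>, which lies in every range\<close>
    define \<tau>S where "\<tau>S n = (if \<bar>t n\<bar> \<le> R powr - \<alpha> then t n else 0)" for n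
    define \<tau>M where "\<tau>M i n = (if \<bar>t n\<bar> \<le> N i powr \<theta> * R powr - \<alpha> then t n else 0)" for i n
    define L where "L = {n. R powr - a \<le> \<bar>t n\<bar>}"
    have L: "finite L" unfolding L_def using R by (intro weak_ell_finite[OF t]) auto
    define v where "v n = inverse (freq_weight S a e R (t n))" for n
    have v0: "0 \<le> v n" for n unfolding v_def using freq_weight_pos[of R S a e "t n"] R by simp
    define large where "large x = (\<Sum>n\<in>L. ennreal (v n) * ennreal ((cmod (wave \<alpha> (t n) F x))\<^sup>2))" for x
    define med where "med i x = (if 1 \<le> N i then ennreal (2 powr s0 * 2 powr (s0 * real i)) * max_wave \<alpha> (\<tau>M i) F x else 0)" for i x
    define small where "small x = ennreal (R powr (2 * S)) * max_wave \<alpha> \<tau>S F x" for x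
    have [measurable]: "large \<in> borel_measurable borel" "small \<in> borel_measurable borel"
      unfolding large_def[abs_def] small_def[abs_def] by measurable
    have [measurable]: "med i \<in> borel_measurable borel" for i unfolding med_def[abs_def] by (cases "1 \<le> N i") auto
    have cover: "(SUP n. ennreal (v n * (cmod (wave \<alpha> (t n) F x))\<^sup>2)) \<le> large x + ((\<Sum>i. med i x) + small x)" for x
    proof (intro SUP_least)
      fix n
      let ?w = "ennreal ((cmod (wave \<alpha> (t n) F x))\<^sup>2)"
      have vw: "ennreal (v n * (cmod (wave \<alpha> (t n) F x))\<^sup>2) = ennreal (v n) * ?w" using v0 by (simp add: ennreal_mult)
      consider (L) "n \<in> L" | (S) "\<bar>t n\<bar> \<le> R powr - \<alpha>" | (M) "R powr - \<alpha> < \<bar>t n\<bar>" "\<bar>t n\<bar> < R powr - a"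
        unfolding L_def by (metis mem_Collect_eq not_le)
      then show "ennreal (v n * (cmod (wave \<alpha> (t n) F x))\<^sup>2) \<le> large x + ((\<Sum>i. med i x) + small x)"
      proof cases
        case L
        have "ennreal (v n) * ?w \<le> large x" unfolding large_def by (rule member_le_sum[OF L]) (auto simp: \<open>finite L\<close>)
        then show ?thesis unfolding vw by (rule order_trans) simp
      next
        case S
        have "?w \<le> max_wave \<alpha> \<tau>S F x" unfolding max_wave_def \<tau>S_def using S by (intro SUP_upper2[of n]) auto
        moreover have "v n \<le> R powr (2 * S)" unfolding v_def using R par by (intro inverse_freq_weight_le) auto
        ultimately have "ennreal (v n) * ?w \<le> small x" unfolding small_def by (intro mult_mono ennreal_leI) auto
        then show ?thesis unfolding vw by (rule order_trans) (simp add: add_increasing)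
      next
        case M
        \<comment> \<open>\<open>m\<close> is the value of \<open>N\<close> for which \<open>t n\<close> is an extreme time of the short-time estimate\<close>
        define m where "m = (\<bar>t n\<bar> * R powr \<alpha>) powr (1 / \<theta>)"
        have t0: "0 < \<bar>t n\<bar>" using M(1) by (rule le_less_trans[rotated]) simp
        have tR: "1 < \<bar>t n\<bar> * R powr \<alpha>" using M(1) R by (simp add: powr_minus field_simps)
        have m\<theta>: "m powr \<theta> = \<bar>t n\<bar> * R powr \<alpha>" unfolding m_def using par tR by (simp add: powr_powr)
        have m1: "1 < m" unfolding m_def using tR par by (simp add: gr_one_powr)
        have mb: "m \<le> R powr b"
        proof -
          have "\<bar>t n\<bar> * R powr \<alpha> \<le> R powr - a * R powr \<alpha>" using M(2) by (intro mult_right_mono) auto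
          also have "\<dots> = R powr (b * \<theta>)" unfolding powr_add[symmetric] par(9) by simp
          finally have "m \<le> (R powr (b * \<theta>)) powr (1 / \<theta>)" unfolding m_def using par by (intro powr_mono2) auto
          then show ?thesis using par by (simp add: powr_powr)
        qed
        define i where "i = nat \<lfloor>log 2 (R powr b / m)\<rfloor>"
        have x1: "1 \<le> R powr b / m" using mb m1 by simp
        then have l: "0 \<le> log 2 (R powr b / m)" by simp
        have le: "real i \<le> log 2 (R powr b / m)" "log 2 (R powr b / m) \<le> real i + 1"
          unfolding i_def using l by linarith+
        have p: "2 powr log 2 (R powr b / m) = R powr b / m" using x1 by simp
        have mN: "m \<le> N i"
          using powr_mono[OF le(1), of 2] p m1 by (simp add: powr_realpow N_def power_one_over field_simps)
        have Nm: "N i \<le> 2 * m"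
          using powr_mono[OF le(2), of 2] p m1 by (simp add: powr_realpow powr_add N_def power_one_over field_simps)
        have "\<bar>t n\<bar> = m powr \<theta> * R powr - \<alpha>" unfolding m\<theta> using R by (simp add: powr_minus)
        also have "\<dots> \<le> N i powr \<theta> * R powr - \<alpha>" using mN m1 par by (intro mult_right_mono powr_mono2) auto
        finally have w: "?w \<le> max_wave \<alpha> (\<tau>M i) F x" unfolding max_wave_def \<tau>M_def by (intro SUP_upper2[of n]) auto
        have \<rho>: "\<bar>t n\<bar> * R powr a = (m / R powr b) powr \<theta>"
        proof -
          have "(m / R powr b) powr \<theta> = \<bar>t n\<bar> * R powr \<alpha> / R powr (b * \<theta>)" using m1 m\<theta> by (simp add: powr_divide powr_powr)
          also have "\<dots> = \<bar>t n\<bar> * (R powr \<alpha> / R powr (b * \<theta>))" by simp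
          also have "R powr \<alpha> / R powr (b * \<theta>) = R powr a" unfolding powr_diff[symmetric] par(9) by simp
          finally show ?thesis ..
        qed
        have "v n \<le> (\<bar>t n\<bar> * R powr a) powr - e"
          unfolding v_def
        proof (rule inverse_freq_weight_le(3))
          show "0 < \<bar>t n\<bar> * R powr a" using t0 R by simp
          have "\<bar>t n\<bar> * R powr a \<le> R powr - a * R powr a" using M(2) by (intro mult_right_mono) auto
          then show "\<bar>t n\<bar> * R powr a \<le> 1" using R by (simp add: powr_minus)
        qed (use R par in auto)
        also have "\<dots> = (R powr b / m) powr (\<theta> * e)"
          unfolding \<rho> powr_powr using m1 R by (simp add: powr_minus powr_divide)
        also have "\<dots> \<le> (2 * 2 ^ i) powr (\<theta> * e)"
          using powr_mono[OF le(2), of 2] p x1 par by (intro powr_mono2) (auto simp: powr_realpow powr_add)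
        also have "\<dots> \<le> (2 * 2 ^ i) powr s0"
          using par by (intro powr_mono) (auto simp: mult_ac intro: order_trans[of 1 "2::real"])
        also have "\<dots> = 2 powr s0 * 2 powr (s0 * real i)"
          by (simp add: powr_mult powr_realpow[symmetric] powr_powr mult.commute)
        finally have "v n \<le> 2 powr s0 * 2 powr (s0 * real i)" .
        then have "ennreal (v n) * ?w \<le> med i x"
          unfolding med_def using w m1 mN by (auto intro!: mult_mono ennreal_leI)
        also have "\<dots> \<le> (\<Sum>i. med i x)"
          using sum_le_suminf[of "\<lambda>i. med i x" "{i}"] by simp
        finally show ?thesis unfolding vw by (rule order_trans) (simp add: add_increasing add_increasing2)
      qed
    qed
    have LM': "(\<integral>\<^sup>+x\<in>ball 0 1. max_wave \<alpha> \<tau> F x \<partial>\<mu>) \<le> ennreal (C1 * D * (R powr \<kappa> * M powr (2 * s0))) * I"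
      if "1 \<le> M" "M \<le> R" "\<And>k. \<bar>\<tau> k\<bar> \<le> M powr \<theta> * R powr - \<alpha>" for M \<tau>
      unfolding I_def by (rule LM[OF F FR \<mu> that])
    let ?J = "ennreal (C1 * D * R powr (\<kappa> + 2 * S)) * I"
    have S1: "(\<integral>\<^sup>+x\<in>ball 0 1. small x \<partial>\<mu>) \<le> ?J"
    proof -
      have "(\<integral>\<^sup>+x\<in>ball 0 1. small x \<partial>\<mu>) = ennreal (R powr (2 * S)) * (\<integral>\<^sup>+x\<in>ball 0 1. max_wave \<alpha> \<tau>S F x \<partial>\<mu>)"
        unfolding small_def mult.assoc by (rule nn_integral_cmult) measurable
      also have "\<dots> \<le> ennreal (R powr (2 * S)) * (ennreal (C1 * D * (R powr \<kappa> * 1 powr (2 * s0))) * I)"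
        using R by (intro mult_left_mono LM') (auto simp: \<tau>S_def)
      also have "\<dots> = ?J" using C10 D by (subst ennreal_mult_assoc) (auto simp: powr_add mult_ac)
      finally show ?thesis .
    qed
    have M1: "(\<integral>\<^sup>+x\<in>ball 0 1. (\<Sum>i. med i x) \<partial>\<mu>) \<le> ennreal (2 powr s0 * (1 / (1 - q))) * ?J"
    proof -
      have one: "(\<integral>\<^sup>+x\<in>ball 0 1. med i x \<partial>\<mu>) \<le> ennreal (2 powr s0 * q ^ i) * ?J" for i
      proof (cases "1 \<le> N i")
        case True
        have "N i \<le> R powr b * 1" unfolding N_def by (intro mult_left_mono power_le_one) auto
        also have "\<dots> \<le> R powr 1" unfolding mult_1_right using R par by (intro powr_mono) auto
        finally have NR: "N i \<le> R" using R by simp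
        have "(\<integral>\<^sup>+x\<in>ball 0 1. med i x \<partial>\<mu>) = ennreal (2 powr s0 * 2 powr (s0 * real i)) * (\<integral>\<^sup>+x\<in>ball 0 1. max_wave \<alpha> (\<tau>M i) F x \<partial>\<mu>)"
          unfolding med_def using True by (simp add: mult.assoc nn_integral_cmult)
        also have "\<dots> \<le> ennreal (2 powr s0 * 2 powr (s0 * real i)) * (ennreal (C1 * D * (R powr \<kappa> * N i powr (2 * s0))) * I)"
          by (intro mult_left_mono LM' True NR) (auto simp: \<tau>M_def)
        also have "\<dots> = ennreal ((2 powr s0 * 2 powr (s0 * real i)) * (C1 * D * (R powr \<kappa> * N i powr (2 * s0)))) * I"
          using C10 D by (intro ennreal_mult_assoc) auto
        also have "(2 powr s0 * 2 powr (s0 * real i)) * (C1 * D * (R powr \<kappa> * N i powr (2 * s0))) = (2 powr s0 * q ^ i) * (C1 * D * R powr (\<kappa> + 2 * S))"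
        proof -
          have "N i powr (2 * s0) = R powr (2 * S) * 2 powr (- (2 * s0 * real i))"
          proof -
            have "N i powr (2 * s0) = (R powr b) powr (2 * s0) * ((1 / 2) ^ i) powr (2 * s0)" unfolding N_def by (simp add: powr_mult)
            also have "(R powr b) powr (2 * s0) = R powr (2 * S)" unfolding powr_powr par(8)[symmetric] by (simp add: mult_ac)
            also have "((1 / 2) ^ i :: real) = 2 powr (- real i)"
              unfolding powr_minus by (subst powr_realpow) (auto simp: power_one_over inverse_eq_divide)
            also have "(2 powr (- real i)) powr (2 * s0) = (2::real) powr (- (2 * s0 * real i))" unfolding powr_powr by (simp add: mult_ac)
            finally show ?thesis .
          qed
          moreover have "2 powr (s0 * real i) * 2 powr (- (2 * s0 * real i)) = q ^ i"
            unfolding q_def powr_add[symmetric] by (simp add: powr_realpow[symmetric] powr_powr)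
          moreover have "(s * y) * (c * (k * (z * w))) = (s * (y * w)) * (c * (k * z))" for s y c k z w :: real
            by (simp only: mult_ac)
          ultimately show ?thesis unfolding powr_add by (simp only: mult_ac)
        qed
        also have "ennreal ((2 powr s0 * q ^ i) * (C1 * D * R powr (\<kappa> + 2 * S))) * I = ennreal (2 powr s0 * q ^ i) * ?J"
          using C10 D q by (intro ennreal_mult_assoc[symmetric]) auto
        finally show ?thesis .
      next
        case False
        then show ?thesis by (simp add: med_def)
      qed
      have "(\<integral>\<^sup>+x\<in>ball 0 1. (\<Sum>i. med i x) \<partial>\<mu>) = (\<integral>\<^sup>+x. (\<Sum>i. med i x * indicator (ball 0 1) x) \<partial>\<mu>)" by simp
      also have "\<dots> = (\<Sum>i. (\<integral>\<^sup>+x\<in>ball 0 1. med i x \<partial>\<mu>))" by (rule nn_integral_suminf) measurable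
      also have "\<dots> \<le> (\<Sum>i. ennreal (2 powr s0 * q ^ i) * ?J)" by (intro suminf_le one summableI)
      also have "\<dots> = (\<Sum>i. ennreal (2 powr s0 * q ^ i)) * ?J" by simp
      also have "(\<Sum>i. ennreal (2 powr s0 * q ^ i)) = ennreal (2 powr s0 * (1 / (1 - q)))"
        using q by (intro sums_unique[symmetric] sums_ennreal[THEN iffD2] sums_mult geometric_sums) auto
      finally show ?thesis .
    qed
    have L1: "(\<integral>\<^sup>+x\<in>ball 0 1. large x \<partial>\<mu>) \<le> ennreal K * ?J"
    proof -
      have fixed: "(\<integral>\<^sup>+x\<in>ball 0 1. ennreal ((cmod (wave \<alpha> T F x))\<^sup>2) \<partial>\<mu>) \<le> ennreal (C1 * D * R powr \<kappa>) * I" for T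
      proof -
        let ?F = "\<lambda>\<xi>. cis (T * norm \<xi> powr \<alpha>) * F \<xi>"
        have e: "ennreal ((cmod (wave \<alpha> T F x))\<^sup>2) = max_wave \<alpha> (\<lambda>_. 0) ?F x" for x
          unfolding max_wave_def using wave_shift[of \<alpha> 0 T F x] by simp
        have "(\<integral>\<^sup>+x\<in>ball 0 1. max_wave \<alpha> (\<lambda>_. 0) ?F x \<partial>\<mu>) \<le> ennreal (C1 * D * (R powr \<kappa> * 1 powr (2 * s0))) * (energy ?F)"
          by (rule LM[OF tame_modulate[OF F] _ \<mu>]) (use R in \<open>auto simp: FR\<close>)
        then show ?thesis unfolding e by (simp add: norm_mult I_def)
      qed
      have "(\<integral>\<^sup>+x\<in>ball 0 1. large x \<partial>\<mu>) = (\<Sum>n\<in>L. (\<integral>\<^sup>+x. ennreal (v n) * (ennreal ((cmod (wave \<alpha> (t n) F x))\<^sup>2) * indicator (ball 0 1) x) \<partial>\<mu>))"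
        unfolding large_def sum_distrib_right mult.assoc by (rule nn_integral_sum) measurable
      also have "\<dots> = (\<Sum>n\<in>L. ennreal (v n) * (\<integral>\<^sup>+x\<in>ball 0 1. ennreal ((cmod (wave \<alpha> (t n) F x))\<^sup>2) \<partial>\<mu>))"
        by (intro sum.cong refl nn_integral_cmult) measurable
      also have "\<dots> \<le> (\<Sum>n\<in>L. ennreal ((\<bar>t n\<bar> / R powr - a) powr e) * (ennreal (C1 * D * R powr \<kappa>) * I))"
      proof (intro sum_mono mult_mono fixed ennreal_leI)
        fix n assume "n \<in> L"
        then have "1 \<le> \<bar>t n\<bar> * R powr a" using R by (simp add: L_def powr_minus field_simps)
        from inverse_freq_weight_le(2)[OF _ _ this, of e S] R par
        show "v n \<le> (\<bar>t n\<bar> / R powr - a) powr e" unfolding v_def by (simp add: powr_minus divide_inverse)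
      qed auto
      also have "\<dots> = ennreal (\<Sum>n\<in>L. (\<bar>t n\<bar> / R powr - a) powr e) * (ennreal (C1 * D * R powr \<kappa>) * I)"
        by (simp add: sum_distrib_right[symmetric] sum_ennreal)
      also have "\<dots> \<le> ennreal (K * (R powr - a) powr - r) * (ennreal (C1 * D * R powr \<kappa>) * I)"
        unfolding L_def using R by (intro mult_right_mono ennreal_leI K) auto
      also have "(R powr - a) powr - r = R powr (2 * S)" unfolding powr_powr using par by simp
      also have "ennreal (K * R powr (2 * S)) * (ennreal (C1 * D * R powr \<kappa>) * I) = ennreal K * ?J"
        using C10 D K by (subst (1 2) ennreal_mult_assoc) (auto simp: powr_add mult_ac)
      finally show ?thesis .
    qed
    have "(\<integral>\<^sup>+x\<in>ball 0 1. (SUP n. ennreal (v n * (cmod (wave \<alpha> (t n) F x))\<^sup>2)) \<partial>\<mu>)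
      \<le> (\<integral>\<^sup>+x\<in>ball 0 1. (large x + ((\<Sum>i. med i x) + small x)) \<partial>\<mu>)"
      by (intro nn_integral_mono mult_right_mono cover) auto
    also have "\<dots> = (\<integral>\<^sup>+x\<in>ball 0 1. large x \<partial>\<mu>) + ((\<integral>\<^sup>+x\<in>ball 0 1. (\<Sum>i. med i x) \<partial>\<mu>) + (\<integral>\<^sup>+x\<in>ball 0 1. small x \<partial>\<mu>))"
      unfolding distrib_right by (subst nn_integral_add, measurable, subst nn_integral_add) auto
    also have "\<dots> \<le> ennreal K * ?J + (ennreal (2 powr s0 * (1 / (1 - q))) * ?J + ennreal 1 * ?J)"
      using L1 M1 S1 by (intro add_mono) auto
    also have "\<dots> = ennreal (K + (2 powr s0 * (1 / (1 - q)) + 1)) * ?J"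
      using K q by (simp add: distrib_right ennreal_plus)
    also have "\<dots> = ennreal (C2 * D * R powr (\<kappa> + 2 * S)) * I"
      unfolding C2_def using K q C10 D by (subst ennreal_mult_assoc) (auto simp: algebra_simps)
    finally show ?thesis unfolding v_def I_def .
  qed
  moreover have "0 \<le> C2" unfolding C2_def using C10 K q by simp
  ultimately show ?thesis unfolding weighted_bound_def \<kappa>_def by blast
qed

section \<open>Summation over dyadic frequencies\<close>

lemma weighted_sum_square_le:
  fixes X :: "'i \<Rightarrow> complex"
  assumes w: "\<And>j. j \<in> A \<Longrightarrow> w j > 0"
  shows "(cmod (\<Sum>j\<in>A. X j))\<^sup>2 \<le> (\<Sum>j\<in>A. w j) * (\<Sum>j\<in>A. inverse (w j) * (cmod (X j))\<^sup>2)"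
proof -
  have "cmod (\<Sum>j\<in>A. X j) \<le> (\<Sum>j\<in>A. cmod (X j))" by (rule norm_sum)
  also have "\<dots> = (\<Sum>j\<in>A. sqrt (w j) * (cmod (X j) / sqrt (w j)))"
  proof (intro sum.cong refl)
    fix j assume "j \<in> A"
    from w[OF this] show "cmod (X j) = sqrt (w j) * (cmod (X j) / sqrt (w j))" by simp
  qed
  finally have "(cmod (\<Sum>j\<in>A. X j))\<^sup>2 \<le> (\<Sum>j\<in>A. sqrt (w j) * (cmod (X j) / sqrt (w j)))\<^sup>2"
    by (intro power_mono) auto
  also have "\<dots> \<le> (\<Sum>j\<in>A. (sqrt (w j))\<^sup>2) * (\<Sum>j\<in>A. (cmod (X j) / sqrt (w j))\<^sup>2)"
    by (rule Cauchy_Schwarz_ineq_sum)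
  also have "\<dots> = (\<Sum>j\<in>A. w j) * (\<Sum>j\<in>A. inverse (w j) * (cmod (X j))\<^sup>2)"
    using less_imp_le[OF w] by (intro arg_cong2[where f="(*)"] sum.cong refl) (auto simp: power_mult_distrib power_inverse divide_inverse mult.commute)
  finally show ?thesis .
qed

text \<open>The least exponent rather than a logarithm: it sends all frequencies of norm at most one
  to level \<open>0\<close> and makes the dyadic pieces disjoint.\<close>

definition dyadic_level :: "'a::real_normed_vector \<Rightarrow> nat" where
  "dyadic_level \<xi> = (LEAST j. norm \<xi> \<le> 2 ^ j)"

lemma dyadic_level_bounds:
  shows "norm \<xi> \<le> 2 ^ dyadic_level \<xi>" and "2 ^ (2 * dyadic_level \<xi>) \<le> 4 * (1 + (norm \<xi>)\<^sup>2)"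
    and "norm \<xi> \<le> 2 ^ J \<Longrightarrow> dyadic_level \<xi> \<le> J"
proof -
  obtain j where "norm \<xi> < 2 ^ j" using real_arch_pow[of 2 "norm \<xi>"] by auto
  then have "norm \<xi> \<le> 2 ^ j" by simp
  then show "norm \<xi> \<le> 2 ^ dyadic_level \<xi>" unfolding dyadic_level_def by (rule LeastI)
  show "norm \<xi> \<le> 2 ^ J \<Longrightarrow> dyadic_level \<xi> \<le> J" unfolding dyadic_level_def by (rule Least_le)
  show "2 ^ (2 * dyadic_level \<xi>) \<le> 4 * (1 + (norm \<xi>)\<^sup>2)"
  proof (cases "dyadic_level \<xi>")
    case (Suc i)
    have "\<not> norm \<xi> \<le> 2 ^ i" using not_less_Least[of i "\<lambda>j. norm \<xi> \<le> 2 ^ j"] Suc by (simp add: dyadic_level_def)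
    then have "(2 ^ i)\<^sup>2 \<le> (norm \<xi>)\<^sup>2" by (intro power_mono) auto
    then have "4 * (2 ^ i)\<^sup>2 \<le> 4 * (1 + (norm \<xi>)\<^sup>2)" by (intro mult_left_mono add_increasing) auto
    moreover have "(2::real) ^ (2 * Suc i) = 4 * (2 ^ i)\<^sup>2" unfolding power_even_eq by (simp add: power_mult_distrib)
    ultimately show ?thesis unfolding Suc by (simp only:)
  qed (simp add: add_nonneg_nonneg)
qed

lemma dyadic_level_measurable [measurable]:
  "(dyadic_level :: real^'n::finite \<Rightarrow> nat) \<in> borel \<rightarrow>\<^sub>M count_space UNIV"
  unfolding dyadic_level_def[abs_def] by measurable

definition sequential_bound :: "'n::finite itself \<Rightarrow> real \<Rightarrow> real \<Rightarrow> real \<Rightarrow> (nat \<Rightarrow> real) \<Rightarrow> real \<Rightarrow> bool" where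
  "sequential_bound ty \<alpha> \<gamma> \<sigma> t C \<longleftrightarrow> 0 \<le> C \<and>
     (\<forall>(F :: real^'n \<Rightarrow> complex) \<mu> D. tame F \<longrightarrow> frostman \<gamma> D \<mu> \<longrightarrow>
        (\<integral>\<^sup>+x\<in>ball 0 1. max_wave \<alpha> t F x \<partial>\<mu>) \<le> ennreal (C * D) * sobolev_sq \<sigma> F)"

text \<open>The weights at a fixed time sum to a bounded quantity over all dyadic frequencies, so
  Cauchy-Schwarz bounds the square of the sum of the pieces by the sum of their squares with
  inverse weights. Here the supremum over the sequence may be taken in each piece
  separately.\<close>

lemma dyadic_assembly:
  assumes C2: "weighted_bound TYPE('n::finite) \<alpha> \<gamma> S a e t C2"
    and par: "\<gamma> \<le> real CARD('n)" "0 < S" "0 < a" "0 < e"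
  shows "\<exists>C3. sequential_bound TYPE('n) \<alpha> \<gamma> ((real CARD('n) - \<gamma>) / 2 + S) t C3"
proof -
  define \<kappa> where "\<kappa> = real CARD('n) - \<gamma>"
  have \<kappa>0: "0 \<le> \<kappa>" using par by (simp add: \<kappa>_def)
  have C20: "0 \<le> C2" using C2 by (simp add: weighted_bound_def)
  obtain K where K: "0 \<le> K" "\<And>t n. (\<Sum>j<n. freq_weight S a e (2 ^ j) t) \<le> K"
    using sum_freq_weight_bounded[OF par(2-4)] by blast
  let ?\<sigma> = "\<kappa> / 2 + S"
  define C3 where "C3 = K * C2 * 4 powr ?\<sigma>"
  have "(\<integral>\<^sup>+x\<in>ball 0 1. max_wave \<alpha> t F x \<partial>\<mu>) \<le> ennreal (C3 * D) * sobolev_sq ?\<sigma> F"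
    if F: "tame F" and \<mu>: "frostman \<gamma> D \<mu>" for F :: "real^'n \<Rightarrow> complex" and \<mu> D
  proof -
    have [measurable]: "F \<in> borel_measurable borel" by (rule tame_measurable[OF F])
    have [measurable_cong]: "sets \<mu> = sets borel" by (rule frostman_sets[OF \<mu>])
    have D: "0 \<le> D" by (rule frostman_nonneg[OF \<mu>])
    obtain R0 where R0: "\<And>\<xi>. R0 < norm \<xi> \<Longrightarrow> F \<xi> = 0" using F unfolding tame_def by blast
    obtain m where m: "R0 < 2 ^ m" using real_arch_pow[of 2 R0] by auto
    \<comment> \<open>the dyadic pieces; only those up to level \<open>m\<close> are nonzero\<close>
    define G where "G j \<xi> = (if dyadic_level \<xi> = j then F \<xi> else 0)" for j \<xi>
    have Gt: "tame (G j)" for j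
    proof -
      have "tame (\<lambda>\<xi>. (if dyadic_level \<xi> = j then 1 else 0) * F \<xi>)"
      proof (rule tame_mult[OF F, of _ 1])
        show "(\<lambda>\<xi>::real^'n. if dyadic_level \<xi> = j then 1 else 0 :: complex) \<in> borel_measurable borel"
          by (rule measurable_compose[OF dyadic_level_measurable, where g="\<lambda>k. if k = j then 1 else 0"]) simp
      qed auto
      moreover have "(\<lambda>\<xi>. (if dyadic_level \<xi> = j then 1 else 0) * F \<xi>) = G j" by (auto simp: G_def)
      ultimately show ?thesis by simp
    qed
    have [measurable]: "G j \<in> borel_measurable borel" for j by (rule tame_measurable[OF Gt])
    have lev: "dyadic_level \<xi> < Suc m" if "F \<xi> \<noteq> 0" for \<xi>
      using dyadic_level_bounds(3)[of \<xi> m] R0[of \<xi>] that m by (meson le_imp_less_Suc less_imp_le linorder_not_le order_trans)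
    have FG: "F \<xi> = (\<Sum>j<Suc m. G j \<xi>)" for \<xi>
      using lev[of \<xi>] unfolding G_def by (cases "F \<xi> = 0") (auto simp: sum.delta simp del: sum.lessThan_Suc)
    have wv: "wave \<alpha> \<tau> F x = (\<Sum>j<Suc m. wave \<alpha> \<tau> (G j) x)" for \<tau> x
    proof -
      have "wave \<alpha> \<tau> F x = (LINT \<xi>|lborel. (\<Sum>j<Suc m. cis (x \<bullet> \<xi> + \<tau> * norm \<xi> powr \<alpha>) * G j \<xi>))"
        unfolding wave_def by (subst FG) (simp only: sum_distrib_left)
      also have "\<dots> = (\<Sum>j<Suc m. wave \<alpha> \<tau> (G j) x)"
        unfolding wave_def by (intro Bochner_Integration.integral_sum integrable_cis_mult tame_integrable Gt) measurable
      finally show ?thesis .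
    qed
    define Y where "Y j x = (SUP n. ennreal (inverse (freq_weight S a e (2 ^ j) (t n)) * (cmod (wave \<alpha> (t n) (G j) x))\<^sup>2))" for j x
    have [measurable]: "Y j \<in> borel_measurable borel" for j unfolding Y_def[abs_def] by measurable
    have ptw: "max_wave \<alpha> t F x \<le> ennreal K * (\<Sum>j<Suc m. Y j x)" for x
      unfolding max_wave_def
    proof (intro SUP_least)
      fix n
      have iw: "0 \<le> inverse (freq_weight S a e (2 ^ j) (t n))" for j
        using freq_weight_pos[of "2 ^ j" S a e "t n"] by simp
      have "(cmod (wave \<alpha> (t n) F x))\<^sup>2 \<le> (\<Sum>j<Suc m. freq_weight S a e (2 ^ j) (t n)) * (\<Sum>j<Suc m. inverse (freq_weight S a e (2 ^ j) (t n)) * (cmod (wave \<alpha> (t n) (G j) x))\<^sup>2)"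
        unfolding wv by (rule weighted_sum_square_le) (simp add: freq_weight_pos)
      also have "\<dots> \<le> K * (\<Sum>j<Suc m. inverse (freq_weight S a e (2 ^ j) (t n)) * (cmod (wave \<alpha> (t n) (G j) x))\<^sup>2)"
        using iw by (intro mult_right_mono K sum_nonneg) auto
      finally have "ennreal ((cmod (wave \<alpha> (t n) F x))\<^sup>2) \<le> ennreal K * (\<Sum>j<Suc m. ennreal (inverse (freq_weight S a e (2 ^ j) (t n)) * (cmod (wave \<alpha> (t n) (G j) x))\<^sup>2))"
        using K iw by (subst sum_ennreal) (auto simp: ennreal_mult[symmetric] sum_nonneg simp del: sum.lessThan_Suc intro!: ennreal_leI)
      also have "\<dots> \<le> ennreal K * (\<Sum>j<Suc m. Y j x)"
        unfolding Y_def by (intro mult_left_mono sum_mono SUP_upper) auto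
      finally show "ennreal ((cmod (wave \<alpha> (t n) F x))\<^sup>2) \<le> ennreal K * (\<Sum>j<Suc m. Y j x)" .
    qed
    have Yj: "(\<integral>\<^sup>+x\<in>ball 0 1. Y j x \<partial>\<mu>) \<le> ennreal (C2 * D) * (ennreal ((2 ^ j) powr (\<kappa> + 2 * S)) * (energy (G j)))" for j
    proof -
      have "(\<integral>\<^sup>+x\<in>ball 0 1. Y j x \<partial>\<mu>) \<le> ennreal (C2 * D * (2 ^ j) powr (\<kappa> + 2 * S)) * (energy (G j))"
      proof -
        have "G j \<xi> = 0" if "2 ^ j < norm \<xi>" for \<xi>
          using dyadic_level_bounds(1)[of \<xi>] that by (auto simp: G_def)
        moreover have "(1::real) \<le> 2 ^ j" by simp
        ultimately show ?thesis using C2 Gt \<mu> unfolding Y_def \<kappa>_def weighted_bound_def by blast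
      qed
      also have "\<dots> = ennreal (C2 * D) * (ennreal ((2 ^ j) powr (\<kappa> + 2 * S)) * (energy (G j)))"
        using C20 D by (intro ennreal_mult_assoc[symmetric]) auto
      finally show ?thesis .
    qed
    have "(\<integral>\<^sup>+x\<in>ball 0 1. max_wave \<alpha> t F x \<partial>\<mu>) \<le> (\<integral>\<^sup>+x\<in>ball 0 1. (ennreal K * (\<Sum>j<Suc m. Y j x)) \<partial>\<mu>)"
      by (intro nn_integral_mono mult_right_mono ptw) auto
    also have "\<dots> = ennreal K * (\<Sum>j<Suc m. (\<integral>\<^sup>+x\<in>ball 0 1. Y j x \<partial>\<mu>))"
      unfolding mult.assoc sum_distrib_right
      by (subst nn_integral_cmult, measurable, subst nn_integral_sum) measurable
    also have "\<dots> \<le> ennreal K * (\<Sum>j<Suc m. ennreal (C2 * D) * (ennreal ((2 ^ j) powr (\<kappa> + 2 * S)) * (energy (G j))))"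
      by (intro mult_left_mono sum_mono Yj) auto
    also have "\<dots> = ennreal K * (ennreal (C2 * D) * (\<integral>\<^sup>+\<xi>. (\<Sum>j<Suc m. ennreal ((2 ^ j) powr (\<kappa> + 2 * S)) * ennreal ((cmod (G j \<xi>))\<^sup>2)) \<partial>lborel))"
      unfolding sum_distrib_left[symmetric]
      by (subst nn_integral_sum, measurable, subst nn_integral_cmult) auto
    also have "\<dots> \<le> ennreal K * (ennreal (C2 * D) * (\<integral>\<^sup>+\<xi>. ennreal (4 powr ?\<sigma>) * ennreal ((1 + (norm \<xi>)\<^sup>2) powr ?\<sigma> * (cmod (F \<xi>))\<^sup>2) \<partial>lborel))"
    proof (intro mult_left_mono nn_integral_mono)
      fix \<xi> :: "real^'n"
      let ?j = "dyadic_level \<xi>"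
      have "(\<Sum>j<Suc m. ennreal ((2 ^ j) powr (\<kappa> + 2 * S)) * ennreal ((cmod (G j \<xi>))\<^sup>2)) \<le> ennreal ((2 ^ ?j) powr (\<kappa> + 2 * S) * (cmod (F \<xi>))\<^sup>2)"
      proof -
        have "(\<Sum>j<Suc m. ennreal ((2 ^ j) powr (\<kappa> + 2 * S)) * ennreal ((cmod (G j \<xi>))\<^sup>2))
          = (\<Sum>j<Suc m. if j = ?j then ennreal ((2 ^ ?j) powr (\<kappa> + 2 * S) * (cmod (F \<xi>))\<^sup>2) else 0)"
          by (intro sum.cong refl) (auto simp: G_def ennreal_mult)
        then show ?thesis by (simp add: sum.delta del: sum.lessThan_Suc)
      qed
      also have "\<dots> \<le> ennreal (4 powr ?\<sigma> * ((1 + (norm \<xi>)\<^sup>2) powr ?\<sigma> * (cmod (F \<xi>))\<^sup>2))"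
      proof (intro ennreal_leI)
        have "2 * ?\<sigma> = \<kappa> + 2 * S" by simp
        then have "(2 ^ ?j) powr (\<kappa> + 2 * S) = ((2 ^ ?j) powr 2) powr ?\<sigma>" unfolding powr_powr by (simp only:)
        also have "(2 ^ ?j) powr 2 = (2::real) ^ (2 * ?j)" by (simp add: power_mult[symmetric] mult.commute)
        also have "\<dots> powr ?\<sigma> \<le> (4 * (1 + (norm \<xi>)\<^sup>2)) powr ?\<sigma>" using par \<kappa>0 dyadic_level_bounds(2)[of \<xi>] by (intro powr_mono2) auto
        also have "\<dots> = 4 powr ?\<sigma> * (1 + (norm \<xi>)\<^sup>2) powr ?\<sigma>" by (rule powr_mult)
        finally show "(2 ^ ?j) powr (\<kappa> + 2 * S) * (cmod (F \<xi>))\<^sup>2 \<le> 4 powr ?\<sigma> * ((1 + (norm \<xi>)\<^sup>2) powr ?\<sigma> * (cmod (F \<xi>))\<^sup>2)"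
          unfolding mult.assoc[symmetric] by (intro mult_right_mono) auto
      qed
      also have "\<dots> = ennreal (4 powr ?\<sigma>) * ennreal ((1 + (norm \<xi>)\<^sup>2) powr ?\<sigma> * (cmod (F \<xi>))\<^sup>2)"
        by (intro ennreal_mult) auto
      finally show "(\<Sum>j<Suc m. ennreal ((2 ^ j) powr (\<kappa> + 2 * S)) * ennreal ((cmod (G j \<xi>))\<^sup>2)) \<le> \<dots>" .
    qed auto
    also have "\<dots> = ennreal K * (ennreal (C2 * D) * (ennreal (4 powr ?\<sigma>) * sobolev_sq ?\<sigma> F))"
      unfolding sobolev_sq_def by (subst nn_integral_cmult) auto
    also have "\<dots> = ennreal (C3 * D) * sobolev_sq ?\<sigma> F"
      using K C20 D unfolding C3_def by (subst ennreal_mult_assoc, simp, simp, subst ennreal_mult_assoc) (auto simp: mult_ac)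
    finally show ?thesis .
  qed
  moreover have "0 \<le> C3" unfolding C3_def using K C20 by simp
  ultimately show ?thesis unfolding sequential_bound_def \<kappa>_def by blast
qed

section \<open>The maximal estimate for Schwartz data\<close>

lemma schwartz_measurable:
  assumes "schwartz f" shows "f \<in> borel_measurable borel"
proof -
  have "iter_partial [] f differentiable at x" for x using assms unfolding schwartz_def by blast
  then have "continuous_on UNIV f"
    by (auto intro!: continuous_at_imp_continuous_on differentiable_imp_continuous_within)
  then show ?thesis by (rule borel_measurable_continuous_onI)
qed

text \<open>If the Fourier transform is integrable, it is the limit of its truncations to balls, which
  are tame, and Fatou's lemma applies. Otherwise the integral defining the propagator takes
  its default value \<open>0\<close>, and the estimate is trivial.\<close>

lemma maximal_bound_schwartz:
  fixes f :: "real^'n::finite \<Rightarrow> complex"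
  assumes C3: "sequential_bound TYPE('n) \<alpha> \<gamma> \<sigma> t C"
    and f: "schwartz f" and \<mu>: "gamma_dimensional \<gamma> \<mu>"
  shows "L2_norm_on \<mu> (ball 0 1) (\<lambda>x. SUP n. ennreal (cmod (propagator \<alpha> (t n) f x)))
     \<le> ennreal (sqrt C * sqrt (dim_const \<gamma> \<mu>)) * sobolev_norm \<sigma> f"
proof -
  let ?D = "dim_const \<gamma> \<mu>"
  have C: "0 \<le> C" using C3 by (simp add: sequential_bound_def)
  have bound: "(\<integral>\<^sup>+x\<in>ball 0 1. max_wave \<alpha> t F x \<partial>\<mu>) \<le> ennreal (C * D) * sobolev_sq \<sigma> F"
    if "tame F" "frostman \<gamma> D \<mu>" for F :: "real^'n \<Rightarrow> complex" and D
    using C3 that unfolding sequential_bound_def by blast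
  have fr: "frostman \<gamma> ?D \<mu>" using \<mu> dim_const_attained[OF \<mu>] by (simp add: frostman_def gamma_dimensional_def)
  have D0: "0 \<le> ?D" by (rule dim_const_nonneg[OF \<mu>])
  have [measurable_cong]: "sets \<mu> = sets borel" by (rule frostman_sets[OF fr])
  define F where "F = fourier f"
  have [measurable]: "f \<in> borel_measurable borel" by (rule schwartz_measurable[OF f])
  have Fm[measurable]: "F \<in> borel_measurable borel" unfolding F_def fourier_def[abs_def] by measurable
  have FB: "cmod (F \<xi>) \<le> (LINT x|lborel. cmod (f x))" for \<xi>
    unfolding F_def fourier_def by (rule order_trans[OF integral_norm_bound]) (simp add: norm_mult)
  have pw: "cmod (propagator \<alpha> \<tau> f x) \<le> cmod (wave \<alpha> \<tau> F x)" for \<tau> x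
  proof -
    have p1: "1 \<le> (2 * pi) ^ CARD('n)" using pi_gt3 by (intro one_le_power) auto
    have "cmod (propagator \<alpha> \<tau> f x) = 1 / (2 * pi) ^ CARD('n) * cmod (wave \<alpha> \<tau> F x)"
      unfolding propagator_def wave_def F_def by (simp add: norm_mult norm_divide norm_power)
    also have "\<dots> \<le> 1 * cmod (wave \<alpha> \<tau> F x)" using p1 by (intro mult_right_mono) auto
    finally show ?thesis by simp
  qed
  have key: "(\<integral>\<^sup>+x\<in>ball 0 1. max_wave \<alpha> t F x \<partial>\<mu>) \<le> ennreal (C * ?D) * sobolev_sq \<sigma> F"
  proof (cases "integrable lborel F")
    case False
    have "\<not> integrable lborel (\<lambda>\<xi>. cis (x \<bullet> \<xi> + \<tau> * norm \<xi> powr \<alpha>) * F \<xi>)" for x \<tau>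
    proof
      assume "integrable lborel (\<lambda>\<xi>. cis (x \<bullet> \<xi> + \<tau> * norm \<xi> powr \<alpha>) * F \<xi>)"
      then have "integrable lborel (\<lambda>\<xi>. cis (- (x \<bullet> \<xi> + \<tau> * norm \<xi> powr \<alpha>)) * (cis (x \<bullet> \<xi> + \<tau> * norm \<xi> powr \<alpha>) * F \<xi>))"
        by (rule integrable_cis_mult) measurable
      moreover have "cis (- u) * (cis u * z) = z" for u z
        unfolding mult.assoc[symmetric] cis_mult by simp
      ultimately show False using False by (simp only:)
    qed
    then have "wave \<alpha> \<tau> F x = 0" for \<tau> x unfolding wave_def by (intro not_integrable_integral_eq)
    then show ?thesis by (simp add: max_wave_def)
  next
    case True
    define T where "T m \<xi> = (if norm \<xi> \<le> real m then F \<xi> else 0)" for m \<xi>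
    have Tt: "tame (T m)" for m
      unfolding tame_def
    proof (intro conjI exI allI impI)
      show "T m \<in> borel_measurable borel" unfolding T_def[abs_def] by measurable
      show "cmod (T m \<xi>) \<le> (LINT x|lborel. cmod (f x))" for \<xi>
        using FB[of \<xi>] order_trans[OF norm_ge_zero FB[of \<xi>]] by (simp add: T_def)
      show "T m \<xi> = 0" if "real m < norm \<xi>" for \<xi> using that by (simp add: T_def)
    qed
    have [measurable]: "T m \<in> borel_measurable borel" for m by (rule tame_measurable[OF Tt])
    have Ts: "sobolev_sq \<sigma> (T m) \<le> sobolev_sq \<sigma> F" for m
      unfolding sobolev_sq_def by (intro nn_integral_mono ennreal_leI mult_left_mono) (auto simp: T_def)
    have lim: "(\<lambda>m. wave \<alpha> \<tau> (T m) x) \<longlonglongrightarrow> wave \<alpha> \<tau> F x" for \<tau> x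
      unfolding wave_def
    proof (rule integral_dominated_convergence[where w="\<lambda>\<xi>. cmod (F \<xi>)"])
      show "AE \<xi> in lborel. (\<lambda>m. cis (x \<bullet> \<xi> + \<tau> * norm \<xi> powr \<alpha>) * T m \<xi>) \<longlonglongrightarrow> cis (x \<bullet> \<xi> + \<tau> * norm \<xi> powr \<alpha>) * F \<xi>"
      proof (intro AE_I2 tendsto_mult tendsto_const)
        fix \<xi> :: "real^'n"
        obtain m0 where "norm \<xi> \<le> real m0" using real_arch_simple by blast
        then have "eventually (\<lambda>m. T m \<xi> = F \<xi>) sequentially"
          unfolding T_def by (intro eventually_sequentiallyI[of m0]) (auto intro: order_trans)
        then show "(\<lambda>m. T m \<xi>) \<longlonglongrightarrow> F \<xi>" by (rule tendsto_eventually)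
      qed
    qed (use True in \<open>auto simp: norm_mult T_def\<close>)
    have "max_wave \<alpha> t F x \<le> liminf (\<lambda>m. max_wave \<alpha> t (T m) x)" for x
      unfolding max_wave_def[of _ _ F]
    proof (intro SUP_least)
      fix k
      have "(\<lambda>m. ennreal ((cmod (wave \<alpha> (t k) (T m) x))\<^sup>2)) \<longlonglongrightarrow> ennreal ((cmod (wave \<alpha> (t k) F x))\<^sup>2)"
        by (intro tendsto_ennrealI tendsto_intros lim)
      then have "ennreal ((cmod (wave \<alpha> (t k) F x))\<^sup>2) = liminf (\<lambda>m. ennreal ((cmod (wave \<alpha> (t k) (T m) x))\<^sup>2))"
        by (intro lim_imp_Liminf[symmetric]) auto
      also have "\<dots> \<le> liminf (\<lambda>m. max_wave \<alpha> t (T m) x)"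
        unfolding max_wave_def by (intro Liminf_mono always_eventually allI SUP_upper) auto
      finally show "ennreal ((cmod (wave \<alpha> (t k) F x))\<^sup>2) \<le> \<dots>" .
    qed
    then have "(\<integral>\<^sup>+x\<in>ball 0 1. max_wave \<alpha> t F x \<partial>\<mu>) \<le> (\<integral>\<^sup>+x. liminf (\<lambda>m. max_wave \<alpha> t (T m) x * indicator (ball 0 1) x) \<partial>\<mu>)"
      by (intro nn_integral_mono) (auto simp: indicator_def)
    also have "\<dots> \<le> liminf (\<lambda>m. \<integral>\<^sup>+x\<in>ball 0 1. max_wave \<alpha> t (T m) x \<partial>\<mu>)"
      by (intro nn_integral_liminf) measurable
    also have "\<dots> \<le> ennreal (C * ?D) * sobolev_sq \<sigma> F"
      by (intro Liminf_le always_eventually allI order_trans[OF bound[OF Tt fr]] mult_left_mono Ts) auto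
    finally show ?thesis .
  qed
  have "(\<integral>\<^sup>+x\<in>ball 0 1. (SUP n. ennreal (cmod (propagator \<alpha> (t n) f x)))\<^sup>2 \<partial>\<mu>) \<le> (\<integral>\<^sup>+x\<in>ball 0 1. max_wave \<alpha> t F x \<partial>\<mu>)"
    unfolding SUP_ennreal_square max_wave_def
    by (intro nn_integral_mono mult_right_mono SUP_mono') (auto simp: ennreal_power intro!: ennreal_leI power_mono pw)
  also have "\<dots> \<le> ennreal (C * ?D) * sobolev_sq \<sigma> F" by (rule key)
  also have "C * ?D = (sqrt C * sqrt ?D)\<^sup>2" using C D0 by (simp add: power_mult_distrib)
  finally show ?thesis unfolding L2_norm_on_def sobolev_norm_eq F_def
    using C D0 by (subst ennreal_sqrt_le_iff) auto
qed

lemma sobolev_norm_mono: "s \<le> s' \<Longrightarrow> sobolev_norm s f \<le> sobolev_norm s' f"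
  unfolding sobolev_norm_eq ennreal_power2_mono_iff[symmetric, of "ennreal_sqrt _"] ennreal_sqrt_square sobolev_sq_def
  by (intro nn_integral_mono ennreal_leI mult_right_mono powr_mono) auto

text \<open>For large \<open>\<delta>\<close> fewer than one member exceeds \<open>\<delta>\<close>.\<close>

lemma weak_ell_bounded:
  assumes "t \<in> weak_ell r" "r > 0"
  shows "\<exists>M. \<forall>n. \<bar>t n\<bar> \<le> M"
proof -
  obtain K where K: "0 \<le> K" "\<And>\<delta>. 0 < \<delta> \<Longrightarrow> real (card {n. \<delta> \<le> \<bar>t n\<bar>}) \<le> K * \<delta> powr - r"
    using weak_ell_card[OF assms(1)] by blast
  define \<delta> where "\<delta> = (K + 1) powr (1 / r)"
  have \<delta>: "\<delta> > 0" using K by (simp add: \<delta>_def)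
  have d: "\<delta> powr - r = 1 / (K + 1)"
  proof -
    have "\<delta> powr r = K + 1" unfolding \<delta>_def powr_powr using assms K by simp
    then show ?thesis unfolding powr_minus_divide by simp
  qed
  have "real (card {n. \<delta> \<le> \<bar>t n\<bar>}) < 1" 
  proof -
    have "K * \<delta> powr - r < 1" unfolding d using K(1) by (simp add: divide_less_eq)
    then show ?thesis using K(2)[OF \<delta>] by linarith
  qed
  then have "{n. \<delta> \<le> \<bar>t n\<bar>} = {}" using weak_ell_finite[OF assms(1) \<delta>] by simp
  then show ?thesis by (intro exI[of _ \<delta>]) (auto simp: not_le intro: less_imp_le)
qed

text \<open>The exponents \<open>a = 2 S / r\<close> and \<open>c = S / s0\<close> are those at which the counting bound and the
  short-time bound agree, and the formula for \<open>S\<close> expresses exactly \<open>\<alpha> = a + c \<theta>\<close>. The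
  assumption \<open>S < s0\<close> guarantees that \<open>N = R^c\<close> is at most \<open>R\<close>.\<close>

lemma sequential_bound_interpolated:
  fixes t :: "nat \<Rightarrow> real"
  assumes b: "maximal_bound TYPE('n::finite) \<alpha> \<gamma> ((real CARD('n) - \<gamma>) / 2 + s0) {-1..1} C"
    and par: "0 < \<alpha>" "\<gamma> \<le> real CARD('n)" "0 < r" "0 < s0" and t: "t \<in> weak_ell r"
    and S: "S = r * \<alpha> / (r * min \<alpha> 1 + 2 * s0) * s0" "S < s0"
  shows "\<exists>C3. sequential_bound TYPE('n) \<alpha> \<gamma> ((real CARD('n) - \<gamma>) / 2 + S) t C3"
proof -
  let ?\<kappa> = "real CARD('n) - \<gamma>" and ?\<theta> = "min \<alpha> 1"
  let ?Q = "r * ?\<theta> + 2 * s0"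
  have \<theta>: "0 < ?\<theta>" using par by simp
  have Q: "0 < ?Q" using par \<theta> by (simp add: add_pos_pos)
  have S0: "0 < S" unfolding S using par Q by simp
  define a where "a = 2 * S / r"
  define c where "c = S / s0"
  define e where "e = min (s0 / ?\<theta>) (r / 2)"
  have exponents: "\<alpha> = a + c * ?\<theta>"
  proof -
    have "a = 2 * \<alpha> * s0 / ?Q" unfolding a_def S using par by simp
    moreover have "c * ?\<theta> = r * \<alpha> * ?\<theta> / ?Q" unfolding c_def S using par by simp
    ultimately have "a + c * ?\<theta> = \<alpha> * ?Q / ?Q" by (simp add: add_divide_distrib[symmetric] algebra_simps)
    then show ?thesis using Q by simp
  qed
  have "(?\<kappa> / 2 + s0) > 0" using par by (simp add: add_nonneg_pos)
  from local_maximal_estimate[OF b this par(1)]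
  obtain C1 where "local_maximal_bound TYPE('n) \<alpha> \<gamma> (2 * (?\<kappa> / 2 + s0) - ?\<kappa>) C1" ..
  moreover have "2 * (k / 2 + s0) - k = 2 * s0" for k :: real by simp
  ultimately have C1: "local_maximal_bound TYPE('n) \<alpha> \<gamma> (2 * s0) C1" by (simp only:)
  have "\<exists>C2. weighted_bound TYPE('n) \<alpha> \<gamma> S a e t C2"
  proof (rule single_frequency_estimate[OF C1 t S0 _ _ _ \<theta> par(4) _ _ exponents])
    show "0 < a" "a * r = 2 * S" using S0 par by (auto simp: a_def)
    show "0 < c" "c \<le> 1" "c * s0 = S" using S0 S(2) par by (auto simp: c_def)
    show "0 < e" "e < r" using par \<theta> by (auto simp: e_def)
    have "?\<theta> * e \<le> ?\<theta> * (s0 / ?\<theta>)" using \<theta> by (intro mult_left_mono) (auto simp: e_def)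
    then show "?\<theta> * e \<le> s0" using \<theta> by simp
  qed
  then obtain C2 where "weighted_bound TYPE('n) \<alpha> \<gamma> S a e t C2" ..
  then show ?thesis
    by (rule dyadic_assembly) (use par \<theta> S0 in \<open>auto simp: a_def e_def\<close>)
qed

theorem corollary3p2:
  fixes \<alpha> \<gamma> r s_star s :: real and t :: "nat \<Rightarrow> real"
  assumes "0 < \<alpha>" and "0 < \<gamma>" and "\<gamma> \<le> real CARD('n::finite)" and "0 < r" and "0 < s_star"
    and "\<exists>C\<ge>0. \<forall>(f :: real^'n \<Rightarrow> complex) \<mu>. schwartz f \<longrightarrow> gamma_dimensional \<gamma> \<mu> \<longrightarrow>
           L2_norm_on \<mu> (ball 0 1)
             (\<lambda>x. SUP \<tau>\<in>{0<..<1}. ennreal (cmod (propagator \<alpha> \<tau> f x)))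
           \<le> ennreal (C * sqrt (dim_const \<gamma> \<mu>))
              * sobolev_norm ((real CARD('n) - \<gamma>) / 2 + s_star) f"
    and "t \<in> weak_ell r"
    and "min s_star (r * \<alpha> / (r * min \<alpha> 1 + 2 * s_star) * s_star) \<le> s"
  shows "\<exists>C'>0. \<forall>(f :: real^'n \<Rightarrow> complex) \<mu>. schwartz f \<longrightarrow> gamma_dimensional \<gamma> \<mu> \<longrightarrow>
           L2_norm_on \<mu> (ball 0 1)
             (\<lambda>x. SUP n. ennreal (cmod (propagator \<alpha> (t n) f x)))
           \<le> ennreal (C' * sqrt (dim_const \<gamma> \<mu>))
              * sobolev_norm ((real CARD('n) - \<gamma>) / 2 + s) f"
proof -
  let ?\<kappa> = "real CARD('n) - \<gamma>"
  define S where "S = r * \<alpha> / (r * min \<alpha> 1 + 2 * s_star) * s_star"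
  obtain C where C: "0 \<le> C" "\<And>(f :: real^'n \<Rightarrow> complex) \<mu>. schwartz f \<Longrightarrow> gamma_dimensional \<gamma> \<mu> \<Longrightarrow>
           L2_norm_on \<mu> (ball 0 1)
             (\<lambda>x. SUP \<tau>\<in>{0<..<1}. ennreal (cmod (propagator \<alpha> \<tau> f x)))
           \<le> ennreal (C * sqrt (dim_const \<gamma> \<mu>))
              * sobolev_norm (?\<kappa> / 2 + s_star) f"
    using assms(6) by blast
  have "?\<kappa> / 2 + s_star > 0" using assms by (simp add: add_nonneg_pos)
  from maximal_bound_tame[OF assms(1) this C] obtain C0 where C0: "maximal_bound TYPE('n) \<alpha> \<gamma> (?\<kappa> / 2 + s_star) {0<..<1} C0" ..
  have "\<exists>C3. sequential_bound TYPE('n) \<alpha> \<gamma> (?\<kappa> / 2 + min s_star S) t C3"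
  proof (cases "S < s_star")
    case True
    obtain C1 where "maximal_bound TYPE('n) \<alpha> \<gamma> (?\<kappa> / 2 + s_star) {-1..1} C1"
      using maximal_bound_long_time[OF C0, of 1] by blast
    from sequential_bound_interpolated[OF this assms(1,3,4,5,7) S_def True] True show ?thesis by simp
  next
    case False
    obtain M where M: "\<And>n. \<bar>t n\<bar> \<le> M" using weak_ell_bounded[OF assms(7,4)] by blast
    obtain C1 where "maximal_bound TYPE('n) \<alpha> \<gamma> (?\<kappa> / 2 + s_star) {-M..M} C1"
      using maximal_bound_long_time[OF C0, of M] by blast
    moreover have "t k \<in> {-M..M}" for k using M[of k] by (auto simp: abs_le_iff)
    ultimately show ?thesis using False unfolding maximal_bound_def sequential_bound_def by (intro exI[of _ C1]) auto
  qed
  then obtain C3 where C3: "sequential_bound TYPE('n) \<alpha> \<gamma> (?\<kappa> / 2 + min s_star S) t C3" ..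
  have C30: "0 \<le> C3" using C3 by (simp add: sequential_bound_def)
  show ?thesis
  proof (intro exI[of _ "sqrt C3 + 1"] conjI allI impI)
    show "0 < sqrt C3 + 1" using C30 by (simp add: add_nonneg_pos)
    fix f :: "real^'n \<Rightarrow> complex" and \<mu> :: "(real^'n) measure"
    assume f: "schwartz f" and \<mu>: "gamma_dimensional \<gamma> \<mu>"
    have "L2_norm_on \<mu> (ball 0 1) (\<lambda>x. SUP n. ennreal (cmod (propagator \<alpha> (t n) f x)))
       \<le> ennreal (sqrt C3 * sqrt (dim_const \<gamma> \<mu>)) * sobolev_norm (?\<kappa> / 2 + min s_star S) f"
      by (rule maximal_bound_schwartz[OF C3 f \<mu>])
    also have "\<dots> \<le> ennreal ((sqrt C3 + 1) * sqrt (dim_const \<gamma> \<mu>)) * sobolev_norm (?\<kappa> / 2 + s) f"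
      using dim_const_nonneg[OF \<mu>] assms(8) unfolding S_def
      by (intro mult_mono ennreal_leI mult_right_mono sobolev_norm_mono) auto
    finally show "L2_norm_on \<mu> (ball 0 1) (\<lambda>x. SUP n. ennreal (cmod (propagator \<alpha> (t n) f x)))
       \<le> ennreal ((sqrt C3 + 1) * sqrt (dim_const \<gamma> \<mu>)) * sobolev_norm (?\<kappa> / 2 + s) f" .
  qed
qed

end
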